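(* In the setting described in the context, suppose the reduced energy satisfies $\Gamma\not\equiv0$. Let $\pi:\widetilde K\to(K,0)$ be a common real analytic principalization of $J(\Gamma)$ and $(\Gamma)$, and let $F_1,\ldots,F_\ell$ be the irreducible components of the resulting normal-crossing divisor whose images contain $0$. Then $$\theta_{\mathrm{LS}}(E,0)=\mathcal L^{\mathbb R}_{(\Gamma)}(J(\Gamma))=\sup_\gamma\frac{\nu_\gamma(J(\Gamma))}{\nu_\gamma(\Gamma)}=\max_{\operatorname{ord}_{F_i}(\Gamma)>0}\frac{\operatorname{ord}_{F_i}(J(\Gamma))}{\operatorname{ord}_{F_i}(\Gamma)},$$ where the supremum is over real analytic arcs $\gamma:(\mathbb R,0)\to(K,0)$ with $\Gamma\circ\gamma\not\equiv0$. In particular, $\theta_{\mathrm{LS}}(E,0)$ is rational and is attained by a divisorial order, i.e. it equals $\operatorname{ord}_{F_i}(J(\Gamma))/\operatorname{ord}_{F_i}(\Gamma)$ for some $i$.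
   Context: Setting. $X,Y$ are real Banach spaces with a continuous bilinear pairing $\langle\cdot,\cdot\rangle_{Y,X}:Y\times X\to\mathbb R$; $U\subseteq X$ is an open neighborhood of $0$; $E:U\to\mathbb R$ is real analytic with $E(0)=0$, $dE(0)=0$; $M:U\to Y$ is a real analytic map with $dE(x)[v]=\langle M(x),v\rangle_{Y,X}$ for all $x\in U$, $v\in X$. Put $L:=DM(0):X\to Y$ and assume $L$ is Fredholm. Put $K:=\ker L$ and let $Z\subset X$ be a closed complement, $X=K\oplus Z$. Assume there is a topological splitting $Y=\operatorname{Ran}L\oplus Y_K$ with $Y_K=Z^\circ:=\{y\in Y:\langle y,z\rangle_{Y,X}=0\ \forall z\in Z\}$, and that the restriction map $\rho:Y_K\to K^*$, $\rho(y)=\langle y,\cdot\rangle_{Y,X}|_K$, is an isomorphism. Let $R:Y\to\operatorname{Ran}L$ be the projection along $Y_K$ and let $\psi:(K,0)\to(Z,0)$ be the unique real analytic germ with $RM(\xi+\psi(\xi))=0$ (analytic implicit function theorem). The reduced energy is $\Gamma(\xi):=E(\xi+\psi(\xi))$, a real analytic germ at $0\in K$. Exponent. $\theta_{\mathrm{LS}}(E,0):=\inf\{\theta\in[1/2,1):\exists C>0,\ \|M(x)\|_Y\ge C|E(x)|^\theta$ for all $x$ sufficiently close to $0\}$. Algebra. Fix linear coordinates $K\cong\mathbb R^r$ and let $A_{\mathbb R}=\mathbb R\{x_1,\ldots,x_r\}$ (convergent power series). $J(\Gamma)=(\partial\Gamma/\partial x_1,\ldots,\partial\Gamma/\partial x_r)$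 is the Jacobian ideal. For an ideal $I=(g_1,\ldots,g_s)\subset A_{\mathbb R}$ and a real analytic arc $\gamma:(\mathbb R,0)\to(\mathbb R^r,0)$, $\nu_\gamma(I)=\min_j\operatorname{ord}_t(g_j\circ\gamma)$; for $h\in A_{\mathbb R}$, $\nu_\gamma(h)=\operatorname{ord}_t(h\circ\gamma)$. The real integral closure $\overline I^{\,\mathbb R}$ is the set of $h\in A_{\mathbb R}$ with $\operatorname{ord}_t(h\circ\gamma)\ge\nu_\gamma(I)$ for every real analytic arc $\gamma$ at $0$ (equivalently $|h|\le C\max_j|g_j|$ near the origin). For $0\ne h\in A_{\mathbb R}$ with $h(0)=0$, $$\mathcal L^{\mathbb R}_{(h)}(I):=\inf\left\{\frac qp\in\mathbb Q_{>0}:h^q\in\overline{I^p}^{\,\mathbb R}\right\}.$$ Principalization. A common real analytic principalization of $J(\Gamma)$ and $(\Gamma)$ is a proper real analytic modification $\pi:\widetilde K\to(K,0)$ from a real analytic manifold onto a neighborhood of $0$ (as produced by real-analytic principalization in characteristic zero, by blowing up) together with a normal-crossing divisor in $\widetilde K$ such that near each point of $\pi^{-1}(0)$ there are local coordinates $y_1,\ldots,y_r$, with the divisor components given by some of the $y_j=0$, and analytic units $u,v$ with $\pi^*\Gamma=u\prod_j y_j^{a_j}$ and $J(\Gamma)\cdot\mathcal O_{\widetilde K}=(v\prod_j y_j^{b_j})$. For a component $F$ given locally by $y_j=0$, $\operatorname{ord}_F(\Gamma)=a_j$ and $\operatorname{ord}_F(J(\Gamma))=b_j$. *)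

theory Defs
  imports "HOL-Analysis.Analysis"
begin

section \<open>Real analytic maps between normed spaces\<close>

text \<open>
  An \<open>n\<close>-linear map takes its arguments as the first \<open>n\<close> entries of a sequence; \<open>C\<close> is a bound for
  its norm. Symmetry is not required, since only the values on the diagonal enter a power series.
\<close>

definition multilinear_bounded ::
  "nat \<Rightarrow> real \<Rightarrow> ((nat \<Rightarrow> 'a::real_normed_vector) \<Rightarrow> 'b::real_normed_vector) \<Rightarrow> bool" where
  "multilinear_bounded n C a \<longleftrightarrow>
     0 \<le> C \<and>
     (\<forall>h k. (\<forall>i<n. h i = k i) \<longrightarrow> a h = a k) \<and>
     (\<forall>h. \<forall>i<n. linear (\<lambda>v. a (h(i := v)))) \<and>
     (\<forall>h. norm (a h) \<le> C * (\<Prod>i<n. norm (h i)))"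

definition real_analytic_at ::
  "('a::real_normed_vector \<Rightarrow> 'b::real_normed_vector) \<Rightarrow> 'a \<Rightarrow> bool" where
  "real_analytic_at f x \<longleftrightarrow>
     (\<exists>a C r. 0 < r \<and> (\<forall>n. multilinear_bounded n (C n) (a n)) \<and> summable (\<lambda>n. C n * r ^ n) \<and>
        (\<forall>h. norm h < r \<longrightarrow> (\<lambda>n. a n (\<lambda>_. h)) sums f (x + h)))"

section \<open>Linear functional analysis\<close>

definition fredholm :: "('a::real_normed_vector \<Rightarrow> 'b::real_normed_vector) \<Rightarrow> bool" where
  "fredholm L \<longleftrightarrow>
     bounded_linear L \<and>
     (\<exists>B. finite B \<and> {x. L x = 0} = span B) \<and>
     closed (range L) \<and>
     (\<exists>B. finite B \<and> span (range L \<union> B) = UNIV)"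

definition closed_complement :: "'a::real_normed_vector set \<Rightarrow> 'a set \<Rightarrow> bool" where
  "closed_complement K Z \<longleftrightarrow>
     subspace Z \<and> closed Z \<and> K \<inter> Z = {0} \<and> (\<forall>x. \<exists>k\<in>K. \<exists>z\<in>Z. x = k + z)"

text \<open>
  \<open>R\<close> is the continuous projection onto \<open>A\<close> along \<open>B\<close>; its existence is what makes the splitting
  of the whole space into \<open>A\<close> and \<open>B\<close> a topological one.
\<close>

definition splitting_projection ::
  "('a::real_normed_vector \<Rightarrow> 'a) \<Rightarrow> 'a set \<Rightarrow> 'a set \<Rightarrow> bool" where
  "splitting_projection R A B \<longleftrightarrow>
     bounded_linear R \<and> range R = A \<and> (\<forall>y\<in>A. R y = y) \<and> {y. R y = 0} = B"

definition annihilator :: "('b \<Rightarrow> 'a \<Rightarrow> real) \<Rightarrow> 'a set \<Rightarrow> 'b set" where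
  "annihilator pair Z = {y. \<forall>z\<in>Z. pair y z = 0}"

text \<open>Functionals on a subspace are represented as functions that are \<open>undefined\<close> outside it.\<close>

definition dual_space :: "'a::real_normed_vector set \<Rightarrow> ('a \<Rightarrow> real) set" where
  "dual_space K =
     {\<phi> \<in> extensional K.
        (\<forall>u\<in>K. \<forall>v\<in>K. \<phi> (u + v) = \<phi> u + \<phi> v) \<and>
        (\<forall>c. \<forall>u\<in>K. \<phi> (c *\<^sub>R u) = c * \<phi> u) \<and>
        (\<exists>C. \<forall>u\<in>K. \<bar>\<phi> u\<bar> \<le> C * norm u)}"

section \<open>The Lojasiewicz--Simon exponent at the origin\<close>

text \<open>Extended reals are used so that an infimum over the empty set is \<open>\<infinity>\<close>.\<close>

definition LS_exponent ::
  "('a::real_normed_vector \<Rightarrow> real) \<Rightarrow> ('a \<Rightarrow> 'b::real_normed_vector) \<Rightarrow> ereal" where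
  "LS_exponent E M =
     Inf (ereal ` {\<theta>. 1/2 \<le> \<theta> \<and> \<theta> < 1 \<and>
       (\<exists>C>0. \<forall>\<^sub>F x in nhds 0. norm (M x) \<ge> C * \<bar>E x\<bar> powr \<theta>)})"

section \<open>Arcs, orders and the real integral closure\<close>

definition analytic_arc :: "(real \<Rightarrow> 'a::real_normed_vector) \<Rightarrow> bool" where
  "analytic_arc \<gamma> \<longleftrightarrow> real_analytic_at \<gamma> 0 \<and> \<gamma> 0 = 0"

text \<open>The order in \<open>t\<close> of an analytic germ at \<open>0\<close>; it is \<open>\<infinity>\<close> for the zero germ.\<close>

definition ord_t :: "(real \<Rightarrow> real) \<Rightarrow> enat" where
  "ord_t f = (INF n\<in>{n. (deriv ^^ n) f 0 \<noteq> 0}. enat n)"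

text \<open>
  An ideal of convergent power series is given by a finite set \<open>G\<close> of generators. The order of the
  principal ideal of \<open>h\<close> along \<open>\<gamma>\<close> is \<open>arc_order \<gamma> {h}\<close>.
\<close>

definition arc_order :: "(real \<Rightarrow> 'a) \<Rightarrow> ('a \<Rightarrow> real) set \<Rightarrow> enat" where
  "arc_order \<gamma> G = (INF g\<in>G. ord_t (g \<circ> \<gamma>))"

definition ideal_power :: "('a \<Rightarrow> real) set \<Rightarrow> nat \<Rightarrow> ('a \<Rightarrow> real) set" where
  "ideal_power G p = {\<lambda>x. \<Prod>i<p. g i x | g. \<forall>i<p. g i \<in> G}"

definition real_integral_closure ::
  "('a::real_normed_vector \<Rightarrow> real) set \<Rightarrow> ('a \<Rightarrow> real) set" where
  "real_integral_closure G =
     {h. real_analytic_at h 0 \<and> (\<forall>\<gamma>. analytic_arc \<gamma> \<longrightarrow> arc_order \<gamma> G \<le> ord_t (h \<circ> \<gamma>))}"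

definition lojasiewicz_exponent ::
  "('a::real_normed_vector \<Rightarrow> real) \<Rightarrow> ('a \<Rightarrow> real) set \<Rightarrow> ereal" where
  "lojasiewicz_exponent h G =
     Inf {ereal (real q / real p) | q p.
            0 < q \<and> 0 < p \<and> (\<lambda>x. h x ^ q) \<in> real_integral_closure (ideal_power G p)}"

definition jacobian_ideal :: "(real ^ 'r \<Rightarrow> real) \<Rightarrow> (real ^ 'r \<Rightarrow> real) set" where
  "jacobian_ideal g = range (\<lambda>i x. deriv (\<lambda>t. g (x + t *\<^sub>R axis i 1)) 0)"

section \<open>Real analytic manifolds\<close>

text \<open>
  A manifold is a type with an atlas; its points are all elements of the type. A chart \<open>(V, y)\<close>
  consists of an open set and a coordinate map, of which only the values on \<open>V\<close> matter.
\<close>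

definition analytic_atlas ::
  "('m::{t2_space,second_countable_topology} set \<times> ('m \<Rightarrow> real ^ 'r)) set \<Rightarrow> bool" where
  "analytic_atlas A \<longleftrightarrow>
     (\<forall>(V, y)\<in>A. open V \<and> open (y ` V) \<and> homeomorphism V (y ` V) y (inv_into V y)) \<and>
     (\<Union>(V, y)\<in>A. V) = UNIV \<and>
     (\<forall>(V, y)\<in>A. \<forall>(W, z)\<in>A. \<forall>x \<in> y ` (V \<inter> W). real_analytic_at (z \<circ> inv_into V y) x)"

text \<open>Local analytic coordinates are the charts compatible with the atlas.\<close>

definition analytic_chart ::
  "('m::{t2_space,second_countable_topology} set \<times> ('m \<Rightarrow> real ^ 'r)) set \<Rightarrow>
     'm set \<Rightarrow> ('m \<Rightarrow> real ^ 'r) \<Rightarrow> bool" where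
  "analytic_chart A V y \<longleftrightarrow> analytic_atlas (insert (V, y) A)"

definition manifold_analytic_at ::
  "('m::{t2_space,second_countable_topology} set \<times> ('m \<Rightarrow> real ^ 'r)) set \<Rightarrow>
     ('m \<Rightarrow> 'b::real_normed_vector) \<Rightarrow> 'm \<Rightarrow> bool" where
  "manifold_analytic_at A f p \<longleftrightarrow>
     (\<exists>(V, y)\<in>A. p \<in> V \<and> real_analytic_at (f \<circ> inv_into V y) (y p))"

text \<open>
  In the next two definitions \<open>an f p\<close> says that \<open>f\<close> is analytic at \<open>p\<close>, so that they apply
  both to Euclidean space and to manifolds. \<open>germ_ideal an p G\<close> is the ideal generated by the finite
  set \<open>G\<close> in the ring of analytic germs at \<open>p\<close>, germs being represented by functions.
\<close>

definition analytic_subset ::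
  "(('a::topological_space \<Rightarrow> real) \<Rightarrow> 'a \<Rightarrow> bool) \<Rightarrow> 'a set \<Rightarrow> 'a set \<Rightarrow> bool" where
  "analytic_subset an W S \<longleftrightarrow>
     S \<subseteq> W \<and>
     (\<forall>p\<in>W. \<exists>V G. open V \<and> p \<in> V \<and> V \<subseteq> W \<and> finite G \<and> (\<forall>g\<in>G. \<forall>q\<in>V. an g q) \<and>
        S \<inter> V = {q\<in>V. \<forall>g\<in>G. g q = 0})"

definition germ_ideal ::
  "(('a::topological_space \<Rightarrow> real) \<Rightarrow> 'a \<Rightarrow> bool) \<Rightarrow> 'a \<Rightarrow> ('a \<Rightarrow> real) set \<Rightarrow> ('a \<Rightarrow> real) set" where
  "germ_ideal an p G =
     {h. \<exists>c. (\<forall>g\<in>G. an (c g) p) \<and> (\<forall>\<^sub>F q in nhds p. h q = (\<Sum>g\<in>G. c g q * g q))}"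

definition irreducible_analytic_subset ::
  "(('a::topological_space \<Rightarrow> real) \<Rightarrow> 'a \<Rightarrow> bool) \<Rightarrow> 'a set \<Rightarrow> 'a set \<Rightarrow> bool" where
  "irreducible_analytic_subset an W S \<longleftrightarrow>
     S \<noteq> {} \<and> analytic_subset an W S \<and>
     \<not> (\<exists>S1 S2. analytic_subset an W S1 \<and> analytic_subset an W S2 \<and>
           S1 \<subset> S \<and> S2 \<subset> S \<and> S = S1 \<union> S2)"

section \<open>Modifications and principalizations\<close>

text \<open>
  A proper analytic surjection onto the open set \<open>W\<close> that is bianalytic, with inverse \<open>\<sigma>\<close>, over the
  complement of an analytic subset \<open>S\<close>, where neither \<open>S\<close> nor its preimage has interior points.
\<close>

definition proper_analytic_modification ::
  "('m::{t2_space,second_countable_topology} set \<times> ('m \<Rightarrow> real ^ 'r)) set \<Rightarrow>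
     (real ^ 'r) set \<Rightarrow> ('m \<Rightarrow> real ^ 'r) \<Rightarrow> bool" where
  "proper_analytic_modification A W \<pi> \<longleftrightarrow>
     analytic_atlas A \<and> open W \<and> range \<pi> = W \<and>
     (\<forall>p. manifold_analytic_at A \<pi> p) \<and>
     (\<forall>C. compact C \<and> C \<subseteq> W \<longrightarrow> compact (\<pi> -` C)) \<and>
     (\<exists>S \<sigma>. analytic_subset real_analytic_at W S \<and>
        interior S = {} \<and> interior (\<pi> -` S) = {} \<and>
        (\<forall>x\<in>W - S. \<pi> (\<sigma> x) = x) \<and> (\<forall>p. \<pi> p \<notin> S \<longrightarrow> \<sigma> (\<pi> p) = p) \<and>
        continuous_on (W - S) \<sigma> \<and>
        (\<forall>x\<in>W - S. \<forall>(V, y)\<in>A. \<sigma> x \<in> V \<longrightarrow> real_analytic_at (y \<circ> \<sigma>) x))"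

text \<open>
  Coordinates centred at \<open>p\<close> in which the components in \<open>D\<close> through \<open>p\<close> are distinct coordinate
  hyperplanes (\<open>F\<close> is given by the vanishing of the coordinate with index \<open>j F\<close>) and which
  no other component meets.
\<close>

definition crossing_chart ::
  "('m::{t2_space,second_countable_topology} set \<times> ('m \<Rightarrow> real ^ 'r)) set \<Rightarrow>
     'm set set \<Rightarrow> 'm \<Rightarrow> 'm set \<Rightarrow> ('m \<Rightarrow> real ^ 'r) \<Rightarrow> ('m set \<Rightarrow> 'r) \<Rightarrow> bool" where
  "crossing_chart A D p V y j \<longleftrightarrow>
     analytic_chart A V y \<and> p \<in> V \<and> y p = 0 \<and>
     inj_on j {F\<in>D. p \<in> F} \<and>
     (\<forall>F\<in>D. F \<inter> V = (if p \<in> F then {q\<in>V. y q $ j F = 0} else {}))"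

text \<open>The set \<open>D\<close> is the set of irreducible components of the divisor.\<close>

definition normal_crossing_divisor ::
  "('m::{t2_space,second_countable_topology} set \<times> ('m \<Rightarrow> real ^ 'r)) set \<Rightarrow> 'm set set \<Rightarrow> bool" where
  "normal_crossing_divisor A D \<longleftrightarrow>
     (\<forall>F\<in>D. irreducible_analytic_subset (manifold_analytic_at A) UNIV F) \<and>
     (\<forall>p. \<exists>V y j. crossing_chart A D p V y j)"

text \<open>
  \<open>a F\<close> and \<open>b F\<close> are the orders along the component \<open>F\<close> of \<open>\<Gamma>\<close> and of its Jacobian ideal: near
  every point of the fibre over \<open>0\<close> the pullback of \<open>\<Gamma>\<close> and the inverse image ideal sheaf of the
  Jacobian ideal are, up to units, the monomials with these exponents.
  The values on components not meeting that fibre are irrelevant.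
\<close>

definition common_principalization ::
  "(real ^ 'r \<Rightarrow> real) \<Rightarrow>
     ('m::{t2_space,second_countable_topology} set \<times> ('m \<Rightarrow> real ^ 'r)) set \<Rightarrow>
     (real ^ 'r) set \<Rightarrow> ('m \<Rightarrow> real ^ 'r) \<Rightarrow>
     'm set set \<Rightarrow> ('m set \<Rightarrow> nat) \<Rightarrow> ('m set \<Rightarrow> nat) \<Rightarrow> bool" where
  "common_principalization \<Gamma> A W \<pi> D a b \<longleftrightarrow>
     0 \<in> W \<and> proper_analytic_modification A W \<pi> \<and> normal_crossing_divisor A D \<and>
     (\<forall>p. \<pi> p = 0 \<longrightarrow>
       (\<exists>V y j u v. crossing_chart A D p V y j \<and>
          (\<forall>q\<in>V. manifold_analytic_at A u q \<and> u q \<noteq> 0 \<and> manifold_analytic_at A v q \<and> v q \<noteq> 0) \<and>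
          (\<forall>q\<in>V. \<Gamma> (\<pi> q) = u q * (\<Prod>F\<in>{F\<in>D. p \<in> F}. (y q $ j F) ^ a F)) \<and>
          germ_ideal (manifold_analytic_at A) p ((\<lambda>g. g \<circ> \<pi>) ` jacobian_ideal \<Gamma>) =
          germ_ideal (manifold_analytic_at A) p
            {\<lambda>q. v q * (\<Prod>F\<in>{F\<in>D. p \<in> F}. (y q $ j F) ^ b F)}))"

end

theory Submission
  imports Defs
begin

text \<open>
  All four quantities are read off from one family of inequalities,
  \<open>C * \<bar>\<Gamma> x\<bar> powr \<theta> \<le> (\<Sum>g\<in>jacobian_ideal \<Gamma>. \<bar>g x\<bar>)\<close> near the origin of the kernel, with the reduced
  energy \<open>\<Gamma>\<close>. Write \<open>P\<close> for the reduction map \<open>\<kappa> + \<psi> \<circ> \<kappa>\<close>.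

  The differential of \<open>\<Gamma>\<close> at \<open>a\<close> is the restriction to the kernel of the functional given by
  \<open>M (P a)\<close>, and \<open>\<rho>\<close> being bijective, the norms of both are comparable. Substituting \<open>P a\<close>
  therefore turns the inequality for \<open>E\<close> into the one for \<open>\<Gamma>\<close> (\<open>reduced_inequality\<close>). Conversely, a point \<open>x\<close> near \<open>0\<close> is \<open>P a + w\<close> with \<open>w\<close> in
  the complement \<open>Z\<close>; the part of \<open>M x\<close> in the range of \<open>L\<close> controls \<open>w\<close>, and \<open>E x - \<Gamma> a\<close> is quadratic in
  \<open>w\<close> because \<open>M (P a)\<close> annihilates \<open>Z\<close>. This is harmless for exponents of at least \<open>1/2\<close>
  (\<open>lifted_inequality\<close>). The bound of \<open>w\<close> rests on the bounded inverse theorem, which is derived from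
  Baire's theorem (\<open>bounded_below_on_complement\<close>).

  In crossing coordinates of a principalization both sides of the inequality are comparable to monomials
  with exponents \<open>\<theta> * ord_\<Gamma> F\<close> and \<open>ord_J F\<close> (\<open>local_model\<close>), so that it holds near a point of the fibre
  as soon as \<open>ord_J F \<le> \<theta> * ord_\<Gamma> F\<close> for the components \<open>F\<close> through that point. The fibre is compact and
  the modification is proper, so these local inequalities give the inequality near the origin
  (\<open>gradient_inequality\<close>), with \<open>\<theta>\<close> the maximum of the quotients \<open>ord_J F / ord_\<Gamma> F\<close>. Integrating the
  gradient of \<open>\<Gamma> \<circ> \<pi>\<close> along lines in these coordinates shows that \<open>ord_J F < ord_\<Gamma> F\<close> or both orders are
  zero (\<open>monomial_gradient_exponents\<close>), hence that this maximum is less than one and that the components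
  with \<open>ord_\<Gamma> F = 0\<close> impose no condition.

  An inequality with exponent \<open>\<theta>\<close>, restricted to an arc, bounds the quotient of the orders along the arc
  by \<open>\<theta>\<close> (\<open>arc_ratio_le\<close>). The image of an arc upstairs that is tangent to a component \<open>F\<close> to high order
  has a quotient arbitrarily close to \<open>ord_J F / ord_\<Gamma> F\<close> (\<open>divisorial_ratio_le_SUP\<close>). So the supremum over
  arcs is the maximum over the divisor and no smaller exponent is admissible. A line on which the leading
  form of \<open>\<Gamma>\<close> does not vanish shows that it is at least \<open>1/2\<close> (\<open>half_le_SUP\<close>). Finally, membership in
  the real integral closure is a condition on the same quotients (\<open>lojasiewicz_exponent_eq_SUP\<close>).

  Analyticity is defined by series of bounded multilinear maps between normed spaces. The arguments above
  use that it is preserved by composition (\<open>real_analytic_at_compose\<close>) and the Lipschitz estimate for tails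
  of a series (\<open>power_series_tail_lipschitz\<close>).
\<close>

section \<open>Multilinear maps on the diagonal\<close>

lemma multilinear_bounded_nonneg: "multilinear_bounded n C a \<Longrightarrow> 0 \<le> C"
  by (simp add: multilinear_bounded_def)

lemma multilinear_bounded_cong:
  "multilinear_bounded n C a \<Longrightarrow> (\<And>i. i < n \<Longrightarrow> h i = k i) \<Longrightarrow> a h = a k"
  unfolding multilinear_bounded_def by blast

lemma multilinear_bounded_linear:
  "multilinear_bounded n C a \<Longrightarrow> i < n \<Longrightarrow> linear (\<lambda>v. a (h(i := v)))"
  unfolding multilinear_bounded_def by blast

lemma multilinear_bounded_norm:
  "multilinear_bounded n C a \<Longrightarrow> norm (a h) \<le> C * (\<Prod>i<n. norm (h i))"
  unfolding multilinear_bounded_def by blast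

lemma multilinear_bounded_norm_le:
  assumes "multilinear_bounded n C a" "\<And>i. i < n \<Longrightarrow> norm (h i) \<le> \<phi> i"
  shows "norm (a h) \<le> C * (\<Prod>i<n. \<phi> i)"
proof -
  have "(\<Prod>i<n. norm (h i)) \<le> (\<Prod>i<n. \<phi> i)"
    by (rule prod_mono) (use assms(2) in auto)
  then show ?thesis
    using multilinear_bounded_norm[OF assms(1), of h] multilinear_bounded_nonneg[OF assms(1)]
    by (meson mult_left_mono order_trans)
qed

lemma multilinear_bounded_bounded_linear:
  assumes "multilinear_bounded n C a" "i < n"
  shows "bounded_linear (\<lambda>v. a (h(i := v)))"
proof -
  have "norm (a (h(i := v))) \<le> norm v * (C * (\<Prod>j\<in>{..<n} - {i}. norm (h j)))" for v
  proof -
    have "(\<Prod>j<n. norm ((h(i := v)) j)) = norm v * (\<Prod>j\<in>{..<n} - {i}. norm ((h(i := v)) j))"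
      using assms(2) by (subst prod.remove[of _ i]) auto
    also have "(\<Prod>j\<in>{..<n} - {i}. norm ((h(i := v)) j)) = (\<Prod>j\<in>{..<n} - {i}. norm (h j))"
      by (rule prod.cong) auto
    finally show ?thesis
      using multilinear_bounded_norm[OF assms(1), of "h(i := v)"] by (simp add: mult_ac)
  qed
  then show ?thesis
    using multilinear_bounded_linear[OF assms] by (auto simp: bounded_linear_def bounded_linear_axioms_def)
qed

lemma multilinear_bounded_diag_norm:
  assumes "multilinear_bounded n C a" "norm h \<le> \<rho>"
  shows "norm (a (\<lambda>_. h)) \<le> C * \<rho> ^ n"
  using multilinear_bounded_norm_le[OF assms(1), of "\<lambda>_. h" "\<lambda>_. \<rho>"] assms(2) by simp

text \<open>Homogeneity on the diagonal; in one variable it turns the series of multilinear maps into an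
  ordinary power series.\<close>

lemma multilinear_bounded_diag_scaleR:
  assumes a: "multilinear_bounded n C a"
  shows "a (\<lambda>_. c *\<^sub>R h) = c ^ n *\<^sub>R a (\<lambda>_. h)"
proof -
  have "k \<le> n \<Longrightarrow> a (\<lambda>i. if i < k then c *\<^sub>R h else h) = c ^ k *\<^sub>R a (\<lambda>_. h)" for k
  proof (induction k)
    case (Suc k)
    let ?g = "\<lambda>i. if i < k then c *\<^sub>R h else h"
    have "a (\<lambda>i. if i < Suc k then c *\<^sub>R h else h) = a (?g(k := c *\<^sub>R h))"
      by (rule arg_cong[of _ _ a]) (auto simp: fun_eq_iff)
    also have "\<dots> = c *\<^sub>R a (?g(k := h))"
      using linear_scale[OF multilinear_bounded_linear[OF a, of k ?g], of c h] Suc.prems by simp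
    also have "?g(k := h) = ?g" by auto
    finally show ?case using Suc by simp
  qed auto
  from this[of n] show ?thesis
    using multilinear_bounded_cong[OF a, of "\<lambda>i. if i < n then c *\<^sub>R h else h" "\<lambda>_. c *\<^sub>R h"]
    by auto
qed

text \<open>Replacing the arguments one at a time turns the difference of two diagonal values into a
  telescoping sum of \<open>n\<close> terms that each contain the factor \<open>h - k\<close>.\<close>

lemma multilinear_bounded_diag_diff:
  assumes a: "multilinear_bounded n C a" and "norm h \<le> \<rho>" "norm k \<le> \<rho>"
  shows "norm (a (\<lambda>_. h) - a (\<lambda>_. k)) \<le> real n * C * \<rho> ^ (n - 1) * norm (h - k)"
proof -
  have "m \<le> n \<Longrightarrow> norm (a (\<lambda>i. if i < m then h else k) - a (\<lambda>_. k))
      \<le> real m * (C * \<rho> ^ (n - 1) * norm (h - k))" for m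
  proof (induction m)
    case (Suc m)
    let ?g = "\<lambda>i. if i < m then h else k"
    let ?d = "?g(m := h - k)"
    have "a (\<lambda>i. if i < Suc m then h else k) = a (?g(m := h))"
      by (rule arg_cong[of _ _ a]) (auto simp: fun_eq_iff)
    moreover have "?g = ?g(m := k)" by auto
    ultimately have "a (\<lambda>i. if i < Suc m then h else k) - a ?g = a (?g(m := h)) - a (?g(m := k))"
      by argo
    also have "\<dots> = a ?d"
      using linear_diff[OF multilinear_bounded_linear[OF a, of m ?g], of h k] Suc.prems by simp
    finally have "norm (a (\<lambda>i. if i < Suc m then h else k) - a ?g) = norm (a ?d)" by simp
    also have "\<dots> \<le> C * (\<Prod>i<n. if i = m then norm (h - k) else \<rho>)"
      by (rule multilinear_bounded_norm_le[OF a]) (use assms in auto)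
    also have "(\<Prod>i<n. if i = m then norm (h - k) else \<rho>) = norm (h - k) * \<rho> ^ (n - 1)"
      using Suc.prems by (subst prod.remove[of _ m]) auto
    finally have 1: "norm (a (\<lambda>i. if i < Suc m then h else k) - a ?g)
        \<le> C * \<rho> ^ (n - 1) * norm (h - k)" by (simp add: mult_ac)
    have "norm (a (\<lambda>i. if i < Suc m then h else k) - a (\<lambda>_. k))
      \<le> norm (a (\<lambda>i. if i < Suc m then h else k) - a ?g) + norm (a ?g - a (\<lambda>_. k))"
      by norm
    also have "\<dots> \<le> C * \<rho> ^ (n - 1) * norm (h - k) + real m * (C * \<rho> ^ (n - 1) * norm (h - k))"
      using 1 Suc by (intro add_mono) auto
    finally show ?case by (simp add: algebra_simps)
  qed simp
  moreover have "a (\<lambda>i. if i < n then h else k) = a (\<lambda>_. h)"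
    by (rule multilinear_bounded_cong[OF a]) simp
  ultimately show ?thesis by (metis order_refl mult.assoc)
qed

section \<open>Local estimates for power series\<close>

text \<open>Analyticity with its witnesses made explicit.\<close>

definition power_series_at ::
  "('a::real_normed_vector \<Rightarrow> 'b::real_normed_vector) \<Rightarrow> 'a \<Rightarrow> (nat \<Rightarrow> (nat \<Rightarrow> 'a) \<Rightarrow> 'b) \<Rightarrow>
     (nat \<Rightarrow> real) \<Rightarrow> real \<Rightarrow> bool" where
  "power_series_at f x a C r \<longleftrightarrow>
     0 < r \<and> (\<forall>n. multilinear_bounded n (C n) (a n)) \<and> summable (\<lambda>n. C n * r ^ n) \<and>
     (\<forall>h. norm h < r \<longrightarrow> (\<lambda>n. a n (\<lambda>_. h)) sums f (x + h))"

lemma power_series_atD: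
  assumes "power_series_at f x a C r"
  shows "0 < r" "multilinear_bounded n (C n) (a n)" "summable (\<lambda>n. C n * r ^ n)"
    "norm h < r \<Longrightarrow> (\<lambda>n. a n (\<lambda>_. h)) sums f (x + h)"
  using assms unfolding power_series_at_def by auto

lemma real_analytic_atE:
  assumes "real_analytic_at f x"
  obtains a C r where "power_series_at f x a C r"
  using assms unfolding real_analytic_at_def power_series_at_def by blast

definition series_tail where
  "series_tail f x a m h = f (x + h) - (\<Sum>n<m. a n (\<lambda>_::nat. h))"

text \<open>The series without its first \<open>m\<close> terms is Lipschitz near the centre with a constant of size
  \<open>s ^ (m - 1)\<close> on the ball of radius \<open>s\<close>. For \<open>m = 1\<close> this is local Lipschitz continuity, for
  \<open>m = 2\<close> strict differentiability, and for \<open>m\<close> the order of a function it bounds the gradient.\<close>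

lemma power_series_tail_lipschitz:
  fixes f :: "'a::real_normed_vector \<Rightarrow> 'b::banach"
  assumes ps: "power_series_at f x a C r" and m: "0 < m"
  obtains B where "0 < B"
    "\<And>h k s. norm h \<le> s \<Longrightarrow> norm k \<le> s \<Longrightarrow> s \<le> r / 2 \<Longrightarrow>
       norm (series_tail f x a m h - series_tail f x a m k) \<le> B * s ^ (m - 1) * norm (h - k)"
proof -
  note r = power_series_atD(1)[OF ps] and a = power_series_atD(2)[OF ps]
    and C = power_series_atD(3)[OF ps] and f = power_series_atD(4)[OF ps]
  define S where "S = (\<Sum>n. C n * r ^ n)"
  define B where "B = (2 / r) ^ m * S + 1"
  have C0: "0 \<le> C n" for n using a multilinear_bounded_nonneg by blast
  have S0: "0 \<le> S" unfolding S_def by (rule suminf_nonneg[OF C]) (use C0 r in auto)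
  have tail: "(\<Sum>n. C (n + m) * r ^ (n + m)) \<le> S"
    unfolding S_def using suminf_split_initial_segment[OF C, of m]
    by (simp add: C0 less_imp_le[OF r] sum_nonneg)
  show ?thesis
  proof
    show "0 < B" unfolding B_def using S0 r by (simp add: add_nonneg_pos)
    fix h k :: 'a and s
    assume hk: "norm h \<le> s" "norm k \<le> s" "s \<le> r / 2"
    have s0: "0 \<le> s" using hk(1) norm_ge_zero order_trans by blast
    have hr: "norm h < r" "norm k < r" using hk r by auto
    let ?t = "\<lambda>n. a n (\<lambda>_. h) - a n (\<lambda>_. k)"
    have "?t sums (f (x + h) - f (x + k))"
      by (intro sums_diff f hr)
    then have "(\<lambda>n. ?t (n + m)) sums (f (x + h) - f (x + k) - (\<Sum>n<m. ?t n))"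
      by (subst sums_iff_shift) simp
    also have "f (x + h) - f (x + k) - (\<Sum>n<m. ?t n) = series_tail f x a m h - series_tail f x a m k"
      by (simp add: series_tail_def sum_subtractf)
    finally have 1: "(\<lambda>n. ?t (n + m)) sums \<dots>" .
    let ?g = "\<lambda>n. (C (n + m) * r ^ (n + m)) * ((2 / r) ^ m * s ^ (m - 1) * norm (h - k))"
    have 2: "?g sums ((\<Sum>n. C (n + m) * r ^ (n + m)) * ((2 / r) ^ m * s ^ (m - 1) * norm (h - k)))"
      by (intro sums_mult2 summable_sums summable_ignore_initial_segment[OF C])
    have 3: "norm (?t (n + m)) \<le> ?g n" for n
    proof -
      \<comment> \<open>Halving the radius pays for the factor that the difference of two terms of degree \<open>n + m\<close> costs.\<close>
      have "real (n + m) \<le> 2 ^ (n + m)"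
        using of_nat_less_two_power[of "n + m", where ?'a = real] by (simp add: less_imp_le)
      then have "real (n + m) * s ^ n \<le> 2 ^ (n + m) * (r / 2) ^ n"
        using s0 hk by (intro mult_mono power_mono) auto
      also have "\<dots> = r ^ (n + m) * (2 / r) ^ m"
        using r by (simp add: power_add power_divide)
      finally have *: "real (n + m) * s ^ n \<le> r ^ (n + m) * (2 / r) ^ m" .
      have "norm (?t (n + m)) \<le> real (n + m) * C (n + m) * s ^ (n + m - 1) * norm (h - k)"
        by (rule multilinear_bounded_diag_diff[OF a]) (use hk in auto)
      also have "s ^ (n + m - 1) = s ^ n * s ^ (m - 1)"
        using m by (simp flip: power_add)
      also have "real (n + m) * C (n + m) * (s ^ n * s ^ (m - 1)) * norm (h - k)
         = (real (n + m) * s ^ n) * (C (n + m) * s ^ (m - 1) * norm (h - k))" by simp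
      also have "\<dots> \<le> (r ^ (n + m) * (2 / r) ^ m) * (C (n + m) * s ^ (m - 1) * norm (h - k))"
        by (rule mult_right_mono[OF *]) (use C0 s0 in auto)
      finally show ?thesis by (simp add: mult_ac)
    qed
    have "norm (series_tail f x a m h - series_tail f x a m k)
       \<le> (\<Sum>n. C (n + m) * r ^ (n + m)) * ((2 / r) ^ m * s ^ (m - 1) * norm (h - k))"
      by (rule norm_sums_le[OF 1 2]) (rule 3)
    also have "\<dots> \<le> S * ((2 / r) ^ m * s ^ (m - 1) * norm (h - k))"
      by (rule mult_right_mono[OF tail]) (use s0 r in auto)
    also have "\<dots> \<le> B * s ^ (m - 1) * norm (h - k)"
      unfolding B_def using s0 by (simp add: algebra_simps)
    finally show "norm (series_tail f x a m h - series_tail f x a m k) \<le> B * s ^ (m - 1) * norm (h - k)" .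
  qed
qed

lemma analytic_locally_lipschitz:
  fixes f :: "'a::real_normed_vector \<Rightarrow> 'b::banach"
  assumes "real_analytic_at f x"
  obtains B \<rho> where "0 < B" "0 < \<rho>"
    "\<And>y z. norm (y - x) < \<rho> \<Longrightarrow> norm (z - x) < \<rho> \<Longrightarrow> norm (f y - f z) \<le> B * norm (y - z)"
proof -
  obtain a C r where ps: "power_series_at f x a C r"
    by (rule real_analytic_atE[OF assms]) (rule that)
  note * = power_series_atD[OF ps]
  obtain B where B: "0 < B"
    "\<And>h k s. norm h \<le> s \<Longrightarrow> norm k \<le> s \<Longrightarrow> s \<le> r / 2 \<Longrightarrow>
       norm (series_tail f x a 1 h - series_tail f x a 1 k) \<le> B * s ^ (1 - 1) * norm (h - k)"
    by (rule power_series_tail_lipschitz[OF ps zero_less_one]) (rule that)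
  have "a 0 (\<lambda>_. h) = a 0 (\<lambda>_. k)" for h k
    by (rule multilinear_bounded_cong[OF *(2)]) auto
  then obtain a0 where "\<And>h. a 0 (\<lambda>_. h) = a0" by metis
  then have lip: "norm (f (x + h) - f (x + k)) \<le> B * norm (h - k)" if "norm h < r/2" "norm k < r/2" for h k
    using B(2)[of h "r/2" k] that by (simp add: series_tail_def less_imp_le)
  show ?thesis
  proof
    show "0 < B" "0 < r / 2" using *(1) B by auto
    show "norm (f y - f z) \<le> B * norm (y - z)"
      if "norm (y - x) < r/2" "norm (z - x) < r/2" for y z
      using lip[of "y - x" "z - x"] that by simp
  qed
qed

lemma analytic_strict_derivative:
  fixes f :: "'a::real_normed_vector \<Rightarrow> 'b::banach"
  assumes "real_analytic_at f x"
  obtains T B \<rho> where "bounded_linear T" "0 < B" "0 < \<rho>"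
    "\<And>h k s. norm h \<le> s \<Longrightarrow> norm k \<le> s \<Longrightarrow> s \<le> \<rho> \<Longrightarrow>
       norm (f (x + h) - f (x + k) - T (h - k)) \<le> B * s * norm (h - k)"
proof -
  obtain a C r where ps: "power_series_at f x a C r"
    by (rule real_analytic_atE[OF assms]) (rule that)
  note * = power_series_atD[OF ps]
  obtain B where B: "0 < B"
    "\<And>h k s. norm h \<le> s \<Longrightarrow> norm k \<le> s \<Longrightarrow> s \<le> r / 2 \<Longrightarrow>
       norm (series_tail f x a 2 h - series_tail f x a 2 k) \<le> B * s ^ (2 - 1) * norm (h - k)"
    by (rule power_series_tail_lipschitz[OF ps pos2]) (rule that)
  define T where "T v = a 1 (\<lambda>_. v)" for v
  have T: "bounded_linear T"
  proof -
    have "T = (\<lambda>v. a 1 ((\<lambda>_. 0)(0 := v)))"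
      unfolding T_def by (rule ext, rule multilinear_bounded_cong[OF *(2)[of 1]]) auto
    then show ?thesis
      using multilinear_bounded_bounded_linear[OF *(2)[of 1], of 0] by simp
  qed
  have a0: "a 0 (\<lambda>_. h) = a 0 (\<lambda>_. k)" for h k
    by (rule multilinear_bounded_cong[OF *(2)]) auto
  have "norm (f (x + h) - f (x + k) - T (h - k)) \<le> B * s * norm (h - k)"
    if "norm h \<le> s" "norm k \<le> s" "s \<le> r / 2" for h k s
  proof -
    have eq: "series_tail f x a 2 h - series_tail f x a 2 k = f (x + h) - f (x + k) - T (h - k)"
      using a0[of h k] linear_diff[OF bounded_linear.linear[OF T], of h k]
      by (simp add: series_tail_def lessThan_nat_numeral T_def)
    show ?thesis using B(2)[OF that] unfolding eq by simp
  qed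
  then show ?thesis using that[OF T B(1), of "r/2"] *(1) by simp
qed

lemma strict_derivative_imp_has_derivative:
  assumes "bounded_linear T" "0 < B" "0 < \<rho>"
    "\<And>h k s. norm h \<le> s \<Longrightarrow> norm k \<le> s \<Longrightarrow> s \<le> \<rho> \<Longrightarrow>
       norm (f (x + h) - f (x + k) - T (h - k)) \<le> B * s * norm (h - k)"
  shows "(f has_derivative T) (at x)"
  unfolding has_derivative_at_alt
proof (intro conjI allI impI)
  show "bounded_linear T" by fact
  fix e :: real assume e: "0 < e"
  show "\<exists>d>0. \<forall>y. norm (y - x) < d \<longrightarrow> norm (f y - f x - T (y - x)) \<le> e * norm (y - x)"
  proof (intro exI[of _ "min \<rho> (e / B)"] conjI allI impI)
    fix y assume y: "norm (y - x) < min \<rho> (e / B)"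
    have "norm (f y - f x - T (y - x)) \<le> B * norm (y - x) * norm (y - x)"
      using assms(4)[of "y - x" "norm (y - x)" 0] y by simp
    also have "\<dots> \<le> e * norm (y - x)"
      using y assms(2) by (intro mult_right_mono) (auto simp: field_simps)
    finally show "norm (f y - f x - T (y - x)) \<le> e * norm (y - x)" .
  qed (use assms e in auto)
qed

lemma analytic_has_derivative:
  fixes f :: "'a::real_normed_vector \<Rightarrow> 'b::banach"
  assumes "real_analytic_at f x"
  obtains T where "(f has_derivative T) (at x)"
  using analytic_strict_derivative[OF assms] strict_derivative_imp_has_derivative by metis

lemma analytic_isCont:
  fixes f :: "'a::real_normed_vector \<Rightarrow> 'b::banach"
  shows "real_analytic_at f x \<Longrightarrow> isCont f x"
  using analytic_has_derivative has_derivative_continuous by blast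

lemma real_analytic_at_cong:
  assumes "real_analytic_at f x" "\<forall>\<^sub>F y in nhds x. f y = g y"
  shows "real_analytic_at g x"
proof -
  obtain a C r where ps: "power_series_at f x a C r"
    by (rule real_analytic_atE[OF assms(1)]) (rule that)
  note * = power_series_atD[OF ps]
  obtain d where d: "0 < d" "\<And>y. dist y x < d \<Longrightarrow> f y = g y"
    using assms(2) unfolding eventually_nhds_metric by blast
  have C0: "0 \<le> C n" for n using *(2) multilinear_bounded_nonneg by blast
  have "summable (\<lambda>n. C n * (min r d) ^ n)"
    by (rule summable_comparison_test'[OF *(3), of 0])
       (use * d C0 in \<open>auto simp: abs_mult intro!: mult_left_mono power_mono\<close>)
  moreover have "(\<lambda>n. a n (\<lambda>_. h)) sums g (x + h)" if "norm h < min r d" for h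
    using *(4)[of h] d(2)[of "x + h"] that by (simp add: dist_norm)
  ultimately show ?thesis
    unfolding real_analytic_at_def using * d(1) by (intro exI[of _ a] exI[of _ C] exI[of _ "min r d"]) auto
qed

section \<open>Closure properties of analytic maps\<close>

lemma multilinear_bounded_zero: "multilinear_bounded n 0 (\<lambda>_. 0)"
  unfolding multilinear_bounded_def by (auto intro: module_hom_zero)

lemma multilinear_bounded_add:
  assumes "multilinear_bounded n C a" "multilinear_bounded n D b"
  shows "multilinear_bounded n (C + D) (\<lambda>h. a h + b h)"
  unfolding multilinear_bounded_def
proof (intro conjI allI impI)
  show "0 \<le> C + D" using assms[THEN multilinear_bounded_nonneg] by simp
  fix h k :: "nat \<Rightarrow> 'a"
  show "a h + b h = a k + b k" if "\<forall>i<n. h i = k i"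
    using assms[THEN multilinear_bounded_cong, of h k] that by simp
  show "linear (\<lambda>v. a (h(i := v)) + b (h(i := v)))" if "i < n" for i
    using assms[THEN multilinear_bounded_linear, OF that] by (rule linear_compose_add)
  have "norm (a h + b h) \<le> norm (a h) + norm (b h)" by norm
  also have "\<dots> \<le> (C + D) * (\<Prod>i<n. norm (h i))"
    using assms[THEN multilinear_bounded_norm, of h] by (simp add: algebra_simps)
  finally show "norm (a h + b h) \<le> \<dots>" .
qed

lemma multilinear_bounded_sum:
  assumes "\<And>s. s \<in> S \<Longrightarrow> multilinear_bounded n (C s) (a s)"
  shows "multilinear_bounded n (\<Sum>s\<in>S. C s) (\<lambda>h. \<Sum>s\<in>S. a s h)"
  using assms
  by (induction S rule: infinite_finite_induct) (auto intro: multilinear_bounded_zero multilinear_bounded_add)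

lemma real_analytic_at_finite_series:
  assumes a: "\<And>n. multilinear_bounded n (C n) (a n)" and N: "\<And>n. N < n \<Longrightarrow> C n = 0"
    and f: "\<And>h. f (x + h) = (\<Sum>n\<le>N. a n (\<lambda>_. h))"
  shows "real_analytic_at f x"
proof -
  have "a n (\<lambda>_. h) = 0" if "N < n" for n h
    using multilinear_bounded_diag_norm[OF a, of h "norm h" n] N[OF that] by simp
  then have "(\<lambda>n. a n (\<lambda>_. h)) sums f (x + h)" for h
    unfolding f by (intro sums_finite) auto
  moreover have "summable (\<lambda>n. C n * 1 ^ n)"
    by (rule summable_finite[of "{..N}"]) (use N in auto)
  ultimately show ?thesis
    unfolding real_analytic_at_def using a by (intro exI[of _ a] exI[of _ C] exI[of _ 1]) auto
qed

lemma real_analytic_at_bounded_linear: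
  assumes "bounded_linear f"
  shows "real_analytic_at f x"
proof -
  obtain B where B: "0 < B" "\<And>v. norm (f v) \<le> norm v * B"
    using bounded_linear.pos_bounded[OF assms] by blast
  define a where "a n = (if n = 0 then (\<lambda>_. f x) else if n = 1 then (\<lambda>h. f (h (0::nat))) else (\<lambda>_. 0))" for n :: nat
  define C where "C n = (if n = 0 then norm (f x) else if n = 1 then B else 0)" for n :: nat
  have lin: "linear f" using assms by (rule bounded_linear.linear)
  show ?thesis
  proof (rule real_analytic_at_finite_series[where a = a and C = C and N = 1])
    show "multilinear_bounded n (C n) (a n)" for n
      using B lin unfolding multilinear_bounded_def a_def C_def by (auto simp: mult.commute intro: module_hom_zero)
  qed (auto simp: a_def C_def linear_add[OF lin])
qed

lemma real_analytic_at_const: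
  fixes x :: "'a::real_normed_vector" and c :: "'b::real_normed_vector"
  shows "real_analytic_at (\<lambda>_. c) x"
proof -
  have "multilinear_bounded n (if n = 0 then norm c else 0) (if n = 0 then (\<lambda>_. c) else (\<lambda>_::nat \<Rightarrow> 'a. 0))" for n
    unfolding multilinear_bounded_def by (auto intro: module_hom_zero)
  then show ?thesis by (rule real_analytic_at_finite_series[where N = 0]) auto
qed

lemma real_analytic_at_add:
  assumes "real_analytic_at f x" "real_analytic_at g x"
  shows "real_analytic_at (\<lambda>y. f y + g y) x"
proof -
  obtain a C r where f: "power_series_at f x a C r"
    by (rule real_analytic_atE[OF assms(1)]) (rule that)
  obtain b D s where g: "power_series_at g x b D s"
    by (rule real_analytic_atE[OF assms(2)]) (rule that)
  note f = power_series_atD[OF f] and g = power_series_atD[OF g]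
  let ?r = "min r s"
  have C0: "0 \<le> C n" "0 \<le> D n" for n using f(2) g(2) multilinear_bounded_nonneg by blast+
  have "summable (\<lambda>n. C n * ?r ^ n)" "summable (\<lambda>n. D n * ?r ^ n)"
    by (rule summable_comparison_test'[OF f(3), of 0] summable_comparison_test'[OF g(3), of 0],
        use f g C0 in \<open>auto simp: abs_mult intro!: mult_left_mono power_mono\<close>)+
  then have "summable (\<lambda>n. (C n + D n) * ?r ^ n)"
    by (auto simp: algebra_simps intro: summable_add)
  then show ?thesis
    unfolding real_analytic_at_def using f g
    by (intro exI[of _ "\<lambda>n h. a n h + b n h"] exI[of _ "\<lambda>n. C n + D n"] exI[of _ ?r])
       (auto intro!: multilinear_bounded_add sums_add)
qed

lemma real_analytic_at_power: "real_analytic_at (\<lambda>t::real. t ^ q) 0"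
proof -
  define a where "a n = (if n = q then (\<lambda>h. \<Prod>i<n. h i) else (\<lambda>_. 0::real))" for n :: nat
  define C where "C n = (if n = q then 1 else 0::real)" for n :: nat
  have "linear (\<lambda>v. \<Prod>j<n. (h(i := v)) j)" if "i < n" for i n and h :: "nat \<Rightarrow> real"
  proof -
    have "(\<Prod>j<n. (h(i := v)) j) = (\<Prod>j\<in>{..<n} - {i}. h j) * v" for v
      using that by (subst prod.remove[of _ i]) (auto intro!: prod.cong)
    then show ?thesis by (simp add: linear_times)
  qed
  then have "multilinear_bounded n (C n) (a n)" for n
    unfolding multilinear_bounded_def a_def C_def
    by (auto simp: abs_prod intro: module_hom_zero)
  then show ?thesis
    by (rule real_analytic_at_finite_series[where N = q]) (auto simp: a_def C_def if_distrib[of "\<lambda>f. f _"] cong: if_cong)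
qed

section \<open>Composition of analytic maps\<close>

lemma sum_list_take_mono:
  fixes ms :: "nat list"
  assumes "i < i'" "i' \<le> length ms"
  shows "sum_list (take i ms) + ms ! i \<le> sum_list (take i' ms)"
proof -
  have "sum_list (take i ms) + ms ! i = sum_list (take (Suc i) ms)"
    using assms by (simp add: take_Suc_conv_app_nth)
  also have "take i' ms = take (Suc i) ms @ take (i' - Suc i) (drop (Suc i) ms)"
    using assms by (metis Suc_leI le_add_diff_inverse take_add)
  then have "sum_list (take (Suc i) ms) \<le> sum_list (take i' ms)"
    by (metis le_add1 sum_list_append)
  finally show ?thesis .
qed

lemma block_index:
  fixes ms :: "nat list"
  assumes "l < sum_list ms"
  obtains i j where "i < length ms" "j < ms ! i" "l = sum_list (take i ms) + j"
  using assms
proof (induction ms arbitrary: thesis rule: rev_induct)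
  case (snoc m ms)
  show ?case
  proof (cases "l < sum_list ms")
    case True
    obtain i j where *: "i < length ms" "j < ms ! i" "l = sum_list (take i ms) + j"
      using snoc.IH[OF _ True] by blast
    show ?thesis
      by (rule snoc.prems(1)[of i j]) (use * in \<open>auto simp: nth_append\<close>)
  next
    case False
    show ?thesis
      by (rule snoc.prems(1)[of "length ms" "l - sum_list ms"]) (use False snoc.prems in \<open>auto simp: nth_append\<close>)
  qed
qed simp

lemma block_index_unique:
  fixes ms :: "nat list"
  assumes "i < length ms" "i' < length ms" "j < ms ! i" "j' < ms ! i'"
    "sum_list (take i ms) + j = sum_list (take i' ms) + j'"
  shows "i = i'"
proof (rule ccontr)
  assume "i \<noteq> i'"
  then consider "i < i'" | "i' < i" by linarith
  then show False
    using sum_list_take_mono[of i i' ms] sum_list_take_mono[of i' i ms] assms by cases auto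
qed

lemma prod_blocks:
  fixes ms :: "nat list" and \<phi> :: "nat \<Rightarrow> real"
  shows "(\<Prod>i<length ms. \<Prod>j<ms ! i. \<phi> (sum_list (take i ms) + j)) = (\<Prod>l<sum_list ms. \<phi> l)"
proof (induction ms rule: rev_induct)
  case (snoc m ms)
  have "(\<Prod>i<length (ms @ [m]). \<Prod>j<(ms @ [m]) ! i. \<phi> (sum_list (take i (ms @ [m])) + j))
    = (\<Prod>i<length ms. \<Prod>j<ms ! i. \<phi> (sum_list (take i ms) + j)) * (\<Prod>j<m. \<phi> (sum_list ms + j))"
    by (simp add: nth_append)
  also have "\<dots> = (\<Prod>l<sum_list ms. \<phi> l) * (\<Prod>l\<in>{sum_list ms..<sum_list ms + m}. \<phi> l)"
  proof -
    have "(\<Prod>j<m. \<phi> (sum_list ms + j)) = (\<Prod>l\<in>{sum_list ms..<sum_list ms + m}. \<phi> l)"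
      using prod.shift_bounds_nat_ivl[of \<phi> 0 "sum_list ms" m] by (simp add: add.commute atLeast0LessThan)
    then show ?thesis by (simp only: snoc.IH)
  qed
  also have "\<dots> = (\<Prod>l<sum_list ms + m. \<phi> l)"
    using prod.atLeastLessThan_concat[of 0 "sum_list ms" "sum_list ms + m" \<phi>] by (simp add: atLeast0LessThan)
  finally show ?case by simp
qed simp

lemma prod_list_map_conv_prod: "prod_list (map f ms) = (\<Prod>i<length ms. f (ms ! i))"
  for f :: "'a \<Rightarrow> 'b::comm_monoid_mult"
  by (induction ms rule: rev_induct) (simp_all add: nth_append mult.commute)

text \<open>Each position below \<open>sum_list ms\<close> lies in exactly one block, so varying one argument varies exactly
  one argument of \<open>b\<close>, and linearly.\<close>

lemma multilinear_bounded_blocks: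
  fixes b :: "(nat \<Rightarrow> 'b::real_normed_vector) \<Rightarrow> 'c::real_normed_vector"
    and a :: "nat \<Rightarrow> (nat \<Rightarrow> 'a::real_normed_vector) \<Rightarrow> 'b"
  assumes b: "multilinear_bounded (length ms) B b"
    and a: "\<And>m. multilinear_bounded m (A m) (a m)"
  shows "multilinear_bounded (sum_list ms) (B * prod_list (map A ms))
           (\<lambda>h. b (\<lambda>i. a (ms ! i) (\<lambda>j. h (sum_list (take i ms) + j))))"
  unfolding multilinear_bounded_def
proof (intro conjI allI impI)
  have A0: "0 \<le> A m" for m using a multilinear_bounded_nonneg by blast
  let ?n = "length ms"
  let ?o = "\<lambda>i. sum_list (take i ms)"
  show "0 \<le> B * prod_list (map A ms)"
    using multilinear_bounded_nonneg[OF b] A0 by (simp add: prod_list_map_conv_prod prod_nonneg)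
  fix h k :: "nat \<Rightarrow> 'a"
  have o: "?o i + j < sum_list ms" if "i < ?n" "j < ms ! i" for i j
    using sum_list_take_mono[of i ?n ms] that by simp
  show "b (\<lambda>i. a (ms ! i) (\<lambda>j. h (?o i + j))) = b (\<lambda>i. a (ms ! i) (\<lambda>j. k (?o i + j)))"
    if "\<forall>i<sum_list ms. h i = k i"
    by (intro multilinear_bounded_cong[OF b] multilinear_bounded_cong[OF a]) (use that o in auto)
  show "linear (\<lambda>v. b (\<lambda>i. a (ms ! i) (\<lambda>j. (h(l := v)) (?o i + j))))" if l: "l < sum_list ms" for l
  proof -
    obtain i0 j0 where ij: "i0 < ?n" "j0 < ms ! i0" "l = ?o i0 + j0"
      using block_index[OF l] by blast
    let ?H = "\<lambda>i. a (ms ! i) (\<lambda>j. h (?o i + j))"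
    have "b (\<lambda>i. a (ms ! i) (\<lambda>j. (h(l := v)) (?o i + j)))
        = b (?H(i0 := a (ms ! i0) ((\<lambda>j. h (?o i0 + j))(j0 := v))))" for v
    proof (rule multilinear_bounded_cong[OF b])
      fix i assume i: "i < ?n"
      show "a (ms ! i) (\<lambda>j. (h(l := v)) (?o i + j))
        = (?H(i0 := a (ms ! i0) ((\<lambda>j. h (?o i0 + j))(j0 := v)))) i"
      proof (cases "i = i0")
        case True
        then show ?thesis using ij by (auto intro!: multilinear_bounded_cong[OF a])
      next
        case False
        have "a (ms ! i) (\<lambda>j. (h(l := v)) (?o i + j)) = ?H i"
        proof (rule multilinear_bounded_cong[OF a])
          fix j assume "j < ms ! i"
          then have "?o i + j \<noteq> l"
            using block_index_unique[OF i ij(1) _ ij(2), of j] False ij(3) by blast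
          then show "(h(l := v)) (?o i + j) = h (?o i + j)" by simp
        qed
        then show ?thesis using False by simp
      qed
    qed
    moreover have "linear (\<lambda>v. b (?H(i0 := a (ms ! i0) ((\<lambda>j. h (?o i0 + j))(j0 := v)))))"
    proof -
      have 1: "linear (\<lambda>v. a (ms ! i0) ((\<lambda>j. h (?o i0 + j))(j0 := v)))"
        by (rule multilinear_bounded_linear[OF a ij(2)])
      have 2: "linear (\<lambda>w. b (?H(i0 := w)))"
        by (rule multilinear_bounded_linear[OF b ij(1)])
      show ?thesis using linear_compose[OF 1 2] by (simp only: o_def)
    qed
    ultimately show ?thesis by presburger
  qed
  have "norm (b (\<lambda>i. a (ms ! i) (\<lambda>j. h (?o i + j))))
     \<le> B * (\<Prod>i<?n. A (ms ! i) * (\<Prod>j<ms ! i. norm (h (?o i + j))))"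
    by (rule multilinear_bounded_norm_le[OF b]) (rule multilinear_bounded_norm[OF a])
  also have "\<dots> = B * prod_list (map A ms) * (\<Prod>l<sum_list ms. norm (h l))"
    using prod_blocks[of "\<lambda>l. norm (h l)" ms] by (simp add: prod.distrib prod_list_map_conv_prod)
  finally show "norm (b (\<lambda>i. a (ms ! i) (\<lambda>j. h (?o i + j)))) \<le> \<dots>" .
qed

abbreviation lists_of :: "'a set \<Rightarrow> nat \<Rightarrow> 'a list set" where
  "lists_of S n \<equiv> {ms. length ms = n \<and> set ms \<subseteq> S}"

lemma bij_betw_snoc: "bij_betw (\<lambda>(ms, m). ms @ [m]) (lists_of S n \<times> S) (lists_of S (Suc n))"
proof (rule bij_betwI[where g = "\<lambda>ms. (butlast ms, last ms)"])
  show "(\<lambda>ms. (butlast ms, last ms)) \<in> lists_of S (Suc n) \<rightarrow> lists_of S n \<times> S"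
    by (auto dest: in_set_butlastD) (metis last_in_set length_0_conv nat.simps(3) subsetD)
next
  fix ms assume "ms \<in> lists_of S (Suc n)"
  then show "(\<lambda>(ms, m). ms @ [m]) (butlast ms, last ms) = ms" by (cases ms rule: rev_cases) auto
qed auto

lemma has_sum_prod_list:
  fixes \<phi> :: "'a \<Rightarrow> real"
  assumes \<phi>: "(\<phi> has_sum \<Phi>) S" "\<And>m. m \<in> S \<Longrightarrow> 0 \<le> \<phi> m"
  shows "((\<lambda>ms. prod_list (map \<phi> ms)) has_sum \<Phi> ^ n) (lists_of S n)"
proof (induction n)
  case 0
  have "lists_of S 0 = {[]}" by auto
  then show ?case by (simp add: has_sum_finite_iff)
next
  case (Suc n)
  let ?f = "\<lambda>(ms, m). prod_list (map \<phi> ms) * \<phi> m"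
  have nn: "0 \<le> prod_list (map \<phi> ms)" if "ms \<in> lists_of S n" for ms
    unfolding prod_list_map_conv_prod by (rule prod_nonneg) (use that \<phi>(2) nth_mem in blast)
  have inner: "((\<lambda>m. ?f (ms, m)) has_sum prod_list (map \<phi> ms) * \<Phi>) S" for ms
    using has_sum_cmult_right[OF \<phi>(1)] by simp
  have outer: "((\<lambda>ms. prod_list (map \<phi> ms) * \<Phi>) has_sum \<Phi> ^ n * \<Phi>) (lists_of S n)"
    using has_sum_cmult_left[OF Suc] by simp
  have "?f summable_on lists_of S n \<times> S"
    by (rule summable_on_SigmaI[OF inner has_sum_imp_summable[OF outer]])
       (use nn \<phi>(2) in \<open>auto intro: mult_nonneg_nonneg\<close>)
  then have "(?f has_sum \<Phi> ^ n * \<Phi>) (lists_of S n \<times> S)"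
    by (intro has_sum_SigmaI[OF inner outer])
  also have "?this \<longleftrightarrow> ((\<lambda>x. prod_list (map \<phi> (case x of (ms, m) \<Rightarrow> ms @ [m]))) has_sum \<Phi> ^ n * \<Phi>) (lists_of S n \<times> S)"
    by (rule has_sum_cong) auto
  also have "\<dots> \<longleftrightarrow> ((\<lambda>ms. prod_list (map \<phi> ms)) has_sum \<Phi> ^ n * \<Phi>) (lists_of S (Suc n))"
    by (rule has_sum_reindex_bij_betw[OF bij_betw_snoc])
  finally show ?case by (simp add: mult.commute)
qed

text \<open>The arguments are expanded one after the other: after \<open>k\<close> steps the first \<open>k\<close> arguments are terms of
  the series and the others are still its sum.\<close>

lemma has_sum_multilinear:
  fixes b :: "(nat \<Rightarrow> 'b::real_normed_vector) \<Rightarrow> 'c::banach" and p :: "'i \<Rightarrow> 'b"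
  assumes b: "multilinear_bounded n B b"
    and p: "(p has_sum P) S"
    and \<phi>: "\<phi> summable_on S" "\<And>m. m \<in> S \<Longrightarrow> norm (p m) \<le> \<phi> m"
  shows "((\<lambda>ms. b (\<lambda>i. p (ms ! i))) has_sum b (\<lambda>_. P)) (lists_of S n)"
proof -
  have \<phi>0: "0 \<le> \<phi> m" if "m \<in> S" for m using \<phi>(2)[OF that] norm_ge_zero order_trans by blast
  define \<Phi> where "\<Phi> = infsum \<phi> S"
  have \<Phi>: "(\<phi> has_sum \<Phi>) S" unfolding \<Phi>_def using \<phi>(1) by (rule has_sum_infsum)
  have "k \<le> n \<Longrightarrow> ((\<lambda>ms. b (\<lambda>i. if i < k then p (ms ! i) else P)) has_sum b (\<lambda>_. P)) (lists_of S k)" for k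
  proof (induction k)
    case 0
    have "lists_of S 0 = {[]}" by auto
    then show ?case by (simp add: has_sum_finite_iff)
  next
    case (Suc k)
    let ?f = "\<lambda>(ms, m). b ((\<lambda>i. if i < k then p (ms ! i) else P)(k := p m))"
    have inner: "((\<lambda>m. ?f (ms, m)) has_sum b (\<lambda>i. if i < k then p (ms ! i) else P)) S" for ms
    proof -
      have "(\<lambda>i. if i < k then p (ms ! i) else P) = (\<lambda>i. if i < k then p (ms ! i) else P)(k := P)"
        by auto
      then show ?thesis
        using has_sum_bounded_linear[OF multilinear_bounded_bounded_linear[OF b, of k] p,
           of "\<lambda>i. if i < k then p (ms ! i) else P"] Suc.prems by simp
    qed
    have outer: "((\<lambda>ms. b (\<lambda>i. if i < k then p (ms ! i) else P)) has_sum b (\<lambda>_. P)) (lists_of S k)"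
      using Suc by simp
    let ?g = "\<lambda>x. prod_list (map \<phi> (case x of (ms, m) \<Rightarrow> ms @ [m]))"
    let ?D = "B * (\<Prod>i\<in>{Suc k..<n}. norm P)"
    have "?g summable_on lists_of S k \<times> S"
      unfolding summable_on_reindex_bij_betw[OF bij_betw_snoc, where f = "\<lambda>ms. prod_list (map \<phi> ms)"]
      by (rule has_sum_imp_summable, rule has_sum_prod_list[OF \<Phi>], rule \<phi>0)
    then have Dg: "(\<lambda>x. ?D * ?g x) summable_on lists_of S k \<times> S"
      by (rule summable_on_cmult_right)
    have fle: "norm (?f x) \<le> ?D * ?g x" if "x \<in> lists_of S k \<times> S" for x
    proof -
      obtain ms m where x: "x = (ms, m)" by force
      have msm: "length ms = k" "set ms \<subseteq> S" "m \<in> S" using that x by auto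
      have "norm (?f x) \<le> B * (\<Prod>i<n. if i < Suc k then \<phi> ((ms @ [m]) ! i) else norm P)"
        unfolding x prod.case
        by (rule multilinear_bounded_norm_le[OF b])
           (use msm \<phi> nth_mem in \<open>auto simp: nth_append less_Suc_eq\<close>)
      also have "(\<Prod>i<n. if i < Suc k then \<phi> ((ms @ [m]) ! i) else norm P)
        = (\<Prod>i<Suc k. \<phi> ((ms @ [m]) ! i)) * (\<Prod>i\<in>{Suc k..<n}. norm P)"
      proof -
        have "{..<n} = {..<Suc k} \<union> {Suc k..<n}" using Suc.prems by auto
        then show ?thesis by (simp add: prod.union_disjoint ivl_disj_int)
      qed
      also have "(\<Prod>i<Suc k. \<phi> ((ms @ [m]) ! i)) = ?g x"
        using msm by (simp add: x prod_list_map_conv_prod nth_append)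
      finally show ?thesis by (simp only: mult_ac)
    qed
    have "?f summable_on lists_of S k \<times> S"
      by (rule abs_summable_summable, rule summable_on_comparison_test[OF Dg], erule fle, rule norm_ge_zero)
    then have "(?f has_sum b (\<lambda>_. P)) (lists_of S k \<times> S)"
      by (intro has_sum_SigmaI[OF inner outer])
    also have "?this \<longleftrightarrow> ((\<lambda>x. b (\<lambda>i. if i < Suc k then p ((case x of (ms, m) \<Rightarrow> ms @ [m]) ! i) else P))
        has_sum b (\<lambda>_. P)) (lists_of S k \<times> S)"
      by (rule has_sum_cong) (auto simp: nth_append less_Suc_eq intro!: arg_cong[of _ _ b])
    also have "\<dots> \<longleftrightarrow> ((\<lambda>ms. b (\<lambda>i. if i < Suc k then p (ms ! i) else P)) has_sum b (\<lambda>_. P)) (lists_of S (Suc k))"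
      by (rule has_sum_reindex_bij_betw[OF bij_betw_snoc])
    finally show ?case .
  qed
  from this[of n] have "((\<lambda>ms. b (\<lambda>i. if i < n then p (ms ! i) else P)) has_sum b (\<lambda>_. P)) (lists_of S n)"
    by simp
  also have "?this \<longleftrightarrow> ?thesis"
    by (rule has_sum_cong) (rule multilinear_bounded_cong[OF b], simp)
  finally show ?thesis .
qed

lemma finite_compositions: "finite {ms. 0 \<notin> set ms \<and> sum_list ms = (N::nat)}"
proof (rule finite_subset)
  show "{ms. 0 \<notin> set ms \<and> sum_list ms = N} \<subseteq> {ms. set ms \<subseteq> {..N} \<and> length ms \<le> N}"
  proof safe
    fix ms :: "nat list" assume *: "0 \<notin> set ms" "N = sum_list ms"
    show "m \<le> sum_list ms" if "m \<in> set ms" for m by (rule member_le_sum_list[OF that]) simp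
    show "length ms \<le> sum_list ms" using *(1) by (induction ms) auto
  qed
  show "finite {ms. set ms \<subseteq> {..N} \<and> length ms \<le> N}" by (rule finite_lists_length_le) simp
qed

text \<open>Substituting \<open>f (x + h) - f x = (\<Sum>m\<ge>1. a m h)\<close> into the power series of \<open>g\<close> gives an
  absolutely convergent family indexed by the lists of positive degrees. Collecting the lists with
  sum \<open>N\<close> gives the term of degree \<open>N\<close>: the factor with index \<open>i\<close> reads its \<open>ms ! i\<close> arguments from the
  \<open>i\<close>-th of the consecutive blocks into which \<open>{..<N}\<close> is cut.\<close>

theorem real_analytic_at_compose:
  fixes f :: "'a::real_normed_vector \<Rightarrow> 'b::banach" and g :: "'b \<Rightarrow> 'c::banach"
  assumes "real_analytic_at f x" "real_analytic_at g (f x)"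
  shows "real_analytic_at (\<lambda>y. g (f y)) x"
proof -
  obtain a A r where f: "power_series_at f x a A r"
    by (rule real_analytic_atE[OF assms(1)]) (rule that)
  obtain b B s where g: "power_series_at g (f x) b B s"
    by (rule real_analytic_atE[OF assms(2)]) (rule that)
  note f = power_series_atD[OF f] and g = power_series_atD[OF g]
  have A0: "0 \<le> A n" and B0: "0 \<le> B n" for n
    using f(2) g(2) multilinear_bounded_nonneg by blast+
  define \<Sigma> where "\<Sigma> = (\<Sum>n. A n * r ^ n)"
  have \<Sigma>0: "0 \<le> \<Sigma>" unfolding \<Sigma>_def by (rule suminf_nonneg[OF f(3)]) (use A0 f(1) in auto)
  \<comment> \<open>The terms of positive degree of the first series are to sum up to less than \<open>s\<close>.\<close>
  define \<rho> where "\<rho> = r * min 1 (s / (2 * (\<Sigma> + 1)))"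
  have \<rho>: "0 < \<rho>" "\<rho> \<le> r" "\<rho> / r * \<Sigma> < s"
  proof -
    show "0 < \<rho>" "\<rho> \<le> r" unfolding \<rho>_def using f(1) g(1) \<Sigma>0 by (auto simp: mult_le_cancel_left2)
    have "\<rho> / r * \<Sigma> \<le> s / (2 * (\<Sigma> + 1)) * \<Sigma>"
      unfolding \<rho>_def using f(1) \<Sigma>0 by (intro mult_right_mono) auto
    also have "\<dots> < s" using \<Sigma>0 g(1) by (simp add: divide_simps)
    finally show "\<rho> / r * \<Sigma> < s" .
  qed
  define S where "S = {m::nat. m \<noteq> 0}"
  define \<phi> where "\<phi> m = A m * \<rho> ^ m" for m
  have \<phi>0: "0 \<le> \<phi> m" for m unfolding \<phi>_def using A0 \<rho> by simp
  have "summable \<phi>"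
    unfolding \<phi>_def
    by (rule summable_comparison_test'[OF f(3), of 0])
       (use A0 \<rho> f(1) in \<open>auto simp: abs_mult intro!: mult_left_mono power_mono\<close>)
  then have \<phi>sum: "\<phi> summable_on S"
    using summable_on_UNIV_nonneg_real_iff[of \<phi>] \<phi>0 summable_on_subset by blast
  define \<Phi> where "\<Phi> = infsum \<phi> S"
  have \<Phi>: "(\<phi> has_sum \<Phi>) S" unfolding \<Phi>_def using \<phi>sum by (rule has_sum_infsum)
  have \<Phi>0: "0 \<le> \<Phi>" using \<Phi> \<phi>0 by (meson has_sum_nonneg)
  have \<Phi>s: "\<Phi> < s"
  proof -
    have "(\<lambda>n. A n * r ^ n) summable_on UNIV"
      using f(3) A0 f(1) by (subst summable_on_UNIV_nonneg_real_iff) auto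
    then have 1: "((\<lambda>n. A n * r ^ n) has_sum \<Sigma>) UNIV"
      unfolding \<Sigma>_def using f(3) has_sum_imp_sums sums_unique has_sum_infsum by metis
    have "((\<lambda>n. \<rho> / r * (A n * r ^ n)) has_sum (\<rho> / r * \<Sigma>)) UNIV"
      by (rule has_sum_cmult_right[OF 1])
    then have "\<Phi> \<le> \<rho> / r * \<Sigma>"
    proof (rule has_sum_mono_neutral[OF \<Phi>])
      fix n assume "n \<in> S \<inter> UNIV"
      then obtain k where n: "n = Suc k" unfolding S_def using not0_implies_Suc by blast
      have "A n * \<rho> ^ n = \<rho> * (A n * \<rho> ^ k)" by (simp add: n)
      also have "\<dots> \<le> \<rho> * (A n * r ^ k)"
        using \<rho> A0 by (intro mult_left_mono power_mono) auto
      also have "\<dots> = \<rho> / r * (A n * r ^ n)" using f(1) by (simp add: n)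
      finally show "\<phi> n \<le> \<rho> / r * (A n * r ^ n)" unfolding \<phi>_def .
    qed (use A0 f(1) \<rho> in auto)
    then show ?thesis using \<rho> by linarith
  qed
  define W where "W x = B (fst x) * prod_list (map \<phi> (snd x))" for x :: "nat \<times> nat list"
  have Wsum: "W summable_on Sigma UNIV (lists_of S)"
  proof (rule summable_on_SigmaI)
    show "((\<lambda>ms. W (n, ms)) has_sum B n * \<Phi> ^ n) (lists_of S n)" for n
      unfolding W_def fst_conv snd_conv
      by (intro has_sum_cmult_right has_sum_prod_list[OF \<Phi>] \<phi>0)
    have "summable (\<lambda>n. B n * \<Phi> ^ n)"
      by (rule summable_comparison_test'[OF g(3), of 0])
         (use B0 \<Phi>0 \<Phi>s in \<open>auto simp: abs_mult intro!: mult_left_mono power_mono\<close>)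
    then show "(\<lambda>n. B n * \<Phi> ^ n) summable_on UNIV"
      by (subst summable_on_UNIV_nonneg_real_iff) (use B0 \<Phi>0 in auto)
    show "0 \<le> W (n, ms)" for n ms
      unfolding W_def using B0 \<phi>0 by (auto simp: prod_list_map_conv_prod intro!: mult_nonneg_nonneg prod_nonneg)
  qed
  let ?comps = "\<lambda>N. {ms. 0 \<notin> set ms \<and> sum_list ms = (N::nat)}"
  have bij: "bij_betw (\<lambda>(N, ms). (length ms, ms)) (Sigma UNIV ?comps) (Sigma UNIV (lists_of S))"
    by (rule bij_betwI[where g = "\<lambda>(n, ms). (sum_list ms, ms)"]) (auto simp: S_def intro!: gr0I)
  define c where "c N h = (\<Sum>ms\<in>?comps N. b (length ms) (\<lambda>i. a (ms ! i) (\<lambda>j. h (sum_list (take i ms) + j))))"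
    for N :: nat and h :: "nat \<Rightarrow> 'a"
  define D where "D N = (\<Sum>ms\<in>?comps N. B (length ms) * prod_list (map A ms))" for N
  have ml: "multilinear_bounded N (D N) (c N)" for N
    unfolding c_def D_def
    by (rule multilinear_bounded_sum) (use multilinear_bounded_blocks[OF g(2) f(2)] in auto)
  have "summable (\<lambda>N. D N * \<rho> ^ N)"
  proof -
    have "((\<lambda>x. W (case x of (N, ms) \<Rightarrow> (length ms, ms)))) summable_on Sigma UNIV ?comps"
      unfolding summable_on_reindex_bij_betw[OF bij] by (rule Wsum)
    then have "((\<lambda>x. W (case x of (N, ms) \<Rightarrow> (length ms, ms))) has_sum
        infsum (\<lambda>x. W (case x of (N, ms) \<Rightarrow> (length ms, ms))) (Sigma UNIV ?comps)) (Sigma UNIV ?comps)"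
      by (rule has_sum_infsum)
    then have "((\<lambda>N. D N * \<rho> ^ N) has_sum
        infsum (\<lambda>x. W (case x of (N, ms) \<Rightarrow> (length ms, ms))) (Sigma UNIV ?comps)) UNIV"
    proof (rule has_sum_SigmaD)
      fix N
      have "prod_list (map \<phi> ms) = prod_list (map A ms) * \<rho> ^ sum_list ms" for ms
        by (induction ms) (simp_all add: \<phi>_def power_add)
      then have "D N * \<rho> ^ N = (\<Sum>ms\<in>?comps N. W (length ms, ms))"
        unfolding D_def W_def sum_distrib_right by (intro sum.cong) auto
      then show "((\<lambda>ms. W (case (N, ms) of (N, ms) \<Rightarrow> (length ms, ms))) has_sum D N * \<rho> ^ N) (?comps N)"
        using finite_compositions by (simp add: has_sum_finite_iff)
    qed
    then show ?thesis using has_sum_imp_sums sums_summable by blast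
  qed
  moreover have "(\<lambda>N. c N (\<lambda>_. h)) sums g (f (x + h))" if h: "norm h < \<rho>" for h
  proof -
    define p where "p m = a m (\<lambda>_. h)" for m
    define P where "P = f (x + h) - f x"
    have p\<phi>: "norm (p m) \<le> \<phi> m" for m
      unfolding p_def \<phi>_def by (rule multilinear_bounded_diag_norm[OF f(2)]) (use h in auto)
    have nsum: "summable (\<lambda>m. norm (p m))"
      by (rule summable_comparison_test'[OF \<open>summable \<phi>\<close>, of 0]) (use p\<phi> in auto)
    have p0: "p 0 = f x"
    proof -
      have "(\<lambda>n. a n (\<lambda>_. 0)) sums f (x + 0)" by (rule f(4)) (use f(1) in auto)
      moreover have "a n (\<lambda>_. 0) = 0" if "n > 0" for n
        using multilinear_bounded_diag_norm[OF f(2), of 0 0 n] that by (simp add: power_0_left)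
      then have "(\<lambda>n. a n (\<lambda>_. 0)) sums a 0 (\<lambda>_. 0)"
        using sums_finite[of "{0}" "\<lambda>n. a n (\<lambda>_. 0)"] by simp
      ultimately have "f x = a 0 (\<lambda>_. 0)" using sums_unique2 by fastforce
      also have "\<dots> = a 0 (\<lambda>_. h)" by (rule multilinear_bounded_cong[OF f(2)]) auto
      finally show ?thesis by (simp add: p_def)
    qed
    have "p sums f (x + h)" unfolding p_def by (rule f(4)) (use h \<rho> in auto)
    then have "(p has_sum f (x + h)) UNIV" by (rule norm_summable_imp_has_sum[OF nsum])
    moreover have "(p has_sum p 0) {0}" by (simp add: has_sum_finite_iff)
    ultimately have pP: "(p has_sum P) S"
    proof -
      assume "(p has_sum f (x + h)) UNIV" "(p has_sum p 0) {0}"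
      then have "(p has_sum (f (x + h) - p 0)) (UNIV - {0})" by (rule has_sum_Diff) auto
      then show ?thesis unfolding P_def S_def p0 by (simp add: set_diff_eq)
    qed
    have Pn: "norm P \<le> \<Phi>"
      using norm_infsum_le[OF pP \<Phi>] p\<phi> infsumI[OF pP] by auto
    define T where "T x = b (fst x) (\<lambda>i. p (snd x ! i))" for x :: "nat \<times> nat list"
    have TW: "norm (T x) \<le> W x" if "x \<in> Sigma UNIV (lists_of S)" for x
    proof -
      have l: "length (snd x) = fst x" using that by auto
      have "norm (T x) \<le> B (fst x) * (\<Prod>i<fst x. \<phi> (snd x ! i))"
        unfolding T_def by (rule multilinear_bounded_norm_le[OF g(2)]) (rule p\<phi>)
      then show ?thesis unfolding W_def prod_list_map_conv_prod l .
    qed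
    have Tsum: "T summable_on Sigma UNIV (lists_of S)"
      by (rule abs_summable_summable, rule summable_on_comparison_test[OF Wsum], erule TW, rule norm_ge_zero)
    have outer: "((\<lambda>n. b n (\<lambda>_. P)) has_sum g (f (x + h))) UNIV"
    proof (rule norm_summable_imp_has_sum)
      show "summable (\<lambda>n. norm (b n (\<lambda>_. P)))"
        by (rule summable_comparison_test'[OF g(3), of 0])
           (use Pn \<Phi>s in \<open>auto intro!: multilinear_bounded_diag_norm[OF g(2)]\<close>)
      show "(\<lambda>n. b n (\<lambda>_. P)) sums g (f (x + h))"
        using g(4)[of P] Pn \<Phi>s by (simp add: P_def)
    qed
    have "(T has_sum g (f (x + h))) (Sigma UNIV (lists_of S))"
    proof (rule has_sum_SigmaI[OF _ outer Tsum])
      show "((\<lambda>ms. T (n, ms)) has_sum b n (\<lambda>_. P)) (lists_of S n)" for n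
        unfolding T_def fst_conv snd_conv by (rule has_sum_multilinear[OF g(2) pP \<phi>sum p\<phi>])
    qed
    then have "((\<lambda>x. T (case x of (N, ms) \<Rightarrow> (length ms, ms))) has_sum g (f (x + h))) (Sigma UNIV ?comps)"
      unfolding has_sum_reindex_bij_betw[OF bij] .
    then have "((\<lambda>N. c N (\<lambda>_. h)) has_sum g (f (x + h))) UNIV"
    proof (rule has_sum_SigmaD)
      fix N
      have "c N (\<lambda>_. h) = (\<Sum>ms\<in>?comps N. T (length ms, ms))"
        unfolding c_def T_def p_def by simp
      then show "((\<lambda>ms. T (case (N, ms) of (N, ms) \<Rightarrow> (length ms, ms))) has_sum c N (\<lambda>_. h)) (?comps N)"
        using finite_compositions by (simp add: has_sum_finite_iff)
    qed
    then show ?thesis by (rule has_sum_imp_sums)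
  qed
  ultimately show ?thesis
    unfolding real_analytic_at_def using ml \<rho>(1)
    by (intro exI[of _ c] exI[of _ D] exI[of _ \<rho>]) auto
qed

section \<open>Orders of analytic functions of one variable\<close>

lemma analytic_has_fps_expansion:
  fixes f :: "real \<Rightarrow> real"
  assumes "real_analytic_at f 0"
  obtains F where "f has_fps_expansion F"
proof -
  obtain a C r where "power_series_at f 0 a C r" by (rule real_analytic_atE[OF assms]) (rule that)
  note f = power_series_atD[OF this]
  have "(\<lambda>n. fps_nth (Abs_fps (\<lambda>n. a n (\<lambda>_. 1))) n * h ^ n) sums f h" if "norm h < r" for h
    using f(4)[OF that] multilinear_bounded_diag_scaleR[OF f(2), of _ h 1] by (simp add: mult.commute)
  then have "f has_fps_expansion Abs_fps (\<lambda>n. a n (\<lambda>_. 1))"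
    by (intro has_fps_expansionI) (auto simp: eventually_nhds_metric dist_norm intro!: exI[of _ r] f(1))
  then show ?thesis by (rule that)
qed

lemma has_fps_expansion_at_0: "f has_fps_expansion F \<Longrightarrow> f 0 = fps_nth F 0"
  unfolding has_fps_expansion_def
  using eventually_nhds_x_imp_x[of "\<lambda>z. eval_fps F z = f z" 0] by (auto simp: eval_fps_at_0)

text \<open>Identifying \<open>ord_t\<close> with the subdegree makes the arithmetic of formal power series available.\<close>

lemma ord_t_conv_subdegree:
  fixes f :: "real \<Rightarrow> real"
  assumes "f has_fps_expansion F"
  shows "ord_t f = (if F = 0 then \<infinity> else enat (subdegree F))"
proof -
  have "(deriv ^^ n) f has_fps_expansion (fps_deriv ^^ n) F" for n
    by (induction n) (use assms in \<open>auto intro: has_fps_expansion_deriv\<close>)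
  then have "(deriv ^^ n) f 0 = fact n * fps_nth F n" for n
    using has_fps_expansion_at_0 fps_0th_higher_deriv by metis
  then have *: "ord_t f = (INF n\<in>{n. fps_nth F n \<noteq> 0}. enat n)"
    unfolding ord_t_def by simp
  show ?thesis
  proof (cases "F = 0")
    case False
    have "(INF n\<in>{n. fps_nth F n \<noteq> 0}. enat n) = enat (subdegree F)"
      by (rule antisym) (use False in \<open>auto intro!: INF_lower INF_greatest subdegree_leI\<close>)
    then show ?thesis using * False by simp
  qed (use * in \<open>simp add: top_enat_def\<close>)
qed

lemma ord_t_infinite_iff:
  fixes f :: "real \<Rightarrow> real"
  assumes "real_analytic_at f 0"
  shows "ord_t f = \<infinity> \<longleftrightarrow> (\<forall>\<^sub>F t in nhds 0. f t = 0)"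
proof -
  obtain F where F: "f has_fps_expansion F" by (rule analytic_has_fps_expansion[OF assms])
  have "F = 0" if "\<forall>\<^sub>F t in nhds 0. f t = 0"
  proof -
    have "(\<lambda>_. 0) has_fps_expansion F"
      using F that unfolding has_fps_expansion_def
      by (auto elim: eventually_elim2)
    then have "ord_t (\<lambda>_::real. 0::real) = (if F = 0 then \<infinity> else enat (subdegree F))"
      by (rule ord_t_conv_subdegree)
    moreover have "ord_t (\<lambda>_::real. 0::real) = \<infinity>"
      by (subst ord_t_conv_subdegree[OF has_fps_expansion_0]) simp
    ultimately show ?thesis by (auto split: if_splits)
  qed
  moreover have "\<forall>\<^sub>F t in nhds 0. f t = 0" if "F = 0"
    using F that unfolding has_fps_expansion_def by (auto elim: eventually_mono)
  ultimately show ?thesis using ord_t_conv_subdegree[OF F] by auto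
qed

lemma ord_t_bounds:
  fixes f :: "real \<Rightarrow> real"
  assumes "real_analytic_at f 0" "ord_t f = enat n"
  obtains c C where "0 < c" "0 < C" "\<forall>\<^sub>F t in nhds 0. c * \<bar>t\<bar> ^ n \<le> \<bar>f t\<bar> \<and> \<bar>f t\<bar> \<le> C * \<bar>t\<bar> ^ n"
proof -
  obtain F where F: "f has_fps_expansion F" by (rule analytic_has_fps_expansion[OF assms(1)])
  have F0: "F \<noteq> 0" and n: "n = subdegree F"
    using ord_t_conv_subdegree[OF F] assms(2) by (auto split: if_splits)
  define u where "u = fps_nth F n"
  define g where "g = (\<lambda>x. if x = 0 then u else f x / x ^ n)"
  have u: "u \<noteq> 0" using F0 by (simp add: u_def n)
  have "g has_fps_expansion fps_shift n F"
    unfolding g_def by (rule has_fps_expansion_shift[OF F]) (auto simp: n u_def)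
  then have "isCont g 0" using has_fps_expansion_imp_continuous by blast
  then have "((\<lambda>t. \<bar>g t\<bar>) \<longlongrightarrow> \<bar>u\<bar>) (nhds 0)"
    using continuous_at_imp_continuous_at_within tendsto_nhds_iff
    by (auto simp: isCont_def g_def tendsto_rabs tendsto_nhds_iff)
  from order_tendstoD(1)[OF this, of "\<bar>u\<bar> / 2"] order_tendstoD(2)[OF this, of "2 * \<bar>u\<bar>"]
  have "\<forall>\<^sub>F t in nhds 0. \<bar>u\<bar> / 2 < \<bar>g t\<bar>" "\<forall>\<^sub>F t in nhds 0. \<bar>g t\<bar> < 2 * \<bar>u\<bar>"
    using u by auto
  then have "\<forall>\<^sub>F t in nhds 0. \<bar>u\<bar> / 2 * \<bar>t\<bar> ^ n \<le> \<bar>f t\<bar> \<and> \<bar>f t\<bar> \<le> 2 * \<bar>u\<bar> * \<bar>t\<bar> ^ n"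
  proof eventually_elim
    case (elim t)
    have "f t = t ^ n * g t"
      using has_fps_expansion_at_0[OF F] by (auto simp: g_def u_def n power_0_left)
    then have "\<bar>f t\<bar> = \<bar>t\<bar> ^ n * \<bar>g t\<bar>" by (simp add: abs_mult power_abs)
    then show ?case
      using mult_left_mono[of "\<bar>u\<bar> / 2" "\<bar>g t\<bar>" "\<bar>t\<bar> ^ n"] mult_left_mono[of "\<bar>g t\<bar>" "2 * \<bar>u\<bar>" "\<bar>t\<bar> ^ n"] elim
      by (simp add: mult.commute)
  qed
  then show ?thesis using that[of "\<bar>u\<bar> / 2" "2 * \<bar>u\<bar>"] u by simp
qed

lemma ord_t_upper_bound:
  fixes f :: "real \<Rightarrow> real"
  assumes "real_analytic_at f 0" "enat k \<le> ord_t f"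
  obtains C where "0 < C" "\<forall>\<^sub>F t in nhds 0. \<bar>f t\<bar> \<le> C * \<bar>t\<bar> ^ k"
proof (cases "ord_t f")
  case infinity
  then have "\<forall>\<^sub>F t in nhds 0. f t = 0" using ord_t_infinite_iff[OF assms(1)] by blast
  then have "\<forall>\<^sub>F t in nhds 0. \<bar>f t\<bar> \<le> 1 * \<bar>t\<bar> ^ k" by eventually_elim simp
  then show ?thesis using that[of 1] by simp
next
  case (enat n)
  obtain c C where C: "0 < C" "\<forall>\<^sub>F t in nhds 0. c * \<bar>t\<bar> ^ n \<le> \<bar>f t\<bar> \<and> \<bar>f t\<bar> \<le> C * \<bar>t\<bar> ^ n"
    by (rule ord_t_bounds[OF assms(1) enat]) (rule that)
  have kn: "k \<le> n" using assms(2) enat by simp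
  have "\<forall>\<^sub>F t in nhds (0::real). \<bar>t\<bar> < 1"
    by (auto simp: eventually_nhds_metric intro!: exI[of _ 1])
  with C(2) have "\<forall>\<^sub>F t in nhds 0. \<bar>f t\<bar> \<le> C * \<bar>t\<bar> ^ k"
  proof eventually_elim
    case (elim t)
    have "C * \<bar>t\<bar> ^ n \<le> C * \<bar>t\<bar> ^ k"
      using C(1) elim kn by (intro mult_left_mono power_decreasing) auto
    then show ?case using elim by linarith
  qed
  then show ?thesis using that C(1) by blast
qed

text \<open>Bounds for orders are obtained by comparing the size of powers near \<open>0\<close>.\<close>

lemma powr_eventually_le_imp:
  assumes "0 < c" "\<forall>\<^sub>F t in at_right 0. c * t powr \<alpha> \<le> C * t powr \<beta>"
  shows "\<beta> \<le> (\<alpha>::real)"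
proof (rule ccontr)
  assume "\<not> \<beta> \<le> \<alpha>"
  then have d: "0 < \<beta> - \<alpha>" by simp
  have "((\<lambda>t. C * t powr (\<beta> - \<alpha>)) \<longlongrightarrow> C * 0) (at_right 0)"
  proof (intro tendsto_mult tendsto_const)
    have "((\<lambda>t::real. t powr (\<beta> - \<alpha>)) \<longlongrightarrow> 0 powr (\<beta> - \<alpha>)) (at_right 0)"
      using d by (intro tendsto_powr') (auto simp: eventually_at_right_less eventually_at intro: exI[of _ 1])
    then show "((\<lambda>t::real. t powr (\<beta> - \<alpha>)) \<longlongrightarrow> 0) (at_right 0)" using d by simp
  qed
  then have "\<forall>\<^sub>F t in at_right 0. C * t powr (\<beta> - \<alpha>) < c"
    using assms(1) by (auto intro: order_tendstoD(2))
  with assms(2) eventually_at_right_less[of "0::real"] have "\<forall>\<^sub>F t::real in at_right 0. False"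
  proof eventually_elim
    case (elim t)
    have "C * t powr \<beta> = (C * t powr (\<beta> - \<alpha>)) * t powr \<alpha>" by (simp add: powr_diff elim)
    also have "\<dots> < c * t powr \<alpha>" using elim by (intro mult_strict_right_mono) auto
    finally show ?case using elim by linarith
  qed
  then show False by simp
qed

lemma eventually_nhds_imp_at_right: "eventually P (nhds (0::real)) \<Longrightarrow> eventually P (at_right 0)"
  by (auto simp: eventually_at_filter elim: eventually_mono)

lemma power_eventually_le_imp:
  assumes "0 < c" "\<forall>\<^sub>F t in nhds (0::real). c * \<bar>t\<bar> ^ m \<le> C * \<bar>t\<bar> ^ n"
  shows "n \<le> m"
proof -
  have "\<forall>\<^sub>F t in at_right 0. c * t powr real m \<le> C * t powr real n"
    using eventually_nhds_imp_at_right[OF assms(2)] eventually_at_right_less[of "0::real"]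
    by eventually_elim (simp add: powr_realpow)
  from powr_eventually_le_imp[OF assms(1) this] show ?thesis by simp
qed

lemma ord_t_geI:
  fixes f :: "real \<Rightarrow> real"
  assumes "real_analytic_at f 0" "\<forall>\<^sub>F t in nhds 0. \<bar>f t\<bar> \<le> C * \<bar>t\<bar> ^ k"
  shows "enat k \<le> ord_t f"
proof (cases "ord_t f")
  case (enat n)
  obtain c D where "0 < c" "\<forall>\<^sub>F t in nhds 0. c * \<bar>t\<bar> ^ n \<le> \<bar>f t\<bar> \<and> \<bar>f t\<bar> \<le> D * \<bar>t\<bar> ^ n"
    by (rule ord_t_bounds[OF assms(1) enat]) (rule that)
  moreover from this(2) assms(2) have "\<forall>\<^sub>F t in nhds 0. c * \<bar>t\<bar> ^ n \<le> C * \<bar>t\<bar> ^ k"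
    by eventually_elim linarith
  ultimately show ?thesis using power_eventually_le_imp enat by auto
qed simp

lemma ord_t_leI:
  fixes f :: "real \<Rightarrow> real"
  assumes "real_analytic_at f 0" "0 < c" "\<forall>\<^sub>F t in nhds 0. c * \<bar>t\<bar> ^ k \<le> \<bar>f t\<bar>"
  shows "ord_t f \<le> enat k"
proof (rule ccontr)
  assume "\<not> ord_t f \<le> enat k"
  then have "enat (Suc k) \<le> ord_t f" by (simp add: Suc_ile_eq)
  then obtain C where "\<forall>\<^sub>F t in nhds 0. \<bar>f t\<bar> \<le> C * \<bar>t\<bar> ^ Suc k"
    by (rule ord_t_upper_bound[OF assms(1)]) (rule that)
  with assms(3) have "\<forall>\<^sub>F t in nhds 0. c * \<bar>t\<bar> ^ k \<le> C * \<bar>t\<bar> ^ Suc k"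
    by eventually_elim linarith
  then show False using power_eventually_le_imp[OF assms(2)] by fastforce
qed

lemma ord_t_prod:
  fixes f :: "nat \<Rightarrow> real \<Rightarrow> real"
  assumes "\<And>i. i < p \<Longrightarrow> real_analytic_at (f i) 0"
  shows "ord_t (\<lambda>t. \<Prod>i<p. f i t) = (\<Sum>i<p. ord_t (f i))"
proof -
  have "\<exists>F. f i has_fps_expansion F" if "i < p" for i
    by (rule analytic_has_fps_expansion[OF assms[OF that]]) blast
  then obtain F where F: "\<And>i. i < p \<Longrightarrow> f i has_fps_expansion F i" by metis
  let ?ord = "\<lambda>F. if F = 0 then \<infinity> else enat (subdegree F)"
  have "?ord (prod F {..<n}) = (\<Sum>i<n. ?ord (F i))" for n
  proof (induction n)
    case (Suc n)
    have "?ord (prod F {..<Suc n}) = ?ord (prod F {..<n}) + ?ord (F n)"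
      by (simp del: prod_zero_iff)
    then show ?case by (simp only: Suc.IH sum.lessThan_Suc)
  qed (simp add: zero_enat_def)
  moreover have "ord_t (\<lambda>t. \<Prod>i<p. f i t) = ?ord (prod F {..<p})"
    by (rule ord_t_conv_subdegree[OF has_fps_expansion_prod]) (use F in simp)
  ultimately show ?thesis by (simp add: ord_t_conv_subdegree[OF F])
qed

section \<open>Orders along arcs\<close>

lemma arc_order_singleton [simp]: "arc_order \<gamma> {h} = ord_t (h \<circ> \<gamma>)"
  by (simp add: arc_order_def)

lemma arc_order_attained:
  assumes "finite G" "G \<noteq> {}"
  obtains g where "g \<in> G" "arc_order \<gamma> G = ord_t (g \<circ> \<gamma>)"
proof -
  let ?S = "(\<lambda>g. ord_t (g \<circ> \<gamma>)) ` G"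
  have "arc_order \<gamma> G = Min ?S"
    unfolding arc_order_def by (rule cInf_eq_Min) (use assms in auto)
  moreover have "Min ?S \<in> ?S" by (rule Min_in) (use assms in auto)
  ultimately have "arc_order \<gamma> G \<in> ?S" by (rule ssubst)
  then show ?thesis by (rule imageE) (rule that)
qed

lemma arc_order_le: "g \<in> G \<Longrightarrow> arc_order \<gamma> G \<le> ord_t (g \<circ> \<gamma>)"
  unfolding arc_order_def by (rule INF_lower)

lemma analytic_along_arc:
  fixes \<gamma> :: "real \<Rightarrow> 'a::banach"
  assumes "analytic_arc \<gamma>" "real_analytic_at g 0"
  shows "real_analytic_at ((g::'a \<Rightarrow> real) \<circ> \<gamma>) 0"
  using real_analytic_at_compose[of \<gamma> 0 g] assms by (simp add: analytic_arc_def o_def)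

text \<open>The order of a product is the sum of the orders, which is smallest for the power of a generator of
  least order.\<close>

lemma arc_order_ideal_power:
  fixes \<gamma> :: "real \<Rightarrow> 'a::banach"
  assumes \<gamma>: "analytic_arc \<gamma>" and G: "finite G" "G \<noteq> {}" "\<And>g. g \<in> G \<Longrightarrow> real_analytic_at g 0"
  shows "arc_order \<gamma> (ideal_power G p) = of_nat p * arc_order \<gamma> G"
proof (rule antisym)
  have an: "real_analytic_at (g \<circ> \<gamma>) 0" if "g \<in> G" for g
    using analytic_along_arc[OF \<gamma> G(3)[OF that]] .
  have ord: "ord_t ((\<lambda>x. \<Prod>i<p. g i x) \<circ> \<gamma>) = (\<Sum>i<p. ord_t (g i \<circ> \<gamma>))" if "\<forall>i<p. g i \<in> G" for g
    using ord_t_prod[of p "\<lambda>i. g i \<circ> \<gamma>"] an that by (simp add: o_def)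
  obtain g where g: "g \<in> G" "arc_order \<gamma> G = ord_t (g \<circ> \<gamma>)"
    by (rule arc_order_attained[OF G(1,2)])
  have "(\<lambda>x. \<Prod>i<p. g x) \<in> ideal_power G p"
    unfolding ideal_power_def using g(1) by (auto intro!: exI[of _ "\<lambda>_. g"])
  then have "arc_order \<gamma> (ideal_power G p) \<le> ord_t ((\<lambda>x. \<Prod>i<p. g x) \<circ> \<gamma>)"
    by (rule arc_order_le)
  also have "\<dots> = of_nat p * arc_order \<gamma> G" using ord[of "\<lambda>_. g"] g by simp
  finally show "arc_order \<gamma> (ideal_power G p) \<le> of_nat p * arc_order \<gamma> G" .
  show "of_nat p * arc_order \<gamma> G \<le> arc_order \<gamma> (ideal_power G p)"
    unfolding arc_order_def[of \<gamma> "ideal_power G p"]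
  proof (rule INF_greatest)
    fix h assume "h \<in> ideal_power G p"
    then obtain g where h: "h = (\<lambda>x. \<Prod>i<p. g i x)" "\<forall>i<p. g i \<in> G"
      unfolding ideal_power_def by blast
    have "of_nat p * arc_order \<gamma> G = (\<Sum>i<p. arc_order \<gamma> G)" by simp
    also have "\<dots> \<le> (\<Sum>i<p. ord_t (g i \<circ> \<gamma>))"
      by (rule sum_mono) (use h arc_order_le in auto)
    also have "\<dots> = ord_t (h \<circ> \<gamma>)" using ord[OF h(2)] h(1) by simp
    finally show "of_nat p * arc_order \<gamma> G \<le> ord_t (h \<circ> \<gamma>)" .
  qed
qed

abbreviation nonzero_arcs :: "('a::real_normed_vector \<Rightarrow> real) \<Rightarrow> (real \<Rightarrow> 'a) set" where
  "nonzero_arcs \<Gamma> \<equiv> {\<gamma>. analytic_arc \<gamma> \<and> \<not> (\<forall>\<^sub>F t in nhds 0. \<Gamma> (\<gamma> t) = 0)}"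

abbreviation arc_ratio :: "('a::real_normed_vector \<Rightarrow> real) \<Rightarrow> ('a \<Rightarrow> real) set \<Rightarrow> (real \<Rightarrow> 'a) \<Rightarrow> ereal" where
  "arc_ratio \<Gamma> G \<gamma> \<equiv> ereal_of_enat (arc_order \<gamma> G) / ereal_of_enat (arc_order \<gamma> {\<Gamma>})"

lemma arc_ord_pos:
  fixes \<gamma> :: "real \<Rightarrow> 'a::banach" and \<Gamma> :: "'a \<Rightarrow> real"
  assumes \<gamma>: "analytic_arc \<gamma>" "\<not> (\<forall>\<^sub>F t in nhds 0. \<Gamma> (\<gamma> t) = 0)"
    and \<Gamma>: "real_analytic_at \<Gamma> 0" "\<Gamma> 0 = 0"
  obtains n where "0 < n" "ord_t (\<Gamma> \<circ> \<gamma>) = enat n"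
proof -
  have an: "real_analytic_at (\<Gamma> \<circ> \<gamma>) 0" by (rule analytic_along_arc[OF \<gamma>(1) \<Gamma>(1)])
  obtain n where n: "ord_t (\<Gamma> \<circ> \<gamma>) = enat n"
    using ord_t_infinite_iff[OF an] \<gamma>(2) by (cases "ord_t (\<Gamma> \<circ> \<gamma>)") auto
  obtain c C where "0 < c" "\<forall>\<^sub>F t in nhds 0. c * \<bar>t\<bar> ^ n \<le> \<bar>(\<Gamma> \<circ> \<gamma>) t\<bar> \<and> \<bar>(\<Gamma> \<circ> \<gamma>) t\<bar> \<le> C * \<bar>t\<bar> ^ n"
    by (rule ord_t_bounds[OF an n]) (rule that)
  then have "c * \<bar>0\<bar> ^ n \<le> \<bar>(\<Gamma> \<circ> \<gamma>) 0\<bar>" using eventually_nhds_x_imp_x by blast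
  moreover have "(\<Gamma> \<circ> \<gamma>) 0 = 0" using \<gamma>(1) \<Gamma>(2) by (simp add: analytic_arc_def)
  ultimately have "0 < n" using \<open>0 < c\<close> by (cases n) auto
  then show ?thesis using n that by blast
qed

text \<open>Along the arc the inequality compares \<open>t powr (n * \<theta>)\<close> with \<open>t ^ k\<close> for the orders \<open>n\<close> of \<open>\<Gamma>\<close> and \<open>k\<close> of
  the ideal.\<close>

lemma arc_ratio_le:
  fixes \<gamma> :: "real \<Rightarrow> 'a::banach" and \<Gamma> :: "'a \<Rightarrow> real"
  assumes \<gamma>: "analytic_arc \<gamma>" "\<not> (\<forall>\<^sub>F t in nhds 0. \<Gamma> (\<gamma> t) = 0)"
    and \<Gamma>: "real_analytic_at \<Gamma> 0" "\<Gamma> 0 = 0"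
    and G: "finite G" "G \<noteq> {}" "\<And>g. g \<in> G \<Longrightarrow> real_analytic_at g 0"
    and \<theta>: "0 \<le> \<theta>" "0 < C" "\<forall>\<^sub>F x in nhds 0. C * \<bar>\<Gamma> x\<bar> powr \<theta> \<le> (\<Sum>g\<in>G. \<bar>g x\<bar>)"
  shows "arc_ratio \<Gamma> G \<gamma> \<le> ereal \<theta>"
proof -
  obtain n where n: "0 < n" "ord_t (\<Gamma> \<circ> \<gamma>) = enat n" by (rule arc_ord_pos[OF \<gamma> \<Gamma>])
  have an: "real_analytic_at (\<Gamma> \<circ> \<gamma>) 0" by (rule analytic_along_arc[OF \<gamma>(1) \<Gamma>(1)])
  obtain c D where c: "0 < c" "\<forall>\<^sub>F t in nhds 0. c * \<bar>t\<bar> ^ n \<le> \<bar>(\<Gamma> \<circ> \<gamma>) t\<bar> \<and> \<bar>(\<Gamma> \<circ> \<gamma>) t\<bar> \<le> D * \<bar>t\<bar> ^ n"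
    by (rule ord_t_bounds[OF an n(2)]) (rule that)
  have "isCont \<gamma> 0" using \<gamma>(1) analytic_isCont by (auto simp: analytic_arc_def)
  then have "filterlim \<gamma> (nhds 0) (nhds 0)"
    using \<gamma>(1) by (auto simp: analytic_arc_def isCont_def tendsto_nhds_iff)
  then have ineq: "\<forall>\<^sub>F t in nhds 0. C * \<bar>\<Gamma> (\<gamma> t)\<bar> powr \<theta> \<le> (\<Sum>g\<in>G. \<bar>g (\<gamma> t)\<bar>)"
    using \<theta>(3) by (rule eventually_compose_filterlim[rotated])
  have key: "real k \<le> real n * \<theta>" if k: "enat k \<le> arc_order \<gamma> G" for k
  proof -
    have "\<exists>D>0. \<forall>\<^sub>F t in nhds 0. \<bar>(g \<circ> \<gamma>) t\<bar> \<le> D * \<bar>t\<bar> ^ k" if "g \<in> G" for g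
    proof -
      have "enat k \<le> ord_t (g \<circ> \<gamma>)" using k arc_order_le[OF that] order_trans by blast
      then show ?thesis using ord_t_upper_bound[OF analytic_along_arc[OF \<gamma>(1) G(3)[OF that]]] by metis
    qed
    then obtain D where D: "\<And>g. g \<in> G \<Longrightarrow> \<forall>\<^sub>F t in nhds 0. \<bar>(g \<circ> \<gamma>) t\<bar> \<le> D g * \<bar>t\<bar> ^ k"
      by metis
    have "\<forall>\<^sub>F t in nhds 0. \<forall>g\<in>G. \<bar>(g \<circ> \<gamma>) t\<bar> \<le> D g * \<bar>t\<bar> ^ k"
      by (intro eventually_ball_finite G(1) ballI D)
    with ineq c(2) have "\<forall>\<^sub>F t in nhds 0. C * (c * \<bar>t\<bar> ^ n) powr \<theta> \<le> (\<Sum>g\<in>G. D g) * \<bar>t\<bar> ^ k"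
    proof eventually_elim
      case (elim t)
      have "C * (c * \<bar>t\<bar> ^ n) powr \<theta> \<le> C * \<bar>\<Gamma> (\<gamma> t)\<bar> powr \<theta>"
        using elim c(1) \<theta> by (intro mult_left_mono powr_mono2) auto
      also have "\<dots> \<le> (\<Sum>g\<in>G. \<bar>g (\<gamma> t)\<bar>)" using elim by simp
      also have "\<dots> \<le> (\<Sum>g\<in>G. D g * \<bar>t\<bar> ^ k)" using elim by (intro sum_mono) auto
      finally show ?case by (simp add: sum_distrib_right)
    qed
    from eventually_nhds_imp_at_right[OF this] eventually_at_right_less[of "0::real"]
    have "\<forall>\<^sub>F t in at_right 0. (C * c powr \<theta>) * t powr (real n * \<theta>) \<le> (\<Sum>g\<in>G. D g) * t powr real k"
    proof eventually_elim
      case (elim t)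
      have "(c * \<bar>t\<bar> ^ n) powr \<theta> = c powr \<theta> * t powr (real n * \<theta>)"
        using elim c(1) by (simp add: powr_mult powr_powr flip: powr_realpow)
      then show ?case using elim by (simp add: powr_realpow mult_ac)
    qed
    then show ?thesis by (rule powr_eventually_le_imp[rotated]) (use \<theta>(2) c(1) in simp)
  qed
  show ?thesis
  proof (cases "arc_order \<gamma> G")
    case (enat k)
    then have "real k \<le> real n * \<theta>" using key[of k] by simp
    then show ?thesis using enat n by (simp add: field_simps)
  next
    case infinity
    obtain k where "real n * \<theta> < real k" using reals_Archimedean2 by blast
    then show ?thesis using key[of k] infinity by simp
  qed
qed

text \<open>A power of \<open>\<Gamma>\<close> lies in the real integral closure of a power of the ideal exactly when the
  quotient of the exponents bounds all quotients of orders along arcs, so that the infimum of the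
  former is the supremum of the latter by density of the rational numbers.\<close>

lemma lojasiewicz_exponent_eq_SUP:
  fixes \<Gamma> :: "'a::banach \<Rightarrow> real"
  assumes \<Gamma>: "real_analytic_at \<Gamma> 0" "\<Gamma> 0 = 0"
    and G: "finite G" "G \<noteq> {}" "\<And>g. g \<in> G \<Longrightarrow> real_analytic_at g 0"
    and SUP: "(SUP \<gamma>\<in>nonzero_arcs \<Gamma>. arc_ratio \<Gamma> G \<gamma>) = ereal \<theta>"
    and \<theta>: "0 < \<theta>"
  shows "lojasiewicz_exponent \<Gamma> G = ereal \<theta>"
proof -
  have pow: "ord_t ((\<lambda>x. \<Gamma> x ^ q) \<circ> \<gamma>) = of_nat q * ord_t (\<Gamma> \<circ> \<gamma>)" if "analytic_arc \<gamma>" for q and \<gamma> :: "real \<Rightarrow> 'a"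
    using ord_t_prod[of q "\<lambda>_. \<Gamma> \<circ> \<gamma>"] analytic_along_arc[OF that \<Gamma>(1)] by (simp add: o_def)
  have an: "real_analytic_at (\<lambda>x. \<Gamma> x ^ q) 0" for q
    using real_analytic_at_compose[OF \<Gamma>(1), of "\<lambda>t. t ^ q"] real_analytic_at_power \<Gamma>(2) by simp
  have iff: "(\<lambda>x. \<Gamma> x ^ q) \<in> real_integral_closure (ideal_power G p) \<longleftrightarrow> \<theta> \<le> real q / real p"
    if qp: "0 < q" "0 < p" for p q
  proof -
    have arc: "of_nat p * arc_order \<gamma> G \<le> of_nat q * ord_t (\<Gamma> \<circ> \<gamma>) \<longleftrightarrow>
       arc_ratio \<Gamma> G \<gamma> \<le> ereal (real q / real p)"
      if ac: "analytic_arc \<gamma>" "\<not> (\<forall>\<^sub>F t in nhds 0. \<Gamma> (\<gamma> t) = 0)" for \<gamma>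
    proof -
      obtain n where n: "0 < n" "ord_t (\<Gamma> \<circ> \<gamma>) = enat n" by (rule arc_ord_pos[OF ac \<Gamma>])
      show ?thesis
      proof (cases "arc_order \<gamma> G")
        case (enat k)
        have "p * k \<le> q * n \<longleftrightarrow> real p * real k \<le> real q * real n"
          by (metis of_nat_le_iff of_nat_mult)
        then show ?thesis using n enat qp by (simp add: of_nat_eq_enat field_simps)
      next
        case infinity
        then show ?thesis using n qp by (simp add: of_nat_eq_enat imult_is_infinity zero_enat_def)
      qed
    qed
    have "(\<lambda>x. \<Gamma> x ^ q) \<in> real_integral_closure (ideal_power G p) \<longleftrightarrow>
        (\<forall>\<gamma>. analytic_arc \<gamma> \<longrightarrow> of_nat p * arc_order \<gamma> G \<le> of_nat q * ord_t (\<Gamma> \<circ> \<gamma>))"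
      unfolding real_integral_closure_def using an pow arc_order_ideal_power[OF _ G] by auto
    also have "\<dots> \<longleftrightarrow> (\<forall>\<gamma>\<in>nonzero_arcs \<Gamma>. arc_ratio \<Gamma> G \<gamma> \<le> ereal (real q / real p))"
    proof -
      have "of_nat p * arc_order \<gamma> G \<le> of_nat q * ord_t (\<Gamma> \<circ> \<gamma>)"
        if "analytic_arc \<gamma>" "\<forall>\<^sub>F t in nhds 0. \<Gamma> (\<gamma> t) = 0" for \<gamma>
      proof -
        have "ord_t (\<Gamma> \<circ> \<gamma>) = \<infinity>"
          using ord_t_infinite_iff[OF analytic_along_arc[OF that(1) \<Gamma>(1)]] that(2) by simp
        then show ?thesis using qp by (simp add: of_nat_eq_enat imult_is_infinity zero_enat_def)
      qed
      then show ?thesis using arc by blast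
    qed
    also have "\<dots> \<longleftrightarrow> ereal \<theta> \<le> ereal (real q / real p)"
      unfolding SUP[symmetric] SUP_le_iff ..
    finally show ?thesis by simp
  qed
  let ?Q = "{ereal (real q / real p) |q p. 0 < q \<and> 0 < p \<and>
        (\<lambda>x. \<Gamma> x ^ q) \<in> real_integral_closure (ideal_power G p)}"
  show ?thesis
    unfolding lojasiewicz_exponent_def
  proof (rule antisym)
    show "ereal \<theta> \<le> Inf ?Q"
      by (rule Inf_greatest) (use iff in auto)
    show "Inf ?Q \<le> ereal \<theta>"
    proof (rule dense_ge)
      fix z assume z: "ereal \<theta> < z"
      obtain e where e: "\<theta> < e" "ereal e < z"
        using z ereal_dense2[OF z] by auto
      obtain d where d: "d \<in> \<rat>" "\<theta> < d" "d < e" using Rats_dense_in_real[OF e(1)] by blast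
      obtain q p :: nat where qp: "p \<noteq> 0" "\<bar>d\<bar> = real q / real p"
        using Rats_abs_nat_div_natE[OF d(1)] by metis
      have dq: "d = real q / real p" "0 < q" "0 < p" using qp d(2) \<theta> by (auto intro!: gr0I)
      have "ereal d \<in> ?Q"
        using dq iff[of q p] d(2) by auto
      then have "Inf ?Q \<le> ereal d" by (rule Inf_lower)
      also have "\<dots> \<le> z" using d(3) e(2) by (meson ereal_less_eq(3) less_imp_le order.trans order_le_less_trans)
      finally show "Inf ?Q \<le> z" .
    qed
  qed
qed

abbreviation grad_size :: "(real ^ 'r::finite \<Rightarrow> real) \<Rightarrow> real ^ 'r \<Rightarrow> real" where
  "grad_size \<Gamma> x \<equiv> \<Sum>g\<in>jacobian_ideal \<Gamma>. \<bar>g x\<bar>"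

section \<open>A bounded inverse theorem\<close>

text \<open>The Baire category theorem in the closed image gives a ball of the image that is contained in
  the closure of the image of a ball; differences of its points and scaling give all right-hand sides.\<close>

lemma approximate_preimage:
  fixes T :: "'a::banach \<Rightarrow> 'b::banach"
  assumes T: "bounded_linear T" and Z: "subspace Z" and S: "closed (T ` Z)"
  obtains C where "0 < C"
    "\<And>y. y \<in> T ` Z \<Longrightarrow> \<exists>z\<in>Z. norm z \<le> C * norm y \<and> norm (y - T z) \<le> norm y / 2"
proof -
  have lin: "linear T" using T by (rule bounded_linear.linear)
  define S where "S = T ` Z"
  have subS: "subspace S" unfolding S_def by (rule linear_subspace_image[OF lin Z])
  define A where "A n = S \<inter> closure (T ` (Z \<inter> cball 0 (real n)))" for n :: nat
  have un: "(\<Union>n. A n) = S"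
  proof
    show "S \<subseteq> (\<Union>n. A n)"
    proof
      fix y assume y: "y \<in> S"
      then obtain z where z: "z \<in> Z" "y = T z" unfolding S_def by blast
      obtain n where "norm z \<le> real n" using real_arch_simple by blast
      then have "y \<in> T ` (Z \<inter> cball 0 (real n))" using z by auto
      then have "y \<in> closure (T ` (Z \<inter> cball 0 (real n)))" by (rule subsetD[OF closure_subset])
      then have "y \<in> A n" using y unfolding A_def by simp
      then show "y \<in> (\<Union>n. A n)" by blast
    qed
  qed (auto simp: A_def)
  have "\<exists>n. (top_of_set S) interior_of (A n) \<noteq> {}"
  proof (rule ccontr)
    assume neg: "\<not> ?thesis"
    have "completely_metrizable_space (top_of_set S)"
      using S unfolding S_def
      by (intro completely_metrizable_space_closedin[OF completely_metrizable_space_euclidean]) auto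
    then have "(top_of_set S) interior_of (\<Union>(range A)) = {}"
    proof (intro Baire_category_alt disjI1)
      fix B assume "B \<in> range A"
      then show "closedin (top_of_set S) B \<and> (top_of_set S) interior_of B = {}"
        using neg by (auto simp: A_def intro!: closedin_closed_Int)
    qed auto
    then have "S = {}" using un interior_of_topspace[of "top_of_set S"] by simp
    then show False using subspace_0[OF subS] by blast
  qed
  then obtain n y0 where n: "y0 \<in> (top_of_set S) interior_of (A n)" by blast
  have "openin (top_of_set S) ((top_of_set S) interior_of (A n))" by (rule openin_interior_of)
  then obtain O' where O': "open O'" "(top_of_set S) interior_of (A n) = S \<inter> O'"
    unfolding openin_open by blast
  have y0: "y0 \<in> S" "y0 \<in> O'" using n O' by auto
  obtain \<delta> where \<delta>: "0 < \<delta>" "ball y0 \<delta> \<subseteq> O'" using O'(1) y0(2) openE by blast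
  have sub: "S \<inter> ball y0 \<delta> \<subseteq> A n"
    using \<delta>(2) O'(2) interior_of_subset[of "top_of_set S" "A n"] by blast
  have approx: "\<exists>z\<in>Z. norm z \<le> 2 * real n \<and> norm (y - T z) < \<epsilon>"
    if y: "y \<in> S" "norm y < \<delta>" and \<epsilon>: "0 < \<epsilon>" for y \<epsilon>
  proof -
    have "\<exists>z\<in>Z \<inter> cball 0 (real n). norm (T z - u) < \<epsilon> / 2" if "u \<in> S \<inter> ball y0 \<delta>" for u
    proof -
      have "u \<in> closure (T ` (Z \<inter> cball 0 (real n)))"
        using subsetD[OF sub that] by (simp add: A_def)
      from closure_approachableD[OF this half_gt_zero[OF \<epsilon>]] show ?thesis
        by (auto simp: dist_norm norm_minus_commute)
    qed
    note this[of "y0 + y"] this[of y0]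
    moreover have "y0 + y \<in> S \<inter> ball y0 \<delta>" "y0 \<in> S \<inter> ball y0 \<delta>"
      using y y0 \<delta> subspace_add[OF subS] by (auto simp: dist_norm)
    ultimately obtain z1 z2 where z: "z1 \<in> Z \<inter> cball 0 (real n)" "z2 \<in> Z \<inter> cball 0 (real n)"
      "norm (T z1 - (y0 + y)) < \<epsilon> / 2" "norm (T z2 - y0) < \<epsilon> / 2" by blast
    have "y - T (z1 - z2) = (T z2 - y0) - (T z1 - (y0 + y))"
      by (simp add: linear_diff[OF lin])
    then have "norm (y - T (z1 - z2)) = norm ((T z2 - y0) - (T z1 - (y0 + y)))" by (rule arg_cong)
    also have "\<dots> < \<epsilon>" using z norm_triangle_ineq4[of "T z2 - y0" "T z1 - (y0 + y)"] by linarith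
    finally have "norm (y - T (z1 - z2)) < \<epsilon>" .
    moreover have "norm (z1 - z2) \<le> 2 * real n" using z norm_triangle_ineq4[of z1 z2] by simp
    moreover have "z1 - z2 \<in> Z" using z subspace_diff[OF Z] by blast
    ultimately show ?thesis by blast
  qed
  define C where "C = 4 * real n / \<delta> + 1"
  have "\<exists>z\<in>Z. norm z \<le> C * norm y \<and> norm (y - T z) \<le> norm y / 2" if y: "y \<in> S" for y
  proof (cases "y = 0")
    case True
    then show ?thesis using subspace_0[OF Z] linear_0[OF lin] by (intro bexI[of _ 0]) auto
  next
    case False
    \<comment> \<open>This factor scales \<open>y\<close> to norm \<open>\<delta> / 2\<close>, where \<open>approx\<close> applies.\<close>
    define s where "s = \<delta> / (2 * norm y)"
    have s: "0 < s" using False \<delta> by (simp add: s_def)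
    obtain z where z: "z \<in> Z" "norm z \<le> 2 * real n" "norm (s *\<^sub>R y - T z) < \<delta> / 4"
      using approx[of "s *\<^sub>R y" "\<delta> / 4"] y subspace_scale[OF subS] \<delta> s False by (auto simp: s_def)
    have "norm ((1 / s) *\<^sub>R z) \<le> (1 / s) * (2 * real n)" using z s by (simp add: divide_right_mono)
    also have "\<dots> \<le> C * norm y" using \<delta> False by (simp add: s_def C_def field_simps)
    finally have 1: "norm ((1 / s) *\<^sub>R z) \<le> C * norm y" .
    have "y - T ((1 / s) *\<^sub>R z) = (1 / s) *\<^sub>R (s *\<^sub>R y - T z)"
      using s by (simp add: linear_scale[OF lin] scaleR_diff_right)
    then have "norm (y - T ((1 / s) *\<^sub>R z)) = (1 / s) * norm (s *\<^sub>R y - T z)" using s by simp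
    also have "\<dots> \<le> (1 / s) * (\<delta> / 4)" using z(3) s by (intro mult_left_mono) auto
    also have "\<dots> = norm y / 2" using \<delta> False by (simp add: s_def)
    finally show ?thesis using 1 z subspace_scale[OF Z] by blast
  qed
  moreover have "0 < C" unfolding C_def using \<delta> by (simp add: add_nonneg_pos)
  ultimately show ?thesis using that unfolding S_def by blast
qed

text \<open>Correcting the error of an approximate solution again and again gives a geometric series of
  corrections, whose sum is the exact solution by completeness.\<close>

theorem bounded_below_on_complement:
  fixes T :: "'a::banach \<Rightarrow> 'b::banach"
  assumes T: "bounded_linear T" and Z: "subspace Z" "closed Z" and S: "closed (T ` Z)"
    and inj: "\<And>z. z \<in> Z \<Longrightarrow> T z = 0 \<Longrightarrow> z = 0"
  obtains c where "0 < c" "\<And>z. z \<in> Z \<Longrightarrow> c * norm z \<le> norm (T z)"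
proof -
  have lin: "linear T" using T by (rule bounded_linear.linear)
  obtain C where C: "0 < C"
    "\<And>y. y \<in> T ` Z \<Longrightarrow> \<exists>z\<in>Z. norm z \<le> C * norm y \<and> norm (y - T z) \<le> norm y / 2"
    by (rule approximate_preimage[OF T Z(1) S]) (rule that)
  have subS: "subspace (T ` Z)" by (rule linear_subspace_image[OF lin Z(1)])
  define g where "g y = (SOME z. z \<in> Z \<and> norm z \<le> C * norm y \<and> norm (y - T z) \<le> norm y / 2)" for y
  have g: "g y \<in> Z" "norm (g y) \<le> C * norm y" "norm (y - T (g y)) \<le> norm y / 2" if y: "y \<in> T ` Z" for y
  proof -
    have "\<exists>z. z \<in> Z \<and> norm z \<le> C * norm y \<and> norm (y - T z) \<le> norm y / 2" using C(2)[OF y] by blast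
    from someI_ex[OF this] show "g y \<in> Z" "norm (g y) \<le> C * norm y" "norm (y - T (g y)) \<le> norm y / 2"
      unfolding g_def by auto
  qed
  have "norm z0 \<le> 2 * C * norm (T z0)" if z0: "z0 \<in> Z" for z0
  proof -
    define y where "y = T z0"
    define r where "r k = ((\<lambda>y. y - T (g y)) ^^ k) y" for k
    have r_Suc: "r (Suc k) = r k - T (g (r k))" for k by (simp add: r_def)
    have rS: "r k \<in> T ` Z" for k
    proof (induction k)
      case (Suc k)
      then show ?case unfolding r_Suc using g(1) subspace_diff[OF subS] by blast
    qed (use z0 in \<open>simp add: r_def y_def\<close>)
    have rn: "norm (r k) \<le> norm y * (1 / 2) ^ k" for k
    proof (induction k)
      case (Suc k)
      then show ?case using g(3)[OF rS[of k]] by (simp add: r_Suc)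
    qed (simp add: r_def)
    have zn: "norm (g (r k)) \<le> C * norm y * (1 / 2) ^ k" for k
      using order_trans[OF g(2)[OF rS[of k]] mult_left_mono[OF rn[of k], of C]] C(1)
      by (simp add: mult.assoc)
    have geo: "(\<lambda>k. C * norm y * (1 / 2) ^ k) sums (C * norm y * 2)"
      using geometric_sums[of "1 / 2 :: real"] by (intro sums_mult) simp
    have sm: "summable (\<lambda>k. norm (g (r k)))"
      by (rule summable_comparison_test'[OF sums_summable[OF geo], of 0]) (use zn in auto)
    define z where "z = (\<Sum>k. g (r k))"
    have z: "(\<lambda>k. g (r k)) sums z" unfolding z_def by (rule summable_sums[OF summable_norm_cancel[OF sm]])
    have "(\<Sum>k<n. g (r k)) \<in> Z" for n by (intro subspace_sum[OF Z(1)] g(1)[OF rS])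
    then have zZ: "z \<in> Z"
      by (rule closed_sequentially[OF Z(2)]) (use z in \<open>simp add: sums_def\<close>)
    have Tz: "(\<lambda>k. T (g (r k))) sums T z" by (rule bounded_linear.sums[OF T z])
    have "r \<longlonglongrightarrow> 0"
    proof (rule Lim_null_comparison)
      show "\<forall>\<^sub>F k in sequentially. norm (r k) \<le> norm y * (1 / 2) ^ k" using rn by simp
      show "(\<lambda>k. norm y * (1 / 2) ^ k) \<longlonglongrightarrow> 0" by (intro tendsto_mult_right_zero LIMSEQ_realpow_zero) auto
    qed
    then have "(\<lambda>k. r k - r (Suc k)) sums (r 0 - 0)" by (rule telescope_sums')
    then have "T z = y" using Tz sums_unique2 by (fastforce simp: r_Suc r_def)
    then have "T (z - z0) = 0" by (simp add: linear_diff[OF lin] y_def)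
    then have "z = z0" using inj[of "z - z0"] subspace_diff[OF Z(1) zZ z0] by simp
    moreover have "norm z \<le> C * norm y * 2" by (rule norm_sums_le[OF z geo]) (rule zn)
    ultimately show ?thesis by (simp add: y_def mult_ac)
  qed
  then show ?thesis using that[of "1 / (2 * C)"] C(1) by (simp add: field_simps)
qed

section \<open>Lyapunov--Schmidt reduction\<close>

lemma deriv_along_axis:
  fixes \<Gamma> :: "real ^ 'r \<Rightarrow> real"
  assumes "(\<Gamma> has_derivative G) (at x)"
  shows "deriv (\<lambda>t. \<Gamma> (x + t *\<^sub>R axis i 1)) 0 = G (axis i 1)"
proof -
  have lin: "linear G" using assms by (rule has_derivative_linear)
  have "((\<lambda>t::real. x + t *\<^sub>R axis i 1) has_derivative (\<lambda>t. t *\<^sub>R axis i 1)) (at 0)"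
    by (auto intro!: derivative_eq_intros)
  moreover have "(\<Gamma> has_derivative G) (at (x + 0 *\<^sub>R axis i 1))" using assms by simp
  ultimately have "((\<lambda>t. \<Gamma> (x + t *\<^sub>R axis i 1)) has_derivative (\<lambda>t. G (t *\<^sub>R axis i 1))) (at 0)"
    by (rule has_derivative_compose)
  then have "((\<lambda>t. \<Gamma> (x + t *\<^sub>R axis i 1)) has_field_derivative G (axis i 1)) (at 0)"
    unfolding has_field_derivative_def
    by (rule has_derivative_eq_rhs) (auto simp: linear_scale[OF lin])
  then show ?thesis by (rule DERIV_imp_deriv)
qed

locale lyapunov_schmidt =
  fixes pair :: "'y::banach \<Rightarrow> 'x::banach \<Rightarrow> real"
    and U K Z :: "'x set"
    and E :: "'x \<Rightarrow> real"
    and M L :: "'x \<Rightarrow> 'y"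
    and YK :: "'y set"
    and R :: "'y \<Rightarrow> 'y"
    and \<psi> :: "'x \<Rightarrow> 'x"
    and \<kappa> :: "real ^ 'r \<Rightarrow> 'x"
    and \<Gamma> :: "real ^ 'r \<Rightarrow> real"
  assumes pairing: "bounded_bilinear pair"
    and U: "open U" "0 \<in> U"
    and E: "\<forall>x\<in>U. real_analytic_at E x" "E 0 = 0"
    and M: "\<forall>x\<in>U. real_analytic_at M x"
    and gradient: "\<forall>x\<in>U. (E has_derivative (\<lambda>v. pair (M x) v)) (at x)"
    and L: "(M has_derivative L) (at 0)" "closed (range L)"
    and K: "K = {x. L x = 0}"
    and Z: "closed_complement K Z"
    and YK: "YK = annihilator pair Z"
    and R: "splitting_projection R (range L) YK"
    and \<rho>: "bij_betw (\<lambda>y. restrict (pair y) K) YK (dual_space K)"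
    and \<kappa>: "linear \<kappa>" "inj \<kappa>" "range \<kappa> = K"
    and \<psi>: "real_analytic_at (\<lambda>x. \<psi> (\<kappa> x)) 0" "\<psi> 0 = 0"
      "\<forall>\<^sub>F x in nhds 0. \<psi> (\<kappa> x) \<in> Z \<and> R (M (\<kappa> x + \<psi> (\<kappa> x))) = 0"
    and \<Gamma>: "\<Gamma> = (\<lambda>x. E (\<kappa> x + \<psi> (\<kappa> x)))"
begin

sublocale pair: bounded_bilinear pair by (rule pairing)

definition P :: "real ^ 'r \<Rightarrow> 'x" where "P a = \<kappa> a + \<psi> (\<kappa> a)"

lemma \<Gamma>_eq: "\<Gamma> a = E (P a)"
  by (simp add: \<Gamma> P_def)

lemma blin_L: "bounded_linear L"
  using L(1) by (rule has_derivative_bounded_linear)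

lemma blin_\<kappa>: "bounded_linear \<kappa>"
  using \<kappa>(1) by (simp add: linear_conv_bounded_linear)

lemma R_props: "bounded_linear R" "R (L v) = L v" "y \<in> YK \<longleftrightarrow> R y = 0"
  using R unfolding splitting_projection_def by auto

lemma Z_props: "subspace Z" "closed Z" "K \<inter> Z = {0}"
  using Z unfolding closed_complement_def by auto

lemma pair_YK_Z: "y \<in> YK \<Longrightarrow> z \<in> Z \<Longrightarrow> pair y z = 0"
  by (simp add: YK annihilator_def)

lemma P_0: "P 0 = 0"
  using \<psi>(2) linear_0[OF \<kappa>(1)] by (simp add: P_def)

lemma \<Gamma>_0: "\<Gamma> 0 = 0"
  by (simp add: \<Gamma>_eq P_0 E)

lemma P_analytic: "real_analytic_at P 0"
  unfolding P_def[abs_def]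
  by (rule real_analytic_at_add[OF real_analytic_at_bounded_linear[OF blin_\<kappa>] \<psi>(1)])

lemma \<Gamma>_analytic: "real_analytic_at \<Gamma> 0"
  using real_analytic_at_compose[OF P_analytic, of E] E(1) U(2) by (simp add: \<Gamma>_eq[abs_def] P_0)

lemma P_tendsto: "filterlim P (nhds 0) (nhds 0)"
  using analytic_isCont[OF P_analytic] P_0 by (simp add: isCont_def tendsto_nhds_iff)

lemma eventually_P: "\<forall>\<^sub>F a in nhds 0. P a \<in> U \<and> \<psi> (\<kappa> a) \<in> Z \<and> M (P a) \<in> YK"
proof -
  have "\<forall>\<^sub>F x in nhds 0. x \<in> U" using U by (rule eventually_nhds_in_open)
  then have "\<forall>\<^sub>F a in nhds 0. P a \<in> U" using P_tendsto by (rule eventually_compose_filterlim)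
  with \<psi>(3) show ?thesis by eventually_elim (simp add: R_props P_def)
qed

text \<open>The elements of \<open>YK\<close> that are dual to the coordinate vectors of the kernel. They represent both
  the coordinates of the projection onto the kernel along \<open>Z\<close> and, on \<open>YK\<close>, the inverse of \<open>\<rho>\<close>.\<close>

lemma dual_basis:
  obtains \<eta> :: "'r \<Rightarrow> 'y" where "\<And>i. \<eta> i \<in> YK" "\<And>i x. pair (\<eta> i) (\<kappa> x) = x $ i"
    "\<And>y. y \<in> YK \<Longrightarrow> y = (\<Sum>i\<in>UNIV. pair y (\<kappa> (axis i 1)) *\<^sub>R \<eta> i)"
proof -
  have "closed K"
    unfolding K using bounded_linear.linear[OF blin_L] blin_L
    by (simp add: closed_Collect_eq linear_continuous_on)
  then have "closed (range \<kappa>)" using \<kappa>(3) by simp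
  moreover have "z = 0" if "\<kappa> z = 0" for z
    using that \<kappa>(1,2) linear_0[OF \<kappa>(1)] by (metis injD)
  ultimately obtain c where c: "0 < c" "\<And>x. c * norm x \<le> norm (\<kappa> x)"
    using bounded_below_on_complement[OF blin_\<kappa>, of UNIV] by auto
  define \<phi> where "\<phi> i = restrict (\<lambda>k. inv \<kappa> k $ i) K" for i
  have inv\<kappa>: "inv \<kappa> (\<kappa> x) = x" for x using \<kappa>(2) by simp
  have \<phi>\<kappa>: "\<phi> i (\<kappa> x) = x $ i" for i x using \<kappa>(3) by (auto simp: \<phi>_def inv\<kappa>)
  have "\<phi> i \<in> dual_space K" for i
  proof -
    have "\<exists>C. \<forall>x. \<bar>\<phi> i (\<kappa> x)\<bar> \<le> C * norm (\<kappa> x)"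
    proof (intro exI[of _ "1 / c"] allI)
      fix x
      have "c * \<bar>x $ i\<bar> \<le> c * norm x" using c(1) component_le_norm_cart[of x i] by simp
      also have "\<dots> \<le> norm (\<kappa> x)" by (rule c(2))
      finally show "\<bar>\<phi> i (\<kappa> x)\<bar> \<le> 1 / c * norm (\<kappa> x)" using c(1) by (simp add: \<phi>\<kappa> field_simps)
    qed
    moreover have "\<phi> i (\<kappa> x + \<kappa> y) = \<phi> i (\<kappa> x) + \<phi> i (\<kappa> y)" for x y
      using \<phi>\<kappa>[of i "x + y"] by (simp add: linear_add[OF \<kappa>(1)] \<phi>\<kappa>)
    moreover have "\<phi> i (s *\<^sub>R \<kappa> x) = s * \<phi> i (\<kappa> x)" for s x
      using \<phi>\<kappa>[of i "s *\<^sub>R x"] by (simp add: linear_scale[OF \<kappa>(1)] \<phi>\<kappa>)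
    moreover have "\<phi> i \<in> extensional K" by (simp add: \<phi>_def)
    ultimately show ?thesis unfolding dual_space_def by (auto simp flip: \<kappa>(3))
  qed
  then have "\<exists>y\<in>YK. restrict (pair y) K = \<phi> i" for i
    using bij_betw_imp_surj_on[OF \<rho>] by (metis (no_types, lifting) imageE)
  then obtain \<eta> where \<eta>: "\<And>i. \<eta> i \<in> YK" "\<And>i. restrict (pair (\<eta> i)) K = \<phi> i" by metis
  have \<eta>\<kappa>: "pair (\<eta> i) (\<kappa> x) = x $ i" for i x
  proof -
    have "restrict (pair (\<eta> i)) K (\<kappa> x) = \<phi> i (\<kappa> x)" by (simp add: \<eta>(2))
    then show ?thesis using \<kappa>(3) by (auto simp: \<phi>\<kappa>)
  qed
  have "y = (\<Sum>i\<in>UNIV. pair y (\<kappa> (axis i 1)) *\<^sub>R \<eta> i)" if y: "y \<in> YK" for y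
  proof -
    define w where "w = (\<Sum>i\<in>UNIV. pair y (\<kappa> (axis i 1)) *\<^sub>R \<eta> i)"
    have "R w = 0"
      unfolding w_def using \<eta>(1) R_props(3) by (simp add: linear_sum linear_scale bounded_linear.linear[OF R_props(1)])
    then have w: "w \<in> YK" by (simp add: R_props)
    have "pair w (\<kappa> x) = pair y (\<kappa> x)" for x
    proof -
      have "pair y (\<kappa> x) = pair y (\<kappa> (\<Sum>i\<in>UNIV. (x $ i) *\<^sub>R axis i 1))"
        using basis_expansion[of x] by (simp add: scalar_mult_eq_scaleR)
      also have "\<dots> = (\<Sum>i\<in>UNIV. x $ i * pair y (\<kappa> (axis i 1)))"
        by (simp add: linear_sum[OF \<kappa>(1)] linear_scale[OF \<kappa>(1)] pair.sum_right pair.scaleR_right)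
      also have "\<dots> = pair w (\<kappa> x)"
        by (simp add: w_def pair.sum_left pair.scaleR_left \<eta>\<kappa> mult.commute)
      finally show ?thesis by simp
    qed
    then have "restrict (pair w) K = restrict (pair y) K"
      by (auto simp: restrict_def fun_eq_iff simp flip: \<kappa>(3))
    then show ?thesis using bij_betw_imp_inj_on[OF \<rho>] w y unfolding w_def[symmetric] by (auto dest: inj_onD)
  qed
  then show ?thesis using that \<eta>(1) \<eta>\<kappa> by blast
qed

text \<open>The part of the increment of the reduction map \<open>P\<close> that lies in \<open>Z\<close> is annihilated by \<open>M (P a)\<close>, so
  that only the part in the kernel contributes. For the remainder it suffices that \<open>P\<close> is Lipschitz.\<close>

lemma \<Gamma>_has_derivative:
  "\<forall>\<^sub>F a in nhds 0. (\<Gamma> has_derivative (\<lambda>v. pair (M (P a)) (\<kappa> v))) (at a)"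
proof -
  obtain B \<delta> where B: "0 < B" "0 < \<delta>"
    "\<And>y z. norm (y - 0) < \<delta> \<Longrightarrow> norm (z - 0) < \<delta> \<Longrightarrow> norm (P y - P z) \<le> B * norm (y - z)"
    by (rule analytic_locally_lipschitz[OF P_analytic]) (rule that)
  obtain \<delta>' where \<delta>': "0 < \<delta>'" "\<And>a. dist a 0 < \<delta>' \<Longrightarrow> P a \<in> U \<and> \<psi> (\<kappa> a) \<in> Z \<and> M (P a) \<in> YK"
    using eventually_P unfolding eventually_nhds_metric by blast
  define d where "d = min \<delta> \<delta>'"
  have "(\<Gamma> has_derivative (\<lambda>v. pair (M (P a)) (\<kappa> v))) (at a)" if a: "dist a 0 < d" for a
    unfolding has_derivative_at_alt
  proof (intro conjI allI impI)
    show "bounded_linear (\<lambda>v. pair (M (P a)) (\<kappa> v))"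
      using bounded_linear_compose[OF pair.bounded_linear_right blin_\<kappa>] .
    fix e :: real assume e: "0 < e"
    have Pa: "P a \<in> U" "\<psi> (\<kappa> a) \<in> Z" "M (P a) \<in> YK" using \<delta>'(2)[of a] a by (auto simp: d_def)
    have "(E has_derivative (\<lambda>v. pair (M (P a)) v)) (at (P a))" using gradient Pa(1) by blast
    then obtain s where s: "0 < s" "\<And>x. norm (x - P a) < s \<Longrightarrow>
        norm (E x - E (P a) - pair (M (P a)) (x - P a)) \<le> e / B * norm (x - P a)"
      unfolding has_derivative_at_alt using e B(1) by (meson divide_pos_pos)
    show "\<exists>d>0. \<forall>b. norm (b - a) < d \<longrightarrow>
        norm (\<Gamma> b - \<Gamma> a - pair (M (P a)) (\<kappa> (b - a))) \<le> e * norm (b - a)"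
    proof (intro exI[of _ "min (s / B) (d - norm a)"] conjI allI impI)
      show "0 < min (s / B) (d - norm a)" using s B a by (simp add: dist_norm)
      fix b assume b: "norm (b - a) < min (s / B) (d - norm a)"
      have nb: "norm b < d" using b norm_triangle_ineq2[of b a] by linarith
      have "\<psi> (\<kappa> b) \<in> Z" using \<delta>'(2)[of b] nb by (auto simp: d_def)
      then have "pair (M (P a)) (\<psi> (\<kappa> b) - \<psi> (\<kappa> a)) = 0"
        using Pa by (intro pair_YK_Z subspace_diff[OF Z_props(1)])
      then have 1: "pair (M (P a)) (P b - P a) = pair (M (P a)) (\<kappa> (b - a))"
        by (simp add: P_def pair.diff_right pair.add_right linear_diff[OF \<kappa>(1)])
      have 2: "norm (P b - P a) \<le> B * norm (b - a)" using B(3)[of b a] nb a by (simp add: d_def dist_norm)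
      also have "\<dots> < s" using b B(1) by (simp add: field_simps)
      finally have "norm (E (P b) - E (P a) - pair (M (P a)) (P b - P a)) \<le> e / B * norm (P b - P a)"
        by (rule s(2))
      also have "\<dots> \<le> e / B * (B * norm (b - a))" using 2 e B(1) by (intro mult_left_mono) auto
      finally show "norm (\<Gamma> b - \<Gamma> a - pair (M (P a)) (\<kappa> (b - a))) \<le> e * norm (b - a)"
        using B(1) 1 by (simp add: \<Gamma>_eq)
    qed
  qed
  then show ?thesis unfolding eventually_nhds_metric
    using B(2) \<delta>'(1) by (intro exI[of _ d]) (auto simp: d_def)
qed

lemma jacobian_eq:
  "\<forall>\<^sub>F a in nhds 0. \<forall>i. deriv (\<lambda>t. \<Gamma> (a + t *\<^sub>R axis i 1)) 0 = pair (M (P a)) (\<kappa> (axis i 1))"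
  using \<Gamma>_has_derivative by eventually_elim (simp add: deriv_along_axis)

lemma jacobian_analytic:
  assumes "g \<in> jacobian_ideal \<Gamma>"
  shows "real_analytic_at g 0"
proof -
  obtain i where g: "g = (\<lambda>x. deriv (\<lambda>t. \<Gamma> (x + t *\<^sub>R axis i 1)) 0)"
    using assms unfolding jacobian_ideal_def by blast
  have "real_analytic_at (\<lambda>a. M (P a)) 0"
    using real_analytic_at_compose[OF P_analytic, of M] M U(2) by (simp add: P_0)
  then have "real_analytic_at (\<lambda>a. pair (M (P a)) (\<kappa> (axis i 1))) 0"
    by (rule real_analytic_at_compose[OF _ real_analytic_at_bounded_linear[OF pair.bounded_linear_left]])
  then show ?thesis
    by (rule real_analytic_at_cong) (use jacobian_eq in \<open>auto simp: g elim: eventually_mono\<close>)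
qed

lemma finite_jacobian: "finite (jacobian_ideal \<Gamma>)" "jacobian_ideal \<Gamma> \<noteq> {}"
  by (auto simp: jacobian_ideal_def)

text \<open>On \<open>YK\<close> the norm is controlled by the coefficients in the dual basis, which are the partial
  derivatives of \<open>\<Gamma>\<close>.\<close>

lemma norm_M_le_jacobian:
  obtains C where "0 < C" "\<forall>\<^sub>F a in nhds 0. norm (M (P a)) \<le> C * grad_size \<Gamma> a"
proof -
  obtain \<eta> :: "'r \<Rightarrow> 'y" where \<eta>: "\<And>y. y \<in> YK \<Longrightarrow> y = (\<Sum>i\<in>UNIV. pair y (\<kappa> (axis i 1)) *\<^sub>R \<eta> i)"
    by (rule dual_basis) (rule that)
  define C where "C = (\<Sum>i\<in>UNIV. norm (\<eta> i)) + 1"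
  have "0 < C" unfolding C_def by (simp add: add_nonneg_pos sum_nonneg)
  moreover have "\<forall>\<^sub>F a in nhds 0. norm (M (P a)) \<le> C * grad_size \<Gamma> a"
    using eventually_P jacobian_eq
  proof eventually_elim
    case (elim a)
    let ?S = "grad_size \<Gamma> a"
    have part: "\<bar>pair (M (P a)) (\<kappa> (axis i 1))\<bar> \<le> ?S" for i
    proof -
      have "(\<lambda>x. deriv (\<lambda>t. \<Gamma> (x + t *\<^sub>R axis i 1)) 0) \<in> jacobian_ideal \<Gamma>"
        unfolding jacobian_ideal_def by blast
      from member_le_sum[OF this, of "\<lambda>g. \<bar>g a\<bar>"] show ?thesis
        using finite_jacobian elim(2) by simp
    qed
    have S0: "0 \<le> ?S" by (simp add: sum_nonneg)
    have "norm (M (P a)) = norm (\<Sum>i\<in>UNIV. pair (M (P a)) (\<kappa> (axis i 1)) *\<^sub>R \<eta> i)"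
      using \<eta>[of "M (P a)"] elim(1) by simp
    also have "\<dots> \<le> (\<Sum>i\<in>UNIV. norm (pair (M (P a)) (\<kappa> (axis i 1)) *\<^sub>R \<eta> i))" by (rule norm_sum)
    also have "\<dots> \<le> (\<Sum>i\<in>UNIV. ?S * norm (\<eta> i))"
      by (rule sum_mono) (use part in \<open>auto intro!: mult_right_mono\<close>)
    also have "\<dots> = (\<Sum>i\<in>UNIV. norm (\<eta> i)) * ?S" by (subst sum_distrib_left[symmetric]) (rule mult.commute)
    also have "\<dots> \<le> C * ?S" unfolding C_def using S0 by (intro mult_right_mono) auto
    finally show ?case .
  qed
  ultimately show ?thesis by (rule that)
qed

lemma pair_\<kappa>_bound:
  obtains C where "0 < C" "\<And>y v. \<bar>pair y (\<kappa> v)\<bar> \<le> norm y * norm v * C"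
  using bounded_bilinear.pos_bounded[OF pair.comp[OF bounded_linear_ident blin_\<kappa>]] that by auto

lemma jacobian_le_norm_M:
  obtains C where "0 < C" "\<forall>\<^sub>F a in nhds 0. grad_size \<Gamma> a \<le> C * norm (M (P a))"
proof -
  obtain C where C: "0 < C" "\<And>y v. \<bar>pair y (\<kappa> v)\<bar> \<le> norm y * norm v * C"
    by (rule pair_\<kappa>_bound) (rule that)
  let ?n = "real (card (jacobian_ideal \<Gamma>))"
  have "0 < ?n" using finite_jacobian by (simp add: card_gt_0_iff)
  then have "0 < ?n * C" using C(1) by simp
  moreover have "\<forall>\<^sub>F a in nhds 0. grad_size \<Gamma> a \<le> (?n * C) * norm (M (P a))"
    using jacobian_eq
  proof eventually_elim
    case (elim a)
    have "\<bar>g a\<bar> \<le> norm (M (P a)) * C" if g: "g \<in> jacobian_ideal \<Gamma>" for g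
    proof -
      obtain i where "g = (\<lambda>x. deriv (\<lambda>t. \<Gamma> (x + t *\<^sub>R axis i 1)) 0)"
        using g unfolding jacobian_ideal_def by blast
      then have "\<bar>g a\<bar> = \<bar>pair (M (P a)) (\<kappa> (axis i 1))\<bar>" using elim by simp
      also have "\<dots> \<le> norm (M (P a)) * C" using C(2)[of "M (P a)" "axis i 1"] by simp
      finally show ?thesis .
    qed
    then have "grad_size \<Gamma> a \<le> ?n * (norm (M (P a)) * C)" by (rule sum_bounded_above)
    then show ?case by (simp add: mult_ac)
  qed
  ultimately show ?thesis by (rule that)
qed

text \<open>Integrated along curves in a principalization, this bound relates the order of \<open>\<Gamma>\<close> to that of its
  Jacobian ideal.\<close>

lemma \<Gamma>_derivative_bound:
  obtains C where "0 < C" "\<forall>\<^sub>F a in nhds 0. \<exists>D. (\<Gamma> has_derivative D) (at a) \<and>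
    (\<forall>v. \<bar>D v\<bar> \<le> C * grad_size \<Gamma> a * norm v)"
proof -
  obtain C where C: "0 < C" "\<forall>\<^sub>F a in nhds 0. norm (M (P a)) \<le> C * grad_size \<Gamma> a"
    by (rule norm_M_le_jacobian) (rule that)
  obtain C' where C': "0 < C'" "\<And>y v. \<bar>pair y (\<kappa> v)\<bar> \<le> norm y * norm v * C'"
    by (rule pair_\<kappa>_bound) (rule that)
  have "\<forall>\<^sub>F a in nhds 0. \<exists>D. (\<Gamma> has_derivative D) (at a) \<and>
    (\<forall>v. \<bar>D v\<bar> \<le> (C * C') * grad_size \<Gamma> a * norm v)"
    using C(2) \<Gamma>_has_derivative
  proof eventually_elim
    case (elim a)
    have "\<bar>pair (M (P a)) (\<kappa> v)\<bar> \<le> (C * C') * grad_size \<Gamma> a * norm v" for v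
    proof -
      have "\<bar>pair (M (P a)) (\<kappa> v)\<bar> \<le> norm (M (P a)) * (norm v * C')"
        using C'(2)[of "M (P a)" v] by (simp add: mult.assoc)
      also have "\<dots> \<le> (C * grad_size \<Gamma> a) * (norm v * C')"
        using C'(1) by (intro mult_right_mono[OF elim(1)]) simp
      finally show ?thesis by (simp only: mult_ac)
    qed
    then show ?case using elim(2) by blast
  qed
  then show ?thesis using that[of "C * C'"] C(1) C'(1) by simp
qed

lemma reduced_inequality:
  assumes "0 < C" "\<forall>\<^sub>F x in nhds 0. norm (M x) \<ge> C * \<bar>E x\<bar> powr \<theta>"
  obtains C' where "0 < C'" "\<forall>\<^sub>F a in nhds 0. C' * \<bar>\<Gamma> a\<bar> powr \<theta> \<le> grad_size \<Gamma> a"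
proof -
  obtain C1 where C1: "0 < C1" "\<forall>\<^sub>F a in nhds 0. norm (M (P a)) \<le> C1 * grad_size \<Gamma> a"
    by (rule norm_M_le_jacobian) (rule that)
  from eventually_compose_filterlim[OF assms(2) P_tendsto] C1(2)
  have "\<forall>\<^sub>F a in nhds 0. C / C1 * \<bar>\<Gamma> a\<bar> powr \<theta> \<le> grad_size \<Gamma> a"
  proof eventually_elim
    case (elim a)
    then have "C * \<bar>E (P a)\<bar> powr \<theta> \<le> C1 * grad_size \<Gamma> a" by linarith
    then show ?case using C1(1) by (simp add: \<Gamma>_eq field_simps)
  qed
  then show ?thesis using that[of "C / C1"] assms(1) C1(1) by simp
qed

text \<open>Write \<open>x = P a + w\<close> with \<open>w\<close> in \<open>Z\<close>. Since \<open>R M\<close> vanishes at \<open>P a\<close> and \<open>L\<close> is bounded below on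
  \<open>Z\<close>, the norm of \<open>w\<close> is controlled by that of \<open>M x\<close>. The energies at \<open>x\<close> and at \<open>P a\<close> differ only by
  a quadratic term in \<open>w\<close>, because \<open>M (P a)\<close> annihilates \<open>w\<close>; an exponent of at least \<open>1/2\<close> absorbs it.\<close>

lemma lifted_inequality:
  assumes \<theta>: "1 / 2 \<le> \<theta>" "\<theta> \<le> 1"
    and ineq: "0 < C" "\<forall>\<^sub>F a in nhds 0. C * \<bar>\<Gamma> a\<bar> powr \<theta> \<le> grad_size \<Gamma> a"
  obtains C' where "0 < C'" "\<forall>\<^sub>F x in nhds 0. norm (M x) \<ge> C' * \<bar>E x\<bar> powr \<theta>"
proof -
  obtain \<eta> :: "'r \<Rightarrow> 'y" where \<eta>: "\<And>i. \<eta> i \<in> YK" "\<And>i x. pair (\<eta> i) (\<kappa> x) = x $ i"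
    by (rule dual_basis) (rule that)
  define \<xi> :: "'x \<Rightarrow> real ^ 'r" where "\<xi> x = (\<Sum>i\<in>UNIV. pair (\<eta> i) x *\<^sub>R axis i 1)" for x
  have blin_\<xi>: "bounded_linear \<xi>"
    unfolding \<xi>_def[abs_def]
    by (intro bounded_linear_sum bounded_linear_compose[OF bounded_linear_scaleR_left pair.bounded_linear_right])
  have \<xi>: "\<xi> (\<kappa> a + z) = a" if "z \<in> Z" for a z
    using basis_expansion[of a]
    by (simp add: \<xi>_def pair.add_right pair_YK_Z[OF \<eta>(1) that] \<eta>(2) scalar_mult_eq_scaleR)
  have decomp: "x - \<kappa> (\<xi> x) \<in> Z" for x
  proof -
    obtain k z where "k \<in> K" "z \<in> Z" "x = k + z" using Z unfolding closed_complement_def by blast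
    then obtain a where "x = \<kappa> a + z" using \<kappa>(3) by blast
    then show ?thesis using \<xi>[OF \<open>z \<in> Z\<close>, of a] \<open>z \<in> Z\<close> by simp
  qed
  have "isCont \<xi> 0" using blin_\<xi> by (rule linear_continuous_at)
  then have \<xi>_lim: "filterlim \<xi> (nhds 0) (nhds 0)"
    using linear_0[OF bounded_linear.linear[OF blin_\<xi>]] by (simp add: isCont_def tendsto_nhds_iff)
  have LZ: "closed (L ` Z)"
  proof -
    have "L ` Z = range L"
    proof
      show "range L \<subseteq> L ` Z"
      proof safe
        fix x
        have "L (\<kappa> (\<xi> x)) = 0" using \<kappa>(3) K by auto
        then have "L (x - \<kappa> (\<xi> x)) = L x" by (simp add: linear_diff[OF bounded_linear.linear[OF blin_L]])
        then show "L x \<in> L ` Z" using decomp[of x] by (metis imageI)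
      qed
    qed auto
    then show ?thesis using L(2) by simp
  qed
  have "z = 0" if "z \<in> Z" "L z = 0" for z
    using that Z_props(3) K by auto
  then obtain c where c: "0 < c" "\<And>z. z \<in> Z \<Longrightarrow> c * norm z \<le> norm (L z)"
    by (rule bounded_below_on_complement[OF blin_L Z_props(1,2) LZ]) (auto intro: that)
  have "real_analytic_at M 0" using M U(2) by blast
  then obtain T B \<delta> where T: "bounded_linear T" "0 < B" "0 < \<delta>"
    "\<And>h k s. norm h \<le> s \<Longrightarrow> norm k \<le> s \<Longrightarrow> s \<le> \<delta> \<Longrightarrow>
       norm (M (0 + h) - M (0 + k) - T (h - k)) \<le> B * s * norm (h - k)"
    by (rule analytic_strict_derivative) (rule that)
  have "T = L"
    using strict_derivative_imp_has_derivative[OF T] L(1) by (rule has_derivative_unique)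
  obtain KR where KR: "0 < KR" "\<And>y. norm (R y) \<le> norm y * KR"
    using bounded_linear.pos_bounded[OF R_props(1)] by blast
  obtain KL where KL: "0 < KL" "\<And>y. norm (L y) \<le> norm y * KL"
    using bounded_linear.pos_bounded[OF blin_L] by blast
  obtain Kp where Kp: "0 < Kp" "\<And>y x. norm (pair y x) \<le> norm y * norm x * Kp"
    using pair.pos_bounded by blast
  obtain CJ where CJ: "0 < CJ" "\<forall>\<^sub>F a in nhds 0. grad_size \<Gamma> a \<le> CJ * norm (M (P a))"
    by (rule jacobian_le_norm_M) (rule that)
  obtain \<delta>U where \<delta>U: "0 < \<delta>U" "ball 0 \<delta>U \<subseteq> U" using U openE by blast
  \<comment> \<open>On the ball of radius \<open>s\<close> the nonlinear part of \<open>M\<close> takes at most half of the lower bound of \<open>L\<close> on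
    \<open>Z\<close>, and \<open>norm w \<le> 1\<close>.\<close>
  define s where "s = min (min \<delta> (\<delta>U / 2)) (min (1 / 2) (c / (2 * KR * B)))"
  have s: "0 < s" "s \<le> \<delta>" "s < \<delta>U" "s \<le> 1 / 2" "KR * B * s \<le> c / 2"
  proof -
    show "0 < s" unfolding s_def using T \<delta>U KR c by simp
    show "s \<le> \<delta>" "s \<le> 1 / 2" unfolding s_def by auto
    show "s < \<delta>U" unfolding s_def using \<delta>U(1) by linarith
    have "s \<le> c / (2 * KR * B)" unfolding s_def by simp
    then show "KR * B * s \<le> c / 2" using KR T by (simp add: field_simps)
  qed
  define C2 where "C2 = KL + B * s"
  define C3 where "C3 = 1 + C2 * (2 * KR / c)"
  define Q where "Q = (CJ / C) * C3 + (Kp * C2) powr \<theta> * (2 * KR / c)"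
  have C2: "0 < C2" unfolding C2_def using KL T s by (simp add: add_pos_nonneg)
  have C3: "0 < C3" unfolding C3_def using C2 KR c by (simp add: add_pos_nonneg)
  have Q: "0 < Q" unfolding Q_def using CJ ineq(1) C3 KR c by (intro add_pos_nonneg) auto
  have ball: "\<forall>\<^sub>F x in nhds (0::'x). norm x < s"
    using s(1) by (auto simp: eventually_nhds_metric dist_norm intro!: exI[of _ s])
  have "\<forall>\<^sub>F x in nhds 0. \<bar>E x\<bar> powr \<theta> \<le> 2 * Q * norm (M x)"
    using ball eventually_compose_filterlim[OF eventually_compose_filterlim[OF ball P_tendsto] \<xi>_lim]
      eventually_compose_filterlim[OF eventually_P \<xi>_lim]
      eventually_compose_filterlim[OF ineq(2) \<xi>_lim]
      eventually_compose_filterlim[OF CJ(2) \<xi>_lim]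
  proof eventually_elim
    case (elim x)
    define a where "a = \<xi> x"
    define w where "w = x - P a"
    note a = elim[folded a_def]
    have wZ: "w \<in> Z"
      using subspace_diff[OF Z_props(1) decomp[of x], of "\<psi> (\<kappa> a)"] a(3)
      by (simp add: w_def P_def a_def algebra_simps)
    have strict: "norm (M y - M z - L (y - z)) \<le> B * s * norm (y - z)"
      if "norm y \<le> s" "norm z \<le> s" for y z
      using T(4)[OF that s(2)] \<open>T = L\<close> by simp
    have segment: "norm (P a + t *\<^sub>R w) \<le> s" if t: "0 \<le> t" "t \<le> 1" for t
    proof -
      have "P a + t *\<^sub>R w = (1 - t) *\<^sub>R P a + t *\<^sub>R x" by (simp add: w_def algebra_simps)
      then have "norm (P a + t *\<^sub>R w) \<le> (1 - t) * norm (P a) + t * norm x"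
        using t norm_triangle_ineq[of "(1 - t) *\<^sub>R P a" "t *\<^sub>R x"] by simp
      also have "\<dots> \<le> (1 - t) * s + t * s" using a(1,2) t by (intro add_mono mult_left_mono) auto
      finally show ?thesis by (simp add: algebra_simps)
    qed
    have Mdiff: "norm (M (P a + t *\<^sub>R w) - M (P a)) \<le> C2 * norm w" if t: "0 \<le> t" "t \<le> 1" for t
    proof -
      have "norm (M (P a + t *\<^sub>R w) - M (P a) - L (t *\<^sub>R w)) \<le> B * s * norm (t *\<^sub>R w)"
        using strict[of "P a + t *\<^sub>R w" "P a"] segment[OF t] a(2) by simp
      moreover have "norm (L (t *\<^sub>R w)) \<le> norm (t *\<^sub>R w) * KL" by (rule KL(2))
      ultimately have "norm (M (P a + t *\<^sub>R w) - M (P a)) \<le> C2 * norm (t *\<^sub>R w)"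
        using norm_triangle_sub[of "M (P a + t *\<^sub>R w) - M (P a)" "L (t *\<^sub>R w)"]
        by (simp add: C2_def algebra_simps)
      also have "\<dots> \<le> C2 * norm w"
        using t C2 by (intro mult_left_mono) (auto intro: mult_left_le_one_le)
      finally show ?thesis .
    qed
    have "c * norm w \<le> norm (L w)" by (rule c(2)[OF wZ])
    also have "L w = R (M x) - R (M x - M (P a) - L (x - P a))"
      using a(3) by (simp add: w_def linear_diff[OF bounded_linear.linear[OF R_props(1)]] R_props(2) R_props(3))
    also have "norm \<dots> \<le> norm (R (M x)) + norm (R (M x - M (P a) - L (x - P a)))"
      by (rule norm_triangle_ineq4)
    also have "\<dots> \<le> norm (M x) * KR + (B * s * norm (x - P a)) * KR"
      using KR strict[of x "P a"] a(1,2)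
      by (intro add_mono KR(2) order_trans[OF KR(2)] mult_right_mono) auto
    also have "(B * s * norm (x - P a)) * KR = (KR * B * s) * norm w" by (simp add: w_def)
    also have "\<dots> \<le> c / 2 * norm w" using s(5) by (rule mult_right_mono) simp
    finally have w: "norm w \<le> 2 * KR / c * norm (M x)" using c(1) by (simp add: field_simps)
    have "norm (M (P a)) \<le> norm (M x) + C2 * norm w"
      using Mdiff[of 1] norm_triangle_ineq4[of "M x" "M x - M (P a)"] by (simp add: w_def)
    also have "\<dots> \<le> C3 * norm (M x)"
      using mult_left_mono[OF w, of C2] C2 by (simp add: C3_def algebra_simps)
    finally have MP: "norm (M (P a)) \<le> C3 * norm (M x)" .
    have Ediff: "\<bar>E x - \<Gamma> a\<bar> \<le> Kp * C2 * norm w ^ 2"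
    proof -
      let ?f = "\<lambda>t::real. E (P a + t *\<^sub>R w)"
      have "(?f has_real_derivative pair (M (P a + t *\<^sub>R w)) w) (at t)" if t: "0 \<le> t" "t \<le> 1" for t
      proof -
        have "P a + t *\<^sub>R w \<in> U" using segment[OF t] s(3) \<delta>U(2) by auto
        then have "(E has_derivative (\<lambda>v. pair (M (P a + t *\<^sub>R w)) v)) (at (P a + t *\<^sub>R w))"
          using gradient by blast
        moreover have "((\<lambda>t::real. P a + t *\<^sub>R w) has_derivative (\<lambda>t. t *\<^sub>R w)) (at t)"
          by (auto intro!: derivative_eq_intros)
        ultimately have "(?f has_derivative (\<lambda>h. pair (M (P a + t *\<^sub>R w)) (h *\<^sub>R w))) (at t)"
          by (rule has_derivative_compose[rotated])
        then show ?thesis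
          unfolding has_field_derivative_def
          by (rule has_derivative_eq_rhs) (auto simp: pair.scaleR_right)
      qed
      then obtain t where t: "0 < t" "t < 1" "?f 1 - ?f 0 = (1 - 0) * pair (M (P a + t *\<^sub>R w)) w"
        using MVT2[of 0 1 ?f "\<lambda>t. pair (M (P a + t *\<^sub>R w)) w"] by auto
      have "pair (M (P a)) w = 0" using a(3) wZ by (intro pair_YK_Z) auto
      then have "E x - \<Gamma> a = pair (M (P a + t *\<^sub>R w) - M (P a)) w"
        using t(3) by (simp add: w_def \<Gamma>_eq pair.diff_left)
      also have "\<bar>\<dots>\<bar> \<le> norm (M (P a + t *\<^sub>R w) - M (P a)) * norm w * Kp" using Kp(2) by simp
      also have "\<dots> \<le> (C2 * norm w) * norm w * Kp"
        using Mdiff[of t] t Kp(1) by (intro mult_right_mono) auto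
      finally show ?thesis by (simp add: power2_eq_square mult_ac)
    qed
    have w1: "norm w \<le> 1" using a(1,2) s(4) norm_triangle_ineq4[of x "P a"] by (simp add: w_def)
    have "norm w powr (2 * \<theta>) \<le> norm w powr 1"
      using w1 \<theta>(1) by (intro powr_mono') auto
    then have w2: "(Kp * C2 * norm w ^ 2) powr \<theta> \<le> (Kp * C2) powr \<theta> * norm w"
      using Kp(1) C2 by (simp add: powr_mult powr_powr mult_left_mono flip: powr_numeral)
    have g: "\<bar>\<Gamma> a\<bar> powr \<theta> \<le> (CJ / C) * norm (M (P a))"
      using order_trans[OF a(4,5)] ineq(1) by (simp add: field_simps)
    define m where "m = max \<bar>\<Gamma> a\<bar> (Kp * C2 * norm w ^ 2)"
    have "\<bar>E x\<bar> \<le> 2 * m" using Ediff unfolding m_def by linarith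
    then have "\<bar>E x\<bar> powr \<theta> \<le> (2 * m) powr \<theta>" using \<theta> by (intro powr_mono2) auto
    also have "\<dots> = 2 powr \<theta> * m powr \<theta>" by (rule powr_mult)
    also have "\<dots> \<le> 2 * (\<bar>\<Gamma> a\<bar> powr \<theta> + (Kp * C2 * norm w ^ 2) powr \<theta>)"
    proof (rule mult_mono)
      show "2 powr \<theta> \<le> 2" using powr_mono[of \<theta> 1 2] \<theta> by simp
      show "m powr \<theta> \<le> \<bar>\<Gamma> a\<bar> powr \<theta> + (Kp * C2 * norm w ^ 2) powr \<theta>"
        unfolding m_def by (auto simp: max_def)
    qed auto
    also have "\<dots> \<le> 2 * ((CJ / C) * (C3 * norm (M x)) + (Kp * C2) powr \<theta> * (2 * KR / c * norm (M x)))"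
    proof (intro mult_left_mono add_mono)
      show "\<bar>\<Gamma> a\<bar> powr \<theta> \<le> (CJ / C) * (C3 * norm (M x))"
        using order_trans[OF g mult_left_mono[OF MP, of "CJ / C"]] CJ(1) ineq(1) by simp
      show "(Kp * C2 * norm w ^ 2) powr \<theta> \<le> (Kp * C2) powr \<theta> * (2 * KR / c * norm (M x))"
        using order_trans[OF w2 mult_left_mono[OF w, of "(Kp * C2) powr \<theta>"]] by simp
    qed auto
    also have "\<dots> = 2 * Q * norm (M x)" by (simp add: Q_def algebra_simps)
    finally show ?case .
  qed
  then have "\<forall>\<^sub>F x in nhds 0. norm (M x) \<ge> 1 / (2 * Q) * \<bar>E x\<bar> powr \<theta>"
  proof eventually_elim
    case (elim x)
    then show ?case using Q by (simp add: field_simps)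
  qed
  then show ?thesis using that[of "1 / (2 * Q)"] Q by simp
qed

end

section \<open>Analytic functions on a manifold in local coordinates\<close>

lemma analytic_atlas_chart:
  assumes "analytic_atlas A" "(V, y) \<in> A"
  shows "open V" "open (y ` V)" "homeomorphism V (y ` V) y (inv_into V y)" "inj_on y V"
proof -
  show *: "open V" "open (y ` V)" "homeomorphism V (y ` V) y (inv_into V y)"
    using assms unfolding analytic_atlas_def by blast+
  show "inj_on y V" using homeomorphism_apply1[OF *(3)] by (metis inj_onI)
qed

lemma filterlim_chart:
  assumes "analytic_atlas A" "(V, y) \<in> A" "p \<in> V"
  shows "filterlim y (nhds (y p)) (nhds p)" "filterlim (inv_into V y) (nhds p) (nhds (y p))"
proof -
  note c = analytic_atlas_chart[OF assms(1,2)]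
  have "isCont y p"
    using homeomorphism_cont1[OF c(3)] c(1) assms(3) continuous_on_eq_continuous_at by blast
  then show "filterlim y (nhds (y p)) (nhds p)"
    unfolding isCont_def by (simp add: tendsto_at_iff_tendsto_nhds)
  have "isCont (inv_into V y) (y p)"
    using homeomorphism_cont2[OF c(3)] c(2) assms(3) continuous_on_eq_continuous_at by blast
  moreover have "inv_into V y (y p) = p" using c(4) assms(3) by simp
  ultimately show "filterlim (inv_into V y) (nhds p) (nhds (y p))"
    unfolding isCont_def using tendsto_at_iff_tendsto_nhds[of "inv_into V y" "y p"] by simp
qed

lemma manifold_analytic_tendsto:
  fixes f :: "'m::{t2_space,second_countable_topology} \<Rightarrow> 'b::banach"
  assumes A: "analytic_atlas A" and f: "manifold_analytic_at A f p"
  shows "filterlim f (nhds (f p)) (nhds p)"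
proof -
  obtain V y where V: "(V, y) \<in> A" "p \<in> V" "real_analytic_at (f \<circ> inv_into V y) (y p)"
    using f unfolding manifold_analytic_at_def by blast
  note c = analytic_atlas_chart[OF A V(1)]
  have "filterlim (f \<circ> inv_into V y) (nhds ((f \<circ> inv_into V y) (y p))) (nhds (y p))"
    using analytic_isCont[OF V(3)] unfolding isCont_def by (simp only: tendsto_at_iff_tendsto_nhds)
  then have "filterlim (f \<circ> inv_into V y) (nhds (f p)) (nhds (y p))"
    using c(4) V(2) by simp
  from filterlim_compose[OF this filterlim_chart(1)[OF A V(1,2)]]
  have "filterlim (\<lambda>q. (f \<circ> inv_into V y) (y q)) (nhds (f p)) (nhds p)" .
  moreover have "\<forall>\<^sub>F q in nhds p. (f \<circ> inv_into V y) (y q) = f q"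
    using eventually_nhds_in_open[OF c(1) V(2)] by eventually_elim (use c(4) in simp)
  ultimately show ?thesis by (rule Lim_transform_eventually)
qed

lemma manifold_analytic_const:
  assumes "analytic_atlas A"
  shows "manifold_analytic_at A (\<lambda>_. c) p"
proof -
  have "p \<in> (\<Union>(V, y)\<in>A. V)" using assms unfolding analytic_atlas_def by simp
  then obtain V y where "(V, y) \<in> A" "p \<in> V" by auto
  then show ?thesis unfolding manifold_analytic_at_def o_def using real_analytic_at_const by fast
qed

text \<open>Passing from the chart that witnesses analyticity to another chart composes with a transition
  map.\<close>

lemma manifold_analytic_in_chart:
  fixes f :: "'m::{t2_space,second_countable_topology} \<Rightarrow> 'b::banach"
  assumes ch: "analytic_chart A V y" and p: "p \<in> V" and f: "manifold_analytic_at A f p"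
  shows "real_analytic_at (f \<circ> inv_into V y) (y p)"
proof -
  have A: "analytic_atlas (insert (V, y) A)" using ch by (simp add: analytic_chart_def)
  obtain W z where W: "(W, z) \<in> A" "p \<in> W" "real_analytic_at (f \<circ> inv_into W z) (z p)"
    using f unfolding manifold_analytic_at_def by blast
  have V: "(V, y) \<in> insert (V, y) A" and W': "(W, z) \<in> insert (V, y) A" using W(1) by auto
  note cV = analytic_atlas_chart[OF A V] and cW = analytic_atlas_chart[OF A W']
  have "y p \<in> y ` (V \<inter> W)" using p W(2) by blast
  then have tr: "real_analytic_at (z \<circ> inv_into V y) (y p)"
    using A V W' unfolding analytic_atlas_def by blast
  have invp: "inv_into V y (y p) = p" using cV(4) p by simp
  have "real_analytic_at (\<lambda>x. (f \<circ> inv_into W z) ((z \<circ> inv_into V y) x)) (y p)"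
    by (rule real_analytic_at_compose[OF tr]) (use W(3) invp in \<open>simp add: o_def\<close>)
  moreover have "\<forall>\<^sub>F x in nhds (y p). (f \<circ> inv_into W z) ((z \<circ> inv_into V y) x) = (f \<circ> inv_into V y) x"
    using eventually_compose_filterlim[OF eventually_nhds_in_open[OF cW(1) W(2)] filterlim_chart(2)[OF A V p]]
    by eventually_elim (use cW(4) in simp)
  ultimately show ?thesis by (rule real_analytic_at_cong)
qed

lemma eventually_abs_bounded:
  fixes f :: "'a::topological_space \<Rightarrow> real"
  assumes "filterlim f (nhds (f p)) (nhds p)"
  shows "\<forall>\<^sub>F q in nhds p. \<bar>f q\<bar> \<le> \<bar>f p\<bar> + 1"
proof -
  have "((\<lambda>q. \<bar>f q\<bar>) \<longlongrightarrow> \<bar>f p\<bar>) (nhds p)" using assms by (rule tendsto_rabs)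
  from order_tendstoD(2)[OF this, of "\<bar>f p\<bar> + 1"] show ?thesis by (auto elim: eventually_mono)
qed

lemma eventually_abs_bounded_below:
  fixes f :: "'a::topological_space \<Rightarrow> real"
  assumes "filterlim f (nhds (f p)) (nhds p)" "f p \<noteq> 0"
  shows "\<forall>\<^sub>F q in nhds p. \<bar>f p\<bar> / 2 \<le> \<bar>f q\<bar>"
proof -
  have "((\<lambda>q. \<bar>f q\<bar>) \<longlongrightarrow> \<bar>f p\<bar>) (nhds p)" using assms(1) by (rule tendsto_rabs)
  from order_tendstoD(1)[OF this, of "\<bar>f p\<bar> / 2"] assms(2) show ?thesis by (auto elim: eventually_mono)
qed

lemma germ_idealI:
  assumes "\<And>g. g \<in> G \<Longrightarrow> an (c g) p" "\<And>q. h q = (\<Sum>g\<in>G. c g q * g q)"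
  shows "h \<in> germ_ideal an p G"
  unfolding germ_ideal_def mem_Collect_eq by (rule exI[of _ c]) (use assms in simp)

lemma germ_idealE:
  assumes "h \<in> germ_ideal an p G"
  obtains c where "\<And>g. g \<in> G \<Longrightarrow> an (c g) p" "\<forall>\<^sub>F q in nhds p. h q = (\<Sum>g\<in>G. c g q * g q)"
  using assms unfolding germ_ideal_def mem_Collect_eq by (elim exE conjE) (rule that, simp_all)

text \<open>If a finitely generated ideal of germs is principal, then expressing the generators by each other
  shows that the absolute values of the generators are comparable.\<close>

lemma germ_ideal_principal_comparable:
  fixes m :: "'a::topological_space \<Rightarrow> real"
  assumes cont: "\<And>f. an f p \<Longrightarrow> filterlim f (nhds (f p)) (nhds p)"
    and const: "\<And>c. an (\<lambda>_. c) p"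
    and G: "finite G" and eq: "germ_ideal an p G = germ_ideal an p {m}"
  obtains C where "0 < C"
    "\<forall>\<^sub>F q in nhds p. \<bar>m q\<bar> \<le> C * (\<Sum>g\<in>G. \<bar>g q\<bar>) \<and> (\<Sum>g\<in>G. \<bar>g q\<bar>) \<le> C * \<bar>m q\<bar>"
proof -
  have "m \<in> germ_ideal an p {m}"
    by (rule germ_idealI[where c = "\<lambda>_ _. 1"]) (simp_all add: const)
  then have "m \<in> germ_ideal an p G" by (simp add: eq)
  then obtain c where c: "\<And>g. g \<in> G \<Longrightarrow> an (c g) p" "\<forall>\<^sub>F q in nhds p. m q = (\<Sum>g\<in>G. c g q * g q)"
    by (rule germ_idealE) (rule that)
  have "\<exists>d. an d p \<and> (\<forall>\<^sub>F q in nhds p. g q = d q * m q)" if g: "g \<in> G" for g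
  proof -
    have "(if h = g then 1 else 0) * h q = (if h = g then g q else 0)" for h q by simp
    then have "g q = (\<Sum>h\<in>G. (if h = g then 1 else 0) * h q)" for q
      using G g by simp
    then have "g \<in> germ_ideal an p G"
      by (intro germ_idealI[where c = "\<lambda>h _. if h = g then 1 else 0"]) (auto intro: const)
    then have "g \<in> germ_ideal an p {m}" by (simp add: eq)
    then obtain d where "\<And>h. h \<in> {m} \<Longrightarrow> an (d h) p" "\<forall>\<^sub>F q in nhds p. g q = (\<Sum>h\<in>{m}. d h q * h q)"
      by (rule germ_idealE) (rule that)
    then show ?thesis by (intro exI[of _ "d m"]) simp
  qed
  then have "\<forall>g\<in>G. \<exists>d. an d p \<and> (\<forall>\<^sub>F q in nhds p. g q = d q * m q)" by blast
  from bchoice[OF this] obtain d where d: "\<And>g. g \<in> G \<Longrightarrow> an (d g) p"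
    "\<And>g. g \<in> G \<Longrightarrow> \<forall>\<^sub>F q in nhds p. g q = d g q * m q" by blast
  define C where "C = (\<Sum>g\<in>G. \<bar>c g p\<bar> + 1) + (\<Sum>g\<in>G. \<bar>d g p\<bar> + 1) + 1"
  have C: "0 < C" "(\<Sum>g\<in>G. \<bar>c g p\<bar> + 1) \<le> C" "(\<Sum>g\<in>G. \<bar>d g p\<bar> + 1) \<le> C"
    unfolding C_def by (auto intro!: add_nonneg_pos add_nonneg_nonneg sum_nonneg)
  have "\<forall>\<^sub>F q in nhds p. \<forall>g\<in>G. \<bar>c g q\<bar> \<le> \<bar>c g p\<bar> + 1"
    by (intro eventually_ball_finite G ballI eventually_abs_bounded cont c)
  moreover have "\<forall>\<^sub>F q in nhds p. \<forall>g\<in>G. \<bar>d g q\<bar> \<le> \<bar>d g p\<bar> + 1"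
    by (intro eventually_ball_finite G ballI eventually_abs_bounded cont d)
  moreover have "\<forall>\<^sub>F q in nhds p. \<forall>g\<in>G. g q = d g q * m q"
    by (intro eventually_ball_finite G ballI d)
  ultimately have "\<forall>\<^sub>F q in nhds p. \<bar>m q\<bar> \<le> C * (\<Sum>g\<in>G. \<bar>g q\<bar>) \<and> (\<Sum>g\<in>G. \<bar>g q\<bar>) \<le> C * \<bar>m q\<bar>"
    using c(2)
  proof eventually_elim
    case (elim q)
    let ?S = "\<Sum>g\<in>G. \<bar>g q\<bar>"
    have S: "0 \<le> ?S" "\<And>g. g \<in> G \<Longrightarrow> \<bar>g q\<bar> \<le> ?S"
      using G by (auto intro: sum_nonneg member_le_sum)
    have "\<bar>m q\<bar> \<le> (\<Sum>g\<in>G. \<bar>c g q * g q\<bar>)" unfolding elim(4) by (rule sum_abs)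
    also have "\<dots> \<le> (\<Sum>g\<in>G. (\<bar>c g p\<bar> + 1) * ?S)"
      unfolding abs_mult using elim(1) S by (intro sum_mono mult_mono) auto
    also have "\<dots> = (\<Sum>g\<in>G. \<bar>c g p\<bar> + 1) * ?S" by (rule sum_distrib_right[symmetric])
    also have "\<dots> \<le> C * ?S" using C(2) S(1) by (rule mult_right_mono)
    finally have 1: "\<bar>m q\<bar> \<le> C * ?S" .
    have "?S \<le> (\<Sum>g\<in>G. (\<bar>d g p\<bar> + 1) * \<bar>m q\<bar>)"
    proof (rule sum_mono)
      fix g assume g: "g \<in> G"
      have "\<bar>g q\<bar> = \<bar>d g q\<bar> * \<bar>m q\<bar>" using elim(3) g by (metis abs_mult)
      also have "\<dots> \<le> (\<bar>d g p\<bar> + 1) * \<bar>m q\<bar>" using elim(2) g by (intro mult_right_mono) auto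
      finally show "\<bar>g q\<bar> \<le> (\<bar>d g p\<bar> + 1) * \<bar>m q\<bar>" .
    qed
    also have "\<dots> = (\<Sum>g\<in>G. \<bar>d g p\<bar> + 1) * \<bar>m q\<bar>" by (rule sum_distrib_right[symmetric])
    also have "\<dots> \<le> C * \<bar>m q\<bar>" using C(3) by (intro mult_right_mono) auto
    finally show ?case using 1 by simp
  qed
  then show ?thesis using that C(1) by blast
qed

section \<open>Monomials\<close>

definition monom_size :: "'f set \<Rightarrow> ('f \<Rightarrow> 'r) \<Rightarrow> ('f \<Rightarrow> nat) \<Rightarrow> real ^ 'r \<Rightarrow> real" where
  "monom_size I j e x = (\<Prod>F\<in>I. \<bar>x $ j F\<bar> ^ e F)"

lemma monom_size_nonneg: "0 \<le> monom_size I j e x"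
  by (simp add: monom_size_def prod_nonneg)

lemma monom_size_curve:
  assumes "finite I" "inj_on j I" "F \<in> I"
  shows "monom_size I j e (\<chi> i. if i = j F then s else t) = \<bar>s\<bar> ^ e F * \<bar>t\<bar> ^ (\<Sum>F'\<in>I - {F}. e F')"
proof -
  have "monom_size I j e (\<chi> i. if i = j F then s else t)
      = \<bar>s\<bar> ^ e F * (\<Prod>F'\<in>I - {F}. \<bar>if j F' = j F then s else t\<bar> ^ e F')"
    unfolding monom_size_def using assms(1,3) by (simp add: prod.remove)
  also have "(\<Prod>F'\<in>I - {F}. \<bar>if j F' = j F then s else t\<bar> ^ e F') = (\<Prod>F'\<in>I - {F}. \<bar>t\<bar> ^ e F')"
    by (rule prod.cong) (use assms in \<open>auto dest: inj_onD\<close>)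
  finally show ?thesis by (simp add: power_sum)
qed

lemma norm_curve_le:
  fixes s t :: real
  shows "norm (\<chi> i::'r::finite. if i = k then s else t) \<le> real CARD('r) * max \<bar>s\<bar> \<bar>t\<bar>"
proof -
  have "norm (\<chi> i::'r. if i = k then s else t) \<le> (\<Sum>i\<in>UNIV. \<bar>(\<chi> i::'r. if i = k then s else t) $ i\<bar>)"
    by (rule norm_le_l1_cart)
  also have "\<dots> \<le> (\<Sum>i\<in>(UNIV::'r set). max \<bar>s\<bar> \<bar>t\<bar>)" by (rule sum_mono) auto
  finally show ?thesis by simp
qed

text \<open>On the hyperplane of \<open>F\<close> the gradient vanishes if \<open>b F > 0\<close>, so that \<open>\<phi>\<close> is constant there and
  hence zero; this forces \<open>a F > 0\<close>. Integrating the gradient bound transversally to the hyperplane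
  through a point off the other hyperplanes gives \<open>b F < a F\<close>.\<close>

lemma monomial_gradient_exponents:
  fixes \<phi> :: "real ^ 'r::finite \<Rightarrow> real"
  assumes I: "finite I" "inj_on j I" "F \<in> I"
    and pos: "0 < c" "0 < C" "0 < \<delta>"
    and low: "\<And>x. norm x < \<delta> \<Longrightarrow> c * monom_size I j a x \<le> \<bar>\<phi> x\<bar>"
    and up: "\<And>x. norm x < \<delta> \<Longrightarrow> \<bar>\<phi> x\<bar> \<le> C * monom_size I j a x"
    and der: "\<And>x. norm x < \<delta> \<Longrightarrow> \<exists>G. (\<phi> has_derivative G) (at x) \<and>
                (\<forall>v. \<bar>G v\<bar> \<le> C * monom_size I j b x * norm v)"
    and \<phi>0: "\<phi> 0 = 0"
  shows "0 < b F \<Longrightarrow> 0 < a F" "0 < a F \<Longrightarrow> b F < a F"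
proof -
  \<comment> \<open>Points whose coordinates are at most \<open>\<epsilon>\<close> lie in the ball of radius \<open>\<delta>\<close>.\<close>
  define \<epsilon> where "\<epsilon> = \<delta> / (2 * real CARD('r))"
  have \<epsilon>: "0 < \<epsilon>" "real CARD('r) * \<epsilon> < \<delta>" using pos(3) by (auto simp: \<epsilon>_def)
  define w :: "real \<Rightarrow> real \<Rightarrow> real ^ 'r" where "w s t = (\<chi> i. if i = j F then s else t)" for s t
  have w\<delta>: "norm (w s t) < \<delta>" if "\<bar>s\<bar> \<le> \<epsilon>" "\<bar>t\<bar> \<le> \<epsilon>" for s t
  proof -
    have "norm (w s t) \<le> real CARD('r) * max \<bar>s\<bar> \<bar>t\<bar>" unfolding w_def by (rule norm_curve_le)
    also have "\<dots> \<le> real CARD('r) * \<epsilon>" using that by (intro mult_left_mono) auto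
    finally show ?thesis using \<epsilon>(2) by linarith
  qed
  have mw: "monom_size I j e (w s t) = \<bar>s\<bar> ^ e F * \<bar>t\<bar> ^ (\<Sum>F'\<in>I - {F}. e F')" for e s t
    unfolding w_def by (rule monom_size_curve[OF I])
  have mvt: "\<exists>t. 0 < t \<and> t < l \<and> \<bar>\<phi> (x + l *\<^sub>R v) - \<phi> x\<bar> \<le> l * (C * monom_size I j b (x + t *\<^sub>R v) * norm v)"
    if l: "0 < l" and seg: "\<And>t. 0 \<le> t \<Longrightarrow> t \<le> l \<Longrightarrow> norm (x + t *\<^sub>R v) < \<delta>" for x v l
  proof -
    define G where "G x = (SOME G. (\<phi> has_derivative G) (at x) \<and>
                (\<forall>v. \<bar>G v\<bar> \<le> C * monom_size I j b x * norm v))" for x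
    have G: "(\<phi> has_derivative G z) (at z)" "\<And>v. \<bar>G z v\<bar> \<le> C * monom_size I j b z * norm v"
      if "norm z < \<delta>" for z
      using someI_ex[OF der[OF that]] unfolding G_def by auto
    have "((\<lambda>t. \<phi> (x + t *\<^sub>R v)) has_real_derivative G (x + t *\<^sub>R v) v) (at t)" if t: "0 \<le> t" "t \<le> l" for t
    proof -
      have lin: "linear (G (x + t *\<^sub>R v))" using G(1)[OF seg[OF t]] by (rule has_derivative_linear)
      have "((\<lambda>t::real. x + t *\<^sub>R v) has_derivative (\<lambda>t. t *\<^sub>R v)) (at t)"
        by (auto intro!: derivative_eq_intros)
      from has_derivative_compose[OF this G(1)[OF seg[OF t]]] show ?thesis
        unfolding has_field_derivative_def
        by (rule has_derivative_eq_rhs) (auto simp: linear_scale[OF lin])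
    qed
    from MVT2[OF l this] obtain t where t: "0 < t" "t < l"
      "\<phi> (x + l *\<^sub>R v) - \<phi> (x + 0 *\<^sub>R v) = (l - 0) * G (x + t *\<^sub>R v) v" by blast
    have "\<bar>\<phi> (x + l *\<^sub>R v) - \<phi> x\<bar> = l * \<bar>G (x + t *\<^sub>R v) v\<bar>" using t l by (simp add: abs_mult)
    also have "\<dots> \<le> l * (C * monom_size I j b (x + t *\<^sub>R v) * norm v)"
      using G(2)[OF seg[of t], of v] t l by (intro mult_left_mono) auto
    finally show ?thesis using t by blast
  qed
  show "0 < a F" if b: "0 < b F"
  proof (rule ccontr)
    assume "\<not> 0 < a F"
    then have aF: "a F = 0" by simp
    have ray: "0 + t *\<^sub>R w 0 1 = w 0 t" for t by (simp add: w_def vec_eq_iff)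
    obtain t where "\<bar>\<phi> (0 + \<epsilon> *\<^sub>R w 0 1) - \<phi> 0\<bar> \<le> \<epsilon> * (C * monom_size I j b (0 + t *\<^sub>R w 0 1) * norm (w 0 1))"
      using mvt[OF \<epsilon>(1), of 0 "w 0 1"] w\<delta>[of 0] unfolding ray by auto
    then have "\<phi> (w 0 \<epsilon>) = 0" using b \<phi>0 unfolding ray mw by (simp add: zero_power)
    then have "c * monom_size I j a (w 0 \<epsilon>) \<le> 0" using low[OF w\<delta>[of 0 \<epsilon>]] \<epsilon>(1) by simp
    moreover have "0 < monom_size I j a (w 0 \<epsilon>)" unfolding mw using aF \<epsilon>(1) by simp
    ultimately show False using pos(1) by (simp add: mult_le_0_iff)
  qed
  show "b F < a F" if a: "0 < a F"
  proof -
    define A' where "A' = (\<Sum>F'\<in>I - {F}. a F')"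
    define B' where "B' = (\<Sum>F'\<in>I - {F}. b F')"
    have nz: "norm (axis (j F) 1 :: real ^ 'r) = 1" by simp
    have "\<forall>\<^sub>F s in at_right 0. (c * \<epsilon> ^ A') * s powr real (a F) \<le> (C * \<epsilon> ^ B') * s powr real (Suc (b F))"
      unfolding eventually_at_right_field
    proof (intro exI[of _ \<epsilon>] conjI allI impI)
      fix s :: real assume s: "0 < s" "s < \<epsilon>"
      have line: "w 0 \<epsilon> + t *\<^sub>R axis (j F) 1 = w t \<epsilon>" for t
        by (auto simp: w_def vec_eq_iff axis_def)
      obtain t where t: "0 < t" "t < s"
        "\<bar>\<phi> (w 0 \<epsilon> + s *\<^sub>R axis (j F) 1) - \<phi> (w 0 \<epsilon>)\<bar>
           \<le> s * (C * monom_size I j b (w 0 \<epsilon> + t *\<^sub>R axis (j F) 1) * norm (axis (j F) 1 :: real ^ 'r))"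
        using mvt[OF s(1), of "w 0 \<epsilon>" "axis (j F) 1"] w\<delta> s unfolding line by auto
      have "\<phi> (w 0 \<epsilon>) = 0" using up[OF w\<delta>[of 0 \<epsilon>]] \<epsilon>(1) a unfolding mw by (simp add: zero_power)
      then have "\<bar>\<phi> (w s \<epsilon>)\<bar> \<le> s * (C * (t ^ b F * \<epsilon> ^ B'))"
        using t unfolding line mw nz B'_def using \<epsilon>(1) by simp
      also have "\<dots> \<le> s * (C * (s ^ b F * \<epsilon> ^ B'))"
        using t s pos \<epsilon>(1) by (intro mult_left_mono mult_right_mono power_mono) auto
      finally have "c * (s ^ a F * \<epsilon> ^ A') \<le> s * (C * (s ^ b F * \<epsilon> ^ B'))"
        using low[OF w\<delta>[of s \<epsilon>]] s \<epsilon>(1) unfolding mw A'_def by simp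
      then show "(c * \<epsilon> ^ A') * s powr real (a F) \<le> (C * \<epsilon> ^ B') * s powr real (Suc (b F))"
        unfolding powr_realpow[OF s(1)] by (simp add: mult_ac)
    qed (use \<epsilon> in auto)
    from powr_eventually_le_imp[OF _ this] have "real (Suc (b F)) \<le> real (a F)"
      using pos(1) \<epsilon>(1) by simp
    then show ?thesis by simp
  qed
qed

text \<open>The coordinates are at most one in absolute value, so a larger exponent gives a smaller value.\<close>

lemma monom_size_powr_le:
  fixes x :: "real ^ 'r::finite"
  assumes I: "finite I" and \<theta>: "0 \<le> \<theta>" "\<And>F. F \<in> I \<Longrightarrow> real (b F) \<le> \<theta> * real (a F)"
    and x: "norm x \<le> 1"
  shows "monom_size I j a x powr \<theta> \<le> monom_size I j b x"
proof -
  have "monom_size I j a x powr \<theta> = (\<Prod>F\<in>I. (\<bar>x $ j F\<bar> ^ a F) powr \<theta>)"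
    unfolding monom_size_def by (rule prod_powr_distrib)
  also have "\<dots> \<le> (\<Prod>F\<in>I. \<bar>x $ j F\<bar> ^ b F)"
  proof (rule prod_mono, safe)
    fix F assume F: "F \<in> I"
    let ?t = "\<bar>x $ j F\<bar>"
    have t1: "?t \<le> 1" using component_le_norm_cart[of x "j F"] x by linarith
    show "(?t ^ a F) powr \<theta> \<le> ?t ^ b F"
    proof (cases "?t = 0")
      case True
      then show ?thesis using \<theta>(2)[OF F] by (cases "a F = 0") (auto simp: power_0_left)
    next
      case False
      then have t: "0 < ?t" by simp
      have "(?t ^ a F) powr \<theta> = ?t powr (\<theta> * real (a F))"
        using t by (simp add: powr_powr mult.commute flip: powr_realpow)
      also have "\<dots> \<le> ?t powr real (b F)" by (rule powr_mono'[OF \<theta>(2)[OF F]]) (use t t1 in auto)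
      also have "\<dots> = ?t ^ b F" using t by (rule powr_realpow)
      finally show ?thesis .
    qed
  qed auto
  finally show ?thesis unfolding monom_size_def .
qed

lemma derivative_bound_of_lipschitz:
  assumes f: "(f has_derivative T) (at x)" and lip: "\<forall>\<^sub>F y in nhds x. norm (f y - f x) \<le> B * norm (y - x)"
  shows "norm (T v) \<le> B * norm v"
proof (rule field_le_epsilon)
  fix e :: real assume e: "0 < e"
  define e' where "e' = e / (norm v + 1)"
  have e': "0 < e'" "e' * norm v \<le> e"
  proof -
    show "0 < e'" unfolding e'_def using e by (simp add: add_nonneg_pos)
    have "e' * norm v \<le> e' * (norm v + 1)" using \<open>0 < e'\<close> by (intro mult_left_mono) auto
    also have "\<dots> = e" unfolding e'_def using add_nonneg_pos[OF norm_ge_zero[of v] zero_less_one] by simp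
    finally show "e' * norm v \<le> e" .
  qed
  obtain d1 where d1: "0 < d1" "\<And>y. norm (y - x) < d1 \<Longrightarrow> norm (f y - f x - T (y - x)) \<le> e' * norm (y - x)"
    using f e'(1) unfolding has_derivative_at_alt by blast
  obtain d2 where d2: "0 < d2" "\<And>y. norm (y - x) < d2 \<Longrightarrow> norm (f y - f x) \<le> B * norm (y - x)"
    using lip unfolding eventually_nhds_metric dist_norm by blast
  define s where "s = min d1 d2 / (2 * (norm v + 1))"
  have np: "0 < norm v + 1" by (simp add: add_nonneg_pos)
  have s: "0 < s" unfolding s_def using d1 d2 np by simp
  have "norm (s *\<^sub>R v) \<le> s * (norm v + 1)" using s by simp
  also have "\<dots> = min d1 d2 / 2" unfolding s_def using np by (simp only: times_divide_eq_left mult_divide_mult_cancel_right)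
  also have "\<dots> < min d1 d2" using d1(1) d2(1) by (simp add: min_def)
  finally have "norm ((x + s *\<^sub>R v) - x) < d1" "norm ((x + s *\<^sub>R v) - x) < d2" by auto
  from d1(2)[OF this(1)] d2(2)[OF this(2)]
  have "norm (T (s *\<^sub>R v)) \<le> B * norm (s *\<^sub>R v) + e' * norm (s *\<^sub>R v)"
    using norm_triangle_ineq4[of "f (x + s *\<^sub>R v) - f x" "f (x + s *\<^sub>R v) - f x - T (s *\<^sub>R v)"] by simp
  also have "T (s *\<^sub>R v) = s *\<^sub>R T v" by (rule linear_scale[OF has_derivative_linear[OF f]])
  finally have "s * norm (T v) \<le> s * (B * norm v + e' * norm v)" using s by (simp add: algebra_simps)
  then show "norm (T v) \<le> B * norm v + e" using s e'(2) by simp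
qed

section \<open>Principalizations\<close>

locale principalized =
  fixes \<Gamma> :: "real ^ 'r::finite \<Rightarrow> real"
    and A :: "('m::{t2_space,second_countable_topology} set \<times> ('m \<Rightarrow> real ^ 'r)) set"
    and W :: "(real ^ 'r) set" and \<pi> :: "'m \<Rightarrow> real ^ 'r"
    and D :: "'m set set" and a b :: "'m set \<Rightarrow> nat"
  assumes prin: "common_principalization \<Gamma> A W \<pi> D a b"
    and \<Gamma>0: "\<Gamma> 0 = 0"
    and gradient_bound: "\<exists>C>0. \<forall>\<^sub>F x in nhds 0. \<exists>G. (\<Gamma> has_derivative G) (at x) \<and>
          (\<forall>v. \<bar>G v\<bar> \<le> C * grad_size \<Gamma> x * norm v)"
begin

lemma grad_size_nonneg: "0 \<le> grad_size \<Gamma> x"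
  by (rule sum_nonneg) simp

lemma modification: "analytic_atlas A" "open W" "0 \<in> W" "range \<pi> = W"
    "\<And>p. manifold_analytic_at A \<pi> p" "\<And>B. compact B \<Longrightarrow> B \<subseteq> W \<Longrightarrow> compact (\<pi> -` B)"
  using prin unfolding common_principalization_def proper_analytic_modification_def by auto

lemma \<pi>_tendsto: "filterlim \<pi> (nhds (\<pi> p)) (nhds p)"
  by (rule manifold_analytic_tendsto[OF modification(1,5)])

lemma continuous_\<pi>: "continuous_on UNIV \<pi>"
  using \<pi>_tendsto unfolding continuous_on_def by (auto intro: tendsto_within_subset simp: tendsto_at_iff_tendsto_nhds)

lemma crossing_chart_at:
  assumes "\<pi> p = 0"
  obtains V y j u v where "crossing_chart A D p V y j"
    "\<forall>q\<in>V. manifold_analytic_at A u q \<and> u q \<noteq> 0 \<and> manifold_analytic_at A v q \<and> v q \<noteq> 0"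
    "\<forall>q\<in>V. \<Gamma> (\<pi> q) = u q * (\<Prod>F\<in>{F\<in>D. p \<in> F}. (y q $ j F) ^ a F)"
    "germ_ideal (manifold_analytic_at A) p ((\<lambda>g. g \<circ> \<pi>) ` jacobian_ideal \<Gamma>) =
     germ_ideal (manifold_analytic_at A) p {\<lambda>q. v q * (\<Prod>F\<in>{F\<in>D. p \<in> F}. (y q $ j F) ^ b F)}"
  using prin assms unfolding common_principalization_def by blast

lemma finite_components_through:
  assumes "\<pi> p = 0"
  shows "finite {F\<in>D. p \<in> F}"
proof -
  obtain V y j where "crossing_chart A D p V y j" by (rule crossing_chart_at[OF assms]) (rule that)
  then have "inj_on j {F\<in>D. p \<in> F}" by (simp add: crossing_chart_def)
  then show ?thesis by (rule inj_on_finite[of _ _ UNIV]) auto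
qed

text \<open>Near \<open>p\<close> the units are bounded and bounded away from zero, generators of the same ideal are
  comparable, and the chain rule with a local Lipschitz bound for \<open>\<pi>\<close> in coordinates carries over the
  bound for the gradient.\<close>

lemma local_model:
  assumes p: "\<pi> p = 0"
  obtains q :: "real ^ 'r \<Rightarrow> 'm" and j :: "'m set \<Rightarrow> 'r" and c C \<delta> where "0 < c" "0 < C" "0 < \<delta>" "\<delta> \<le> 1" "inj_on j {F\<in>D. p \<in> F}"
    "q 0 = p" "real_analytic_at (\<lambda>x. \<pi> (q x)) 0"
    "\<And>x. norm x < \<delta> \<Longrightarrow> c * monom_size {F\<in>D. p \<in> F} j a x \<le> \<bar>\<Gamma> (\<pi> (q x))\<bar>"
    "\<And>x. norm x < \<delta> \<Longrightarrow> \<bar>\<Gamma> (\<pi> (q x))\<bar> \<le> C * monom_size {F\<in>D. p \<in> F} j a x"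
    "\<And>x. norm x < \<delta> \<Longrightarrow> c * monom_size {F\<in>D. p \<in> F} j b x \<le> grad_size \<Gamma> (\<pi> (q x))"
    "\<And>x. norm x < \<delta> \<Longrightarrow> grad_size \<Gamma> (\<pi> (q x)) \<le> C * monom_size {F\<in>D. p \<in> F} j b x"
    "\<And>x. norm x < \<delta> \<Longrightarrow> \<exists>G. ((\<lambda>x. \<Gamma> (\<pi> (q x))) has_derivative G) (at x) \<and>
                (\<forall>v. \<bar>G v\<bar> \<le> C * monom_size {F\<in>D. p \<in> F} j b x * norm v)"
    "\<forall>\<^sub>F p' in nhds p. \<exists>x. norm x < \<delta> \<and> p' = q x"
proof -
  obtain V y j u v where ch: "crossing_chart A D p V y j"
    "\<forall>q\<in>V. manifold_analytic_at A u q \<and> u q \<noteq> 0 \<and> manifold_analytic_at A v q \<and> v q \<noteq> 0"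
    "\<forall>q\<in>V. \<Gamma> (\<pi> q) = u q * (\<Prod>F\<in>{F\<in>D. p \<in> F}. (y q $ j F) ^ a F)"
    "germ_ideal (manifold_analytic_at A) p ((\<lambda>g. g \<circ> \<pi>) ` jacobian_ideal \<Gamma>) =
     germ_ideal (manifold_analytic_at A) p {\<lambda>q. v q * (\<Prod>F\<in>{F\<in>D. p \<in> F}. (y q $ j F) ^ b F)}"
    by (rule crossing_chart_at[OF p]) (rule that)
  define I where "I = {F\<in>D. p \<in> F}"
  have V: "analytic_chart A V y" "p \<in> V" "y p = 0" "inj_on j I"
    using ch(1) by (auto simp: crossing_chart_def I_def)
  have A': "analytic_atlas (insert (V, y) A)" using V(1) by (simp add: analytic_chart_def)
  have Vy: "(V, y) \<in> insert (V, y) A" by simp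
  note c = analytic_atlas_chart[OF A' Vy]
  define q where "q = inv_into V y"
  have q0: "q 0 = p" using c(4) V(2,3) by (simp add: q_def flip: V(3))
  have ylim: "filterlim y (nhds 0) (nhds p)" and qlim: "filterlim q (nhds p) (nhds 0)"
    using filterlim_chart[OF A' Vy V(2)] by (simp_all add: V(3) q_def)
  have \<pi>q: "real_analytic_at (\<lambda>x. \<pi> (q x)) x" if "x \<in> y ` V" for x
    using manifold_analytic_in_chart[OF V(1) _ modification(5)] that by (auto simp: q_def o_def)
  have "0 \<in> y ` V" using V(2,3) by (metis imageI)
  then have yV: "\<forall>\<^sub>F x in nhds 0. x \<in> y ` V" using c(2) by (intro eventually_nhds_in_open)
  have yq: "y (q x) = x" "q x \<in> V" if "x \<in> y ` V" for x
    using that by (auto simp: q_def f_inv_into_f inv_into_into)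

  have absprod: "\<bar>\<Prod>F\<in>I. (y p' $ j F) ^ e F\<bar> = monom_size I j e (y p')" for e p'
    by (simp add: monom_size_def abs_prod power_abs)
  have uan: "filterlim u (nhds (u p)) (nhds p)" "u p \<noteq> 0"
    and van: "filterlim v (nhds (v p)) (nhds p)" "v p \<noteq> 0"
    using ch(2) V(2) manifold_analytic_tendsto[OF modification(1)] by blast+
  have J: "finite ((\<lambda>g. g \<circ> \<pi>) ` jacobian_ideal \<Gamma>)" by (simp add: jacobian_ideal_def)
  obtain Cg where Cg: "0 < Cg"
    "\<forall>\<^sub>F p' in nhds p. \<bar>v p' * (\<Prod>F\<in>I. (y p' $ j F) ^ b F)\<bar> \<le> Cg * (\<Sum>g\<in>(\<lambda>g. g \<circ> \<pi>) ` jacobian_ideal \<Gamma>. \<bar>g p'\<bar>) \<and>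
       (\<Sum>g\<in>(\<lambda>g. g \<circ> \<pi>) ` jacobian_ideal \<Gamma>. \<bar>g p'\<bar>) \<le> Cg * \<bar>v p' * (\<Prod>F\<in>I. (y p' $ j F) ^ b F)\<bar>"
    by (rule germ_ideal_principal_comparable[OF manifold_analytic_tendsto[OF modification(1)]
          manifold_analytic_const[OF modification(1)] J ch(4)[folded I_def]]) (assumption, rule that)
  \<comment> \<open>Different generators may have the same pullback, so the two sums agree only up to the number
    of generators.\<close>
  define n where "n = real (card (jacobian_ideal \<Gamma>))"
  have n: "1 \<le> n"
  proof -
    have "0 < card (jacobian_ideal \<Gamma>)" by (auto simp: jacobian_ideal_def card_gt_0_iff)
    then show ?thesis unfolding n_def by simp
  qed
  let ?S = "\<lambda>p'. \<Sum>g\<in>(\<lambda>g. g \<circ> \<pi>) ` jacobian_ideal \<Gamma>. \<bar>g p'\<bar>"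
  have S1: "?S p' \<le> grad_size \<Gamma> (\<pi> p')" for p'
    using sum_image_le[of "jacobian_ideal \<Gamma>" "\<lambda>g. \<bar>g p'\<bar>" "\<lambda>g. g \<circ> \<pi>"] by (simp add: jacobian_ideal_def o_def)
  have S2: "grad_size \<Gamma> (\<pi> p') \<le> n * ?S p'" for p'
    unfolding n_def
  proof (rule sum_bounded_above)
    fix g assume "g \<in> jacobian_ideal \<Gamma>"
    then have "g \<circ> \<pi> \<in> (\<lambda>g. g \<circ> \<pi>) ` jacobian_ideal \<Gamma>" by (rule imageI)
    from member_le_sum[OF this, of "\<lambda>g. \<bar>g p'\<bar>"] J show "\<bar>g (\<pi> p')\<bar> \<le> ?S p'" by simp
  qed
  obtain CG where CG: "0 < CG" "\<forall>\<^sub>F x in nhds 0. \<exists>G. (\<Gamma> has_derivative G) (at x) \<and>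
          (\<forall>v. \<bar>G v\<bar> \<le> CG * grad_size \<Gamma> x * norm v)"
    using gradient_bound by blast
  obtain B \<delta>' where B: "0 < B" "0 < \<delta>'"
    "\<And>x z. norm (x - 0) < \<delta>' \<Longrightarrow> norm (z - 0) < \<delta>' \<Longrightarrow> norm (\<pi> (q x) - \<pi> (q z)) \<le> B * norm (x - z)"
    by (rule analytic_locally_lipschitz[OF \<pi>q[OF \<open>0 \<in> y ` V\<close>]]) (rule that)
  define cl where "cl = min (\<bar>u p\<bar> / 2) (\<bar>v p\<bar> / 2 / Cg)"
  define Cu where "Cu = (\<bar>u p\<bar> + 1) + n * (Cg * (\<bar>v p\<bar> + 1)) + CG * (n * (Cg * (\<bar>v p\<bar> + 1))) * B"
  have cl: "0 < cl" unfolding cl_def using uan van Cg by simp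
  have Cu: "0 < Cu" "\<bar>u p\<bar> + 1 \<le> Cu" "n * (Cg * (\<bar>v p\<bar> + 1)) \<le> Cu" "CG * (n * (Cg * (\<bar>v p\<bar> + 1))) * B \<le> Cu"
  proof -
    have "0 \<le> n * (Cg * (\<bar>v p\<bar> + 1))" "0 \<le> CG * (n * (Cg * (\<bar>v p\<bar> + 1))) * B"
      using n Cg(1) CG(1) B(1) by (intro mult_nonneg_nonneg; simp)+
    then show "0 < Cu" "\<bar>u p\<bar> + 1 \<le> Cu" "n * (Cg * (\<bar>v p\<bar> + 1)) \<le> Cu"
      "CG * (n * (Cg * (\<bar>v p\<bar> + 1))) * B \<le> Cu"
      unfolding Cu_def by linarith+
  qed
  have "\<forall>\<^sub>F x in nhds 0. norm x < \<delta>'"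
    using B(2) by (auto simp: eventually_nhds_metric dist_norm)
  moreover have "filterlim (\<lambda>x. \<pi> (q x)) (nhds 0) (nhds 0)"
    using filterlim_compose[OF \<pi>_tendsto[of p] qlim] p by simp
  note eventually_compose_filterlim[OF CG(2) this]
  moreover note yV
    eventually_compose_filterlim[OF eventually_abs_bounded[OF uan(1)] qlim]
    eventually_compose_filterlim[OF eventually_abs_bounded_below[OF uan] qlim]
    eventually_compose_filterlim[OF eventually_abs_bounded[OF van(1)] qlim]
    eventually_compose_filterlim[OF eventually_abs_bounded_below[OF van] qlim]
    eventually_compose_filterlim[OF Cg(2) qlim]
  ultimately have "\<forall>\<^sub>F x in nhds 0.
     (cl * monom_size I j a x \<le> \<bar>\<Gamma> (\<pi> (q x))\<bar> \<and> \<bar>\<Gamma> (\<pi> (q x))\<bar> \<le> Cu * monom_size I j a x) \<and>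
     (cl * monom_size I j b x \<le> grad_size \<Gamma> (\<pi> (q x)) \<and> grad_size \<Gamma> (\<pi> (q x)) \<le> Cu * monom_size I j b x) \<and>
     (\<exists>G. ((\<lambda>x. \<Gamma> (\<pi> (q x))) has_derivative G) (at x) \<and>
                (\<forall>v. \<bar>G v\<bar> \<le> Cu * monom_size I j b x * norm v))"
  proof eventually_elim
    case (elim x)
    note x = elim(1) and G = elim(2) and xV = elim(3) and u = elim(4,5) and v = elim(6,7) and g = elim(8)
    let ?ma = "monom_size I j a x" and ?mb = "monom_size I j b x"
    have ma: "0 \<le> ?ma" "0 \<le> ?mb" by (rule monom_size_nonneg)+
    have "\<bar>\<Gamma> (\<pi> (q x))\<bar> = \<bar>u (q x)\<bar> * ?ma"
      using ch(3) yq[OF xV] absprod[of "q x" a] by (simp add: I_def abs_mult)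
    moreover have "cl * ?ma \<le> \<bar>u (q x)\<bar> * ?ma" "\<bar>u (q x)\<bar> * ?ma \<le> Cu * ?ma"
      using u Cu(2) ma unfolding cl_def by (auto intro!: mult_right_mono)
    ultimately have 1: "cl * ?ma \<le> \<bar>\<Gamma> (\<pi> (q x))\<bar> \<and> \<bar>\<Gamma> (\<pi> (q x))\<bar> \<le> Cu * ?ma" by simp
    have vm: "\<bar>v (q x) * (\<Prod>F\<in>I. (y (q x) $ j F) ^ b F)\<bar> = \<bar>v (q x)\<bar> * ?mb"
      using yq[OF xV] absprod[of "q x" b] by (simp add: abs_mult)
    have "\<bar>v p\<bar> / 2 * ?mb \<le> \<bar>v (q x)\<bar> * ?mb" using v ma by (intro mult_right_mono) auto
    also have "\<dots> \<le> Cg * grad_size \<Gamma> (\<pi> (q x))"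
      using g S1[of "q x"] Cg(1) unfolding vm by (meson mult_left_mono order_trans less_imp_le)
    finally have "\<bar>v p\<bar> / 2 / Cg * ?mb \<le> grad_size \<Gamma> (\<pi> (q x))" using Cg(1) by (simp add: field_simps)
    moreover have "cl * ?mb \<le> \<bar>v p\<bar> / 2 / Cg * ?mb" unfolding cl_def using ma by (intro mult_right_mono) auto
    ultimately have 2: "cl * ?mb \<le> grad_size \<Gamma> (\<pi> (q x))" by linarith
    have "grad_size \<Gamma> (\<pi> (q x)) \<le> n * ?S (q x)" by (rule S2)
    also have "\<dots> \<le> n * (Cg * (\<bar>v (q x)\<bar> * ?mb))"
      using g n unfolding vm by (intro mult_left_mono) auto
    also have "\<dots> \<le> n * (Cg * ((\<bar>v p\<bar> + 1) * ?mb))"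
      using v n Cg(1) ma by (intro mult_left_mono mult_right_mono) auto
    finally have 3: "grad_size \<Gamma> (\<pi> (q x)) \<le> n * (Cg * (\<bar>v p\<bar> + 1)) * ?mb" by (simp add: mult.assoc)
    also have "\<dots> \<le> Cu * ?mb" using Cu(3) ma by (intro mult_right_mono) auto
    finally have 4: "grad_size \<Gamma> (\<pi> (q x)) \<le> Cu * ?mb" .
    obtain G where G: "(\<Gamma> has_derivative G) (at (\<pi> (q x)))"
      "\<And>v. \<bar>G v\<bar> \<le> CG * grad_size \<Gamma> (\<pi> (q x)) * norm v" using G by blast
    obtain T where T: "((\<lambda>x. \<pi> (q x)) has_derivative T) (at x)"
      by (rule analytic_has_derivative[OF \<pi>q[OF xV]]) (rule that)
    have "\<forall>\<^sub>F z in nhds x. norm z < \<delta>'"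
      using x by (intro eventually_nhds_in_open[of "{z. norm z < \<delta>'}", simplified]) (auto intro: open_Collect_less continuous_intros)
    then have "\<forall>\<^sub>F z in nhds x. norm (\<pi> (q z) - \<pi> (q x)) \<le> B * norm (z - x)"
      by eventually_elim (use B(3) x in auto)
    note TB = derivative_bound_of_lipschitz[OF T this]
    have "\<bar>G (T w)\<bar> \<le> Cu * ?mb * norm w" for w
    proof -
      have "\<bar>G (T w)\<bar> \<le> CG * grad_size \<Gamma> (\<pi> (q x)) * norm (T w)" by (rule G(2))
      also have "\<dots> \<le> CG * (n * (Cg * (\<bar>v p\<bar> + 1)) * ?mb) * (B * norm w)"
        using CG(1) 3 TB[of w] grad_size_nonneg n Cg(1) ma by (intro mult_mono mult_left_mono) auto
      also have "\<dots> = (CG * (n * (Cg * (\<bar>v p\<bar> + 1))) * B) * (?mb * norm w)" by (simp add: mult_ac)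
      also have "\<dots> \<le> Cu * (?mb * norm w)" using Cu(4) ma by (intro mult_right_mono) auto
      finally show ?thesis by (simp add: mult.assoc)
    qed
    moreover have "((\<lambda>x. \<Gamma> (\<pi> (q x))) has_derivative (\<lambda>w. G (T w))) (at x)"
      by (rule has_derivative_compose[OF T G(1)])
    ultimately show ?case using 1 2 4 by blast
  qed
  then obtain \<delta>\<^sub>0 where \<delta>\<^sub>0: "0 < \<delta>\<^sub>0" "\<And>x. norm x < \<delta>\<^sub>0 \<Longrightarrow> 
     (cl * monom_size I j a x \<le> \<bar>\<Gamma> (\<pi> (q x))\<bar> \<and> \<bar>\<Gamma> (\<pi> (q x))\<bar> \<le> Cu * monom_size I j a x) \<and>
     (cl * monom_size I j b x \<le> grad_size \<Gamma> (\<pi> (q x)) \<and> grad_size \<Gamma> (\<pi> (q x)) \<le> Cu * monom_size I j b x) \<and>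
     (\<exists>G. ((\<lambda>x. \<Gamma> (\<pi> (q x))) has_derivative G) (at x) \<and>
                (\<forall>v. \<bar>G v\<bar> \<le> Cu * monom_size I j b x * norm v))"
    unfolding eventually_nhds_metric by auto
  define \<delta> where "\<delta> = min \<delta>\<^sub>0 1"
  have \<delta>: "0 < \<delta>" "\<delta> \<le> 1" "\<And>x. norm x < \<delta> \<Longrightarrow> norm x < \<delta>\<^sub>0" using \<delta>\<^sub>0(1) by (auto simp: \<delta>_def)
  have "\<forall>\<^sub>F x in nhds (0::real ^ 'r). norm x < \<delta>"
    using \<delta>(1) by (auto simp: eventually_nhds_metric dist_norm)
  from eventually_compose_filterlim[OF this ylim] eventually_nhds_in_open[OF c(1) V(2)]
  have cover: "\<forall>\<^sub>F p' in nhds p. \<exists>x. norm x < \<delta> \<and> p' = q x"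
  proof eventually_elim
    case (elim p')
    then show ?case using c(4) by (intro exI[of _ "y p'"]) (simp add: q_def)
  qed
  show ?thesis
    by (rule that[of cl Cu \<delta> j q, folded I_def, OF cl Cu(1) \<delta>(1,2) V(4) q0 \<pi>q[OF \<open>0 \<in> y ` V\<close>] _ _ _ _ _ cover])
       (use \<delta>\<^sub>0(2) \<delta>(3) in blast)+
qed

lemma exponents:
  assumes p: "\<pi> p = 0" and F: "F \<in> D" "p \<in> F"
  shows "0 < b F \<Longrightarrow> 0 < a F" "0 < a F \<Longrightarrow> b F < a F"
proof -
  obtain q :: "real ^ 'r \<Rightarrow> 'm" and j :: "'m set \<Rightarrow> 'r" and c C \<delta> where m: "0 < c" "0 < C" "0 < \<delta>" "inj_on j {F\<in>D. p \<in> F}"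
    "q 0 = p"
    "\<And>x. norm x < \<delta> \<Longrightarrow> c * monom_size {F\<in>D. p \<in> F} j a x \<le> \<bar>\<Gamma> (\<pi> (q x))\<bar>"
    "\<And>x. norm x < \<delta> \<Longrightarrow> \<bar>\<Gamma> (\<pi> (q x))\<bar> \<le> C * monom_size {F\<in>D. p \<in> F} j a x"
    "\<And>x. norm x < \<delta> \<Longrightarrow> \<exists>G. ((\<lambda>x. \<Gamma> (\<pi> (q x))) has_derivative G) (at x) \<and>
                (\<forall>v. \<bar>G v\<bar> \<le> C * monom_size {F\<in>D. p \<in> F} j b x * norm v)"
    by (rule local_model[OF p]) (rule that)
  have "\<Gamma> (\<pi> (q 0)) = 0" using m(5) p \<Gamma>0 by simp
  note * = monomial_gradient_exponents[OF finite_components_through[OF p] m(4) _ m(1-3) m(6-8) this, of F]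
  show "0 < b F \<Longrightarrow> 0 < a F" "0 < a F \<Longrightarrow> b F < a F" using * F by auto
qed

text \<open>Over the origin \<open>\<Gamma> \<circ> \<pi>\<close> vanishes and the unit does not, so some coordinate occurs in the
  monomial.\<close>

lemma component_exists: obtains p F where "\<pi> p = 0" "F \<in> D" "p \<in> F" "0 < a F"
proof -
  obtain p where p: "\<pi> p = 0" using modification(3,4) by (metis imageE)
  obtain V y j u v where ch: "crossing_chart A D p V y j"
    "\<forall>q\<in>V. manifold_analytic_at A u q \<and> u q \<noteq> 0 \<and> manifold_analytic_at A v q \<and> v q \<noteq> 0"
    "\<forall>q\<in>V. \<Gamma> (\<pi> q) = u q * (\<Prod>F\<in>{F\<in>D. p \<in> F}. (y q $ j F) ^ a F)"
    "germ_ideal (manifold_analytic_at A) p ((\<lambda>g. g \<circ> \<pi>) ` jacobian_ideal \<Gamma>) =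
     germ_ideal (manifold_analytic_at A) p {\<lambda>q. v q * (\<Prod>F\<in>{F\<in>D. p \<in> F}. (y q $ j F) ^ b F)}"
    by (rule crossing_chart_at[OF p]) (rule that)
  have "p \<in> V" using ch(1) by (simp add: crossing_chart_def)
  then have "(\<Prod>F\<in>{F\<in>D. p \<in> F}. (y p $ j F) ^ a F) = 0" using ch p \<Gamma>0 by auto
  then obtain F where "F \<in> D" "p \<in> F" "(y p $ j F) ^ a F = 0"
    using finite_components_through[OF p] by auto
  then show ?thesis using p that by (cases "a F") auto
qed

text \<open>The fibre over the origin is compact because \<open>\<pi>\<close> is proper.\<close>

lemma fibre_cover:
  assumes "\<And>p. \<pi> p = 0 \<Longrightarrow> open (N p) \<and> p \<in> N p"
  obtains P where "finite P" "\<And>p. p \<in> P \<Longrightarrow> \<pi> p = 0" "{q. \<pi> q = 0} \<subseteq> (\<Union>p\<in>P. N p)"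
proof -
  have "compact (\<pi> -` {0})" using modification(3) by (intro modification(6)) auto
  then obtain P where "P \<subseteq> \<pi> -` {0}" "finite P" "\<pi> -` {0} \<subseteq> (\<Union>p\<in>P. N p)"
    by (rule compactE_image[of _ "\<pi> -` {0}" N]) (use assms in auto)
  then show ?thesis by (intro that[of P]) auto
qed

text \<open>A component that meets the domain of a crossing chart passes through its centre, so the components
  over the origin pass through one of finitely many centres.\<close>

lemma finite_components: "finite {F\<in>D. 0 \<in> \<pi> ` F}"
proof -
  have "\<exists>V. open V \<and> p \<in> V \<and> (\<forall>F\<in>D. p \<notin> F \<longrightarrow> F \<inter> V = {})" if p: "\<pi> p = 0" for p
  proof -
    obtain V y j where ch: "crossing_chart A D p V y j" by (rule crossing_chart_at[OF p]) (rule that)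
    then have "analytic_atlas (insert (V, y) A)" by (simp add: crossing_chart_def analytic_chart_def)
    then have "open V" using analytic_atlas_chart(1) by blast
    then show ?thesis using ch by (intro exI[of _ V]) (auto simp: crossing_chart_def)
  qed
  then obtain N where N: "\<And>p. \<pi> p = 0 \<Longrightarrow> open (N p) \<and> p \<in> N p \<and> (\<forall>F\<in>D. p \<notin> F \<longrightarrow> F \<inter> N p = {})"
    by metis
  obtain P where P: "finite P" "\<And>p. p \<in> P \<Longrightarrow> \<pi> p = 0" "{q. \<pi> q = 0} \<subseteq> (\<Union>p\<in>P. N p)"
    using fibre_cover[of N] N by blast
  have "{F\<in>D. 0 \<in> \<pi> ` F} \<subseteq> (\<Union>p\<in>P. {F\<in>D. p \<in> F})"
  proof safe
    fix F q assume F: "F \<in> D" "q \<in> F" "0 = \<pi> q"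
    then obtain p where p: "p \<in> P" "q \<in> N p" using P(3) by auto
    then have "p \<in> F" using N[OF P(2)[OF p(1)]] F by blast
    then show "F \<in> (\<Union>p\<in>P. {F\<in>D. p \<in> F})" using p F by blast
  qed
  moreover have "finite (\<Union>p\<in>P. {F\<in>D. p \<in> F})" using P finite_components_through by blast
  ultimately show ?thesis by (rule finite_subset)
qed

text \<open>On each member of a finite cover of the fibre the comparison of monomials gives the inequality,
  and since \<open>\<pi>\<close> is proper the cover contains the preimage of a neighbourhood of the origin.\<close>

lemma gradient_inequality:
  assumes \<theta>: "0 \<le> \<theta>" "\<And>F. F \<in> D \<Longrightarrow> 0 \<in> \<pi> ` F \<Longrightarrow> real (b F) \<le> \<theta> * real (a F)"
  obtains C where "0 < C" "\<forall>\<^sub>F x in nhds 0. C * \<bar>\<Gamma> x\<bar> powr \<theta> \<le> grad_size \<Gamma> x"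
proof -
  have "\<exists>N C. open N \<and> p \<in> N \<and> 0 < C \<and> (\<forall>p'\<in>N. \<bar>\<Gamma> (\<pi> p')\<bar> powr \<theta> \<le> C * grad_size \<Gamma> (\<pi> p'))"
    if p: "\<pi> p = 0" for p
  proof -
    let ?I = "{F\<in>D. p \<in> F}"
    obtain q :: "real ^ 'r \<Rightarrow> 'm" and j :: "'m set \<Rightarrow> 'r" and c C \<delta> where m: "0 < c" "0 < C" "\<delta> \<le> 1"
      "\<And>x. norm x < \<delta> \<Longrightarrow> \<bar>\<Gamma> (\<pi> (q x))\<bar> \<le> C * monom_size ?I j a x"
      "\<And>x. norm x < \<delta> \<Longrightarrow> c * monom_size ?I j b x \<le> grad_size \<Gamma> (\<pi> (q x))"
      "\<forall>\<^sub>F p' in nhds p. \<exists>x. norm x < \<delta> \<and> p' = q x"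
      by (rule local_model[OF p]) (rule that)
    obtain N where N: "open N" "p \<in> N" "\<And>p'. p' \<in> N \<Longrightarrow> \<exists>x. norm x < \<delta> \<and> p' = q x"
      using m(6) unfolding eventually_nhds by blast
    have "\<bar>\<Gamma> (\<pi> p')\<bar> powr \<theta> \<le> (C powr \<theta> / c) * grad_size \<Gamma> (\<pi> p')" if p': "p' \<in> N" for p'
    proof -
      obtain x where x: "norm x < \<delta>" "p' = q x" using N(3)[OF p'] by blast
      have "\<bar>\<Gamma> (\<pi> p')\<bar> powr \<theta> \<le> (C * monom_size ?I j a x) powr \<theta>"
        using m(4)[of x] x \<theta>(1) by (intro powr_mono2) auto
      also have "\<dots> = C powr \<theta> * monom_size ?I j a x powr \<theta>"
        by (rule powr_mult)
      also have "monom_size ?I j a x powr \<theta> \<le> monom_size ?I j b x"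
        by (rule monom_size_powr_le[OF finite_components_through[OF p] \<theta>(1)])
           (use \<theta>(2) p x m(3) in \<open>auto simp: image_iff\<close>)
      also have "\<dots> \<le> grad_size \<Gamma> (\<pi> p') / c" using m(5)[of x] m(1) x by (simp add: field_simps)
      finally show ?thesis by (simp add: mult_left_mono)
    qed
    moreover have "0 < C powr \<theta> / c" using m by simp
    ultimately show ?thesis using N(1,2) by blast
  qed
  then obtain N C where NC: "\<And>p. \<pi> p = 0 \<Longrightarrow> open (N p) \<and> p \<in> N p \<and> 0 < C p \<and>
      (\<forall>p'\<in>N p. \<bar>\<Gamma> (\<pi> p')\<bar> powr \<theta> \<le> C p * grad_size \<Gamma> (\<pi> p'))" by metis
  obtain P where P: "finite P" "\<And>p. p \<in> P \<Longrightarrow> \<pi> p = 0" "{q. \<pi> q = 0} \<subseteq> (\<Union>p\<in>P. N p)"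
    using fibre_cover[of N] NC by blast
  define O' where "O' = (\<Union>p\<in>P. N p)"
  define C' where "C' = (\<Sum>p\<in>P. C p) + 1"
  have C': "0 < C'" unfolding C'_def using NC P(2) by (intro add_nonneg_pos sum_nonneg) (auto intro: less_imp_le)
  have ineq: "\<bar>\<Gamma> (\<pi> p')\<bar> powr \<theta> \<le> C' * grad_size \<Gamma> (\<pi> p')" if "p' \<in> O'" for p'
  proof -
    obtain p where p: "p \<in> P" "p' \<in> N p" using \<open>p' \<in> O'\<close> unfolding O'_def by blast
    have "C p \<le> (\<Sum>p\<in>P. C p)"
      by (rule member_le_sum[OF p(1)]) (use NC P in \<open>auto intro: less_imp_le\<close>)
    then have "C p \<le> C'" unfolding C'_def by simp
    then have "C p * grad_size \<Gamma> (\<pi> p') \<le> C' * grad_size \<Gamma> (\<pi> p')" by (rule mult_right_mono[OF _ grad_size_nonneg])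
    moreover have "\<bar>\<Gamma> (\<pi> p')\<bar> powr \<theta> \<le> C p * grad_size \<Gamma> (\<pi> p')" using NC[OF P(2)[OF p(1)]] p(2) by blast
    ultimately show ?thesis by linarith
  qed
  obtain r0 where r0: "0 < r0" "cball 0 r0 \<subseteq> W" using modification(2,3) open_contains_cball by blast
  \<comment> \<open>The part of a compact preimage outside the cover has a compact image that misses the origin.\<close>
  define B where "B = \<pi> -` cball 0 r0 \<inter> - O'"
  have "open O'" unfolding O'_def using NC P(2) by auto
  moreover have "compact (\<pi> -` cball 0 r0)" using r0 by (intro modification(6)) auto
  ultimately have "compact B" unfolding B_def by (intro compact_Int_closed) auto
  then have "compact (\<pi> ` B)"
    using continuous_\<pi> by (intro compact_continuous_image) (auto intro: continuous_on_subset)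
  then have "open (- (\<pi> ` B))" using compact_imp_closed by blast
  moreover have "0 \<in> - (\<pi> ` B)" using P(3) unfolding B_def O'_def by force
  ultimately have "\<forall>\<^sub>F x in nhds 0. x \<in> - (\<pi> ` B)" by (rule eventually_nhds_in_open)
  moreover have "\<forall>\<^sub>F x in nhds (0::real ^ 'r). norm x < r0"
    using r0(1) by (auto simp: eventually_nhds_metric dist_norm)
  ultimately have "\<forall>\<^sub>F x in nhds 0. (1 / C') * \<bar>\<Gamma> x\<bar> powr \<theta> \<le> grad_size \<Gamma> x"
  proof eventually_elim
    case (elim x)
    then have "x \<in> cball 0 r0" by simp
    then obtain p' where p': "x = \<pi> p'" using r0(2) modification(4) by (metis imageE subsetD)
    then have "p' \<in> O'" using elim \<open>x \<in> cball 0 r0\<close> unfolding B_def by auto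
    from ineq[OF this] show ?case using C' by (simp add: p' field_simps)
  qed
  then show ?thesis using that[of "1 / C'"] C' by simp
qed

text \<open>The image of the arc with order \<open>N\<close> in the coordinate of \<open>F\<close> and order one in the others has
  orders that differ from \<open>N\<close> times those along \<open>F\<close> by a bounded amount, so that their quotient tends to
  that of \<open>F\<close> as \<open>N\<close> grows.\<close>

lemma divisorial_ratio_le_SUP:
  assumes \<Gamma>an: "real_analytic_at \<Gamma> 0" and Jan: "\<And>g. g \<in> jacobian_ideal \<Gamma> \<Longrightarrow> real_analytic_at g 0"
    and F: "F \<in> D" "0 \<in> \<pi> ` F" "0 < a F"
  shows "ereal (real (b F) / real (a F)) \<le>
    (SUP \<gamma>\<in>nonzero_arcs \<Gamma>. arc_ratio \<Gamma> (jacobian_ideal \<Gamma>) \<gamma>)"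
    (is "_ \<le> ?SUP")
proof -
  obtain p where p: "\<pi> p = 0" "p \<in> F" using F(2) by auto
  define I where "I = {F\<in>D. p \<in> F}"
  have I: "finite I" "F \<in> I" using finite_components_through[OF p(1)] F(1) p(2) by (auto simp: I_def)
  obtain q :: "real ^ 'r \<Rightarrow> 'm" and j :: "'m set \<Rightarrow> 'r" and c C \<delta> where m: "0 < c" "0 < C" "0 < \<delta>" "inj_on j I"
    "q 0 = p" "real_analytic_at (\<lambda>x. \<pi> (q x)) 0"
    "\<And>x. norm x < \<delta> \<Longrightarrow> c * monom_size I j a x \<le> \<bar>\<Gamma> (\<pi> (q x))\<bar>"
    "\<And>x. norm x < \<delta> \<Longrightarrow> grad_size \<Gamma> (\<pi> (q x)) \<le> C * monom_size I j b x"
    by (rule local_model[OF p(1), folded I_def]) (rule that)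
  define A' where "A' = (\<Sum>F'\<in>I - {F}. a F')"
  define B' where "B' = (\<Sum>F'\<in>I - {F}. b F')"
  have ratio: "ereal (real (b F) / (real (a F) + real A' / real N)) \<le> ?SUP" if N: "0 < N" for N
  proof -
    define w where "w t = (\<chi> i::'r. if i = j F then t ^ N else t)" for t :: real
    have "real_analytic_at (\<lambda>t::real. t ^ N *\<^sub>R axis (j F) (1::real) + t *\<^sub>R (1 - axis (j F) 1)) 0"
      by (intro real_analytic_at_add real_analytic_at_bounded_linear bounded_linear_scaleR_left
          real_analytic_at_compose[OF real_analytic_at_power real_analytic_at_bounded_linear[OF bounded_linear_scaleR_left]])
    moreover have "(\<lambda>t::real. t ^ N *\<^sub>R axis (j F) (1::real) + t *\<^sub>R (1 - axis (j F) 1)) = w"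
      by (auto simp: fun_eq_iff w_def vec_eq_iff axis_def)
    ultimately have wan: "real_analytic_at w 0" by simp
    have w0: "w 0 = 0" using N by (simp add: w_def vec_eq_iff)
    define \<gamma> where "\<gamma> t = \<pi> (q (w t))" for t
    have \<gamma>an: "real_analytic_at \<gamma> 0"
      unfolding \<gamma>_def[abs_def] by (rule real_analytic_at_compose[OF wan]) (use m(6) w0 in simp)
    have \<gamma>: "analytic_arc \<gamma>" using \<gamma>an w0 m(5) p by (simp add: analytic_arc_def \<gamma>_def)
    have "filterlim w (nhds (w 0)) (nhds 0)"
      using analytic_isCont[OF wan] unfolding isCont_def by (simp only: tendsto_at_iff_tendsto_nhds)
    then have "filterlim w (nhds 0) (nhds 0)" by (simp add: w0)
    moreover have "\<forall>\<^sub>F x in nhds (0::real ^ 'r). norm x < \<delta>"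
      using m(3) by (auto simp: eventually_nhds_metric dist_norm)
    ultimately have small: "\<forall>\<^sub>F t in nhds 0. norm (w t) < \<delta>" by (rule eventually_compose_filterlim[rotated])
    have mw: "monom_size I j e (w t) = \<bar>t\<bar> ^ (N * e F + (\<Sum>F'\<in>I - {F}. e F'))" for e t
      unfolding w_def monom_size_curve[OF I(1) m(4) I(2)] by (simp add: power_abs power_add power_mult)
    define na where "na = N * a F + A'"
    define nb where "nb = N * b F + B'"
    have low: "\<forall>\<^sub>F t in nhds 0. c * \<bar>t\<bar> ^ na \<le> \<bar>(\<Gamma> \<circ> \<gamma>) t\<bar>"
      using small
    proof eventually_elim
      case (elim t)
      then show ?case using m(7)[of "w t"] by (simp add: mw na_def A'_def \<gamma>_def)
    qed
    have nz: "\<not> (\<forall>\<^sub>F t in nhds 0. \<Gamma> (\<gamma> t) = 0)"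
    proof
      assume "\<forall>\<^sub>F t in nhds 0. \<Gamma> (\<gamma> t) = 0"
      with low have "\<forall>\<^sub>F t in nhds 0. c * \<bar>t\<bar> ^ na \<le> 0 * \<bar>t\<bar> ^ Suc na"
        by eventually_elim simp
      then show False using power_eventually_le_imp[OF m(1)] by fastforce
    qed
    obtain k where k: "0 < k" "ord_t (\<Gamma> \<circ> \<gamma>) = enat k" by (rule arc_ord_pos[OF \<gamma> nz \<Gamma>an \<Gamma>0])
    have "ord_t (\<Gamma> \<circ> \<gamma>) \<le> enat na"
      by (rule ord_t_leI[OF analytic_along_arc[OF \<gamma> \<Gamma>an] m(1) low])
    then have kna: "k \<le> na" using k by simp
    have "enat nb \<le> arc_order \<gamma> (jacobian_ideal \<Gamma>)"
      unfolding arc_order_def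
    proof (rule INF_greatest)
      fix g assume g: "g \<in> jacobian_ideal \<Gamma>"
      show "enat nb \<le> ord_t (g \<circ> \<gamma>)"
      proof (rule ord_t_geI[OF analytic_along_arc[OF \<gamma> Jan[OF g]]])
        show "\<forall>\<^sub>F t in nhds 0. \<bar>(g \<circ> \<gamma>) t\<bar> \<le> C * \<bar>t\<bar> ^ nb"
          using small
        proof eventually_elim
          case (elim t)
          have "\<bar>g (\<gamma> t)\<bar> \<le> grad_size \<Gamma> (\<gamma> t)"
            using member_le_sum[OF g, of "\<lambda>g. \<bar>g (\<gamma> t)\<bar>"] by (simp add: jacobian_ideal_def)
          also have "\<dots> \<le> C * \<bar>t\<bar> ^ nb" using m(8)[OF elim] by (simp add: mw nb_def B'_def \<gamma>_def)
          finally show ?case by simp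
        qed
      qed
    qed
    then have "ereal (real nb) \<le> ereal_of_enat (arc_order \<gamma> (jacobian_ideal \<Gamma>))"
      by (metis ereal_of_enat_le_iff ereal_of_enat_simps(1))
    then have "ereal (real nb) / ereal (real k) \<le>
        arc_ratio \<Gamma> (jacobian_ideal \<Gamma>) \<gamma>"
      using k by (cases "arc_order \<gamma> (jacobian_ideal \<Gamma>)") (auto intro: divide_right_mono)
    also have "\<dots> \<le> ?SUP" by (rule SUP_upper) (use \<gamma> nz in simp)
    finally have "ereal (real nb / real k) \<le> ?SUP" using k by simp
    moreover have "real (b F) / (real (a F) + real A' / real N) \<le> real nb / real k"
    proof -
      have "real (b F) / (real (a F) + real A' / real N) = real (N * b F) / real na"
        using N by (simp add: na_def divide_simps) (simp add: algebra_simps)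
      also have "\<dots> \<le> real nb / real k"
        using k kna by (intro frac_le) (auto simp: nb_def)
      finally show ?thesis .
    qed
    ultimately show ?thesis using order_trans ereal_less_eq(3) by blast
  qed
  have "(\<lambda>N. real (b F) / (real (a F) + real A' / real (Suc N))) \<longlonglongrightarrow> real (b F) / (real (a F) + 0)"
    using F(3) by (intro tendsto_intros LIMSEQ_Suc lim_const_over_n) auto
  then have "(\<lambda>N. ereal (real (b F) / (real (a F) + real A' / real (Suc N)))) \<longlonglongrightarrow> ereal (real (b F) / real (a F))"
    by simp
  then show ?thesis by (rule LIMSEQ_le_const2) (use ratio in blast)
qed

end

section \<open>The exponent is at least one half\<close>

text \<open>Let \<open>m\<close> be the least degree in which the power series of \<open>\<Gamma>\<close> is not zero. Every partial derivative
  is of order at least \<open>m - 1\<close>, and along a line on which the leading form does not vanish \<open>\<Gamma>\<close> has order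
  \<open>m\<close>. The origin being critical, \<open>m \<ge> 2\<close> and \<open>(m - 1) / m \<ge> 1 / 2\<close>.\<close>

lemma half_le_SUP:
  fixes \<Gamma> :: "real ^ 'r::finite \<Rightarrow> real"
  assumes \<Gamma>: "real_analytic_at \<Gamma> 0" "\<Gamma> 0 = 0" "(\<Gamma> has_derivative (\<lambda>_. 0)) (at 0)"
    and nz: "\<not> (\<forall>\<^sub>F x in nhds 0. \<Gamma> x = 0)"
    and diff: "\<forall>\<^sub>F x in nhds 0. \<exists>G. (\<Gamma> has_derivative G) (at x)"
    and Jan: "\<And>g. g \<in> jacobian_ideal \<Gamma> \<Longrightarrow> real_analytic_at g 0"
  shows "ereal (1 / 2) \<le>
    (SUP \<gamma>\<in>nonzero_arcs \<Gamma>. arc_ratio \<Gamma> (jacobian_ideal \<Gamma>) \<gamma>)"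
    (is "_ \<le> ?SUP")
proof -
  obtain a C r where ps: "power_series_at \<Gamma> 0 a C r" by (rule real_analytic_atE[OF \<Gamma>(1)]) (rule that)
  note f = power_series_atD[OF ps]
  have "\<exists>n h. a n (\<lambda>_. h) \<noteq> 0"
  proof (rule ccontr)
    assume "\<not> ?thesis"
    then have "\<Gamma> h = 0" if "norm h < r" for h using f(4)[OF that] sums_unique2[OF _ sums_zero] by simp
    then have "\<forall>\<^sub>F x in nhds 0. \<Gamma> x = 0"
      using f(1) by (auto simp: eventually_nhds_metric dist_norm)
    then show False using nz by blast
  qed
  define m where "m = (LEAST n. \<exists>h. a n (\<lambda>_. h) \<noteq> 0)"
  have "\<exists>h. a m (\<lambda>_. h) \<noteq> 0" unfolding m_def using \<open>\<exists>n h. a n (\<lambda>_. h) \<noteq> 0\<close> by (rule LeastI_ex)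
  then obtain h where h: "a m (\<lambda>_. h) \<noteq> 0" by blast
  have lower: "a n (\<lambda>_. k) = 0" if "n < m" for n k
    using not_less_Least[of n "\<lambda>n. \<exists>h. a n (\<lambda>_. h) \<noteq> 0"] that unfolding m_def by blast
  have at0: "a n (\<lambda>_. 0) = 0" if "0 < n" for n
    using multilinear_bounded_diag_norm[OF f(2), of 0 0 n] that by (simp add: power_0_left)
  have m0: "0 < m"
  proof (rule gr0I)
    assume "m = 0"
    have "(\<lambda>n. a n (\<lambda>_. 0)) sums a 0 (\<lambda>_. 0)"
      using sums_finite[of "{0}" "\<lambda>n. a n (\<lambda>_. 0)"] at0 by simp
    then have "a 0 (\<lambda>_. 0) = 0" using f(4)[of 0] f(1) \<Gamma>(2) sums_unique2 by fastforce
    moreover have "a 0 (\<lambda>_. h) = a 0 (\<lambda>_. 0)" by (rule multilinear_bounded_cong[OF f(2)]) auto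
    ultimately show False using h \<open>m = 0\<close> by simp
  qed
  obtain B where B: "0 < B"
    "\<And>h k s. norm h \<le> s \<Longrightarrow> norm k \<le> s \<Longrightarrow> s \<le> r / 2 \<Longrightarrow>
       norm (series_tail \<Gamma> 0 a m h - series_tail \<Gamma> 0 a m k) \<le> B * s ^ (m - 1) * norm (h - k)"
    by (rule power_series_tail_lipschitz[OF ps m0]) (rule that)
  obtain B' where B': "0 < B'"
    "\<And>h k s. norm h \<le> s \<Longrightarrow> norm k \<le> s \<Longrightarrow> s \<le> r / 2 \<Longrightarrow>
       norm (series_tail \<Gamma> 0 a (Suc m) h - series_tail \<Gamma> 0 a (Suc m) k) \<le> B' * s ^ (Suc m - 1) * norm (h - k)"
    by (rule power_series_tail_lipschitz[OF ps zero_less_Suc]) (rule that)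
  define \<gamma> where "\<gamma> t = t *\<^sub>R h" for t :: real
  have \<gamma>: "analytic_arc \<gamma>"
    unfolding analytic_arc_def \<gamma>_def[abs_def]
    using real_analytic_at_bounded_linear[OF bounded_linear_scaleR_left] by simp
  have an: "real_analytic_at (\<Gamma> \<circ> \<gamma>) 0" by (rule analytic_along_arc[OF \<gamma> \<Gamma>(1)])
  define \<mu> where "\<mu> = \<bar>a m (\<lambda>_. h)\<bar>"
  have \<mu>: "0 < \<mu>" using h by (simp add: \<mu>_def)
  have h0: "h \<noteq> 0" using h at0[OF m0] by metis
  \<comment> \<open>For \<open>\<bar>t\<bar> < \<tau>\<close> the terms of higher degree are at most half of the leading term.\<close>
  define \<tau> where "\<tau> = min (r / (2 * norm h)) (\<mu> / (2 * B' * norm h ^ Suc m))"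
  have \<tau>: "0 < \<tau>" unfolding \<tau>_def using f(1) h0 \<mu> B'(1) by simp
  have low: "\<forall>\<^sub>F t in nhds 0. \<mu> / 2 * \<bar>t\<bar> ^ m \<le> \<bar>(\<Gamma> \<circ> \<gamma>) t\<bar>"
    unfolding eventually_nhds_metric
  proof (intro exI[of _ \<tau>] conjI allI impI \<tau>)
    fix t :: real assume "dist t 0 < \<tau>"
    then have t: "\<bar>t\<bar> \<le> r / (2 * norm h)" "\<bar>t\<bar> \<le> \<mu> / (2 * B' * norm h ^ Suc m)" by (auto simp: \<tau>_def)
    have s: "norm (t *\<^sub>R h) \<le> r / 2" using t(1) h0 by (simp add: field_simps)
    have "(\<Sum>n<Suc m. a n (\<lambda>_. k)) = a m (\<lambda>_. k)" for k using lower by simp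
    then have "\<bar>\<Gamma> (t *\<^sub>R h) - a m (\<lambda>_. t *\<^sub>R h)\<bar> \<le> B' * norm (t *\<^sub>R h) ^ m * norm (t *\<^sub>R h)"
      using B'(2)[of "t *\<^sub>R h" "norm (t *\<^sub>R h)" 0] s \<Gamma>(2) at0[OF m0] by (simp add: series_tail_def)
    also have "\<dots> = (B' * norm h ^ Suc m * \<bar>t\<bar>) * \<bar>t\<bar> ^ m" by (simp add: power_mult_distrib mult_ac)
    also have "\<dots> \<le> \<mu> / 2 * \<bar>t\<bar> ^ m"
    proof (rule mult_right_mono)
      have "B' * norm h ^ Suc m * \<bar>t\<bar> \<le> B' * norm h ^ Suc m * (\<mu> / (2 * B' * norm h ^ Suc m))"
        using t(2) B'(1) by (intro mult_left_mono) auto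
      also have "\<dots> = \<mu> / 2" using B'(1) h0 by simp
      finally show "B' * norm h ^ Suc m * \<bar>t\<bar> \<le> \<mu> / 2" .
    qed simp
    finally have "\<bar>\<Gamma> (t *\<^sub>R h) - a m (\<lambda>_. t *\<^sub>R h)\<bar> \<le> \<mu> / 2 * \<bar>t\<bar> ^ m" .
    moreover have "\<bar>a m (\<lambda>_. t *\<^sub>R h)\<bar> = \<mu> * \<bar>t\<bar> ^ m"
      using multilinear_bounded_diag_scaleR[OF f(2), of m t h] by (simp add: abs_mult power_abs \<mu>_def)
    ultimately show "\<mu> / 2 * \<bar>t\<bar> ^ m \<le> \<bar>(\<Gamma> \<circ> \<gamma>) t\<bar>" unfolding \<gamma>_def o_def by linarith
  qed
  have nz\<gamma>: "\<not> (\<forall>\<^sub>F t in nhds 0. \<Gamma> (\<gamma> t) = 0)"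
  proof
    assume "\<forall>\<^sub>F t in nhds 0. \<Gamma> (\<gamma> t) = 0"
    with low have "\<forall>\<^sub>F t in nhds 0. \<mu> / 2 * \<bar>t\<bar> ^ m \<le> 0 * \<bar>t\<bar> ^ Suc m" by eventually_elim simp
    then show False using power_eventually_le_imp[of "\<mu> / 2"] \<mu> by fastforce
  qed
  obtain k where k: "0 < k" "ord_t (\<Gamma> \<circ> \<gamma>) = enat k" by (rule arc_ord_pos[OF \<gamma> nz\<gamma> \<Gamma>(1,2)])
  have "ord_t (\<Gamma> \<circ> \<gamma>) \<le> enat m" by (rule ord_t_leI[OF an _ low]) (use \<mu> in simp)
  then have km: "k \<le> m" using k(2) by simp
  have m2: "2 \<le> m"
  proof (rule ccontr)
    assume "\<not> 2 \<le> m"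
    then have m1: "m = 1" using m0 by simp
    have hp: "0 < norm h" using h0 by simp
    have pos: "0 < \<mu> / (4 * norm h)" using hp \<mu> by simp
    obtain d where d: "0 < d" "\<And>y. norm (y - 0) < d \<Longrightarrow> norm (\<Gamma> y - \<Gamma> 0 - 0) \<le> \<mu> / (4 * norm h) * norm (y - 0)"
      using \<Gamma>(3) pos unfolding has_derivative_at_alt by blast
    have "\<forall>\<^sub>F t in nhds (0::real). \<bar>t\<bar> < d / norm h"
      using d(1) hp by (auto simp: eventually_nhds_metric intro!: exI[of _ "d / norm h"])
    with low have "\<forall>\<^sub>F t::real in nhds 0. \<mu> / 4 * \<bar>t\<bar> ^ 1 \<le> 0 * \<bar>t\<bar> ^ 2"
    proof eventually_elim
      case (elim t)
      have "norm (t *\<^sub>R h - 0) < d" using elim(2) hp by (simp add: field_simps)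
      from d(2)[OF this] have "\<bar>\<Gamma> (t *\<^sub>R h)\<bar> \<le> \<mu> / 4 * \<bar>t\<bar>" using \<Gamma>(2) hp by simp
      then show ?case using elim(1) by (simp add: m1 \<gamma>_def)
    qed
    from power_eventually_le_imp[OF _ this] show False using \<mu> by simp
  qed
  have "enat (m - 1) \<le> arc_order \<gamma> (jacobian_ideal \<Gamma>)"
    unfolding arc_order_def
  proof (rule INF_greatest)
    fix g assume g: "g \<in> jacobian_ideal \<Gamma>"
    then obtain i where gi: "g = (\<lambda>x. deriv (\<lambda>t. \<Gamma> (x + t *\<^sub>R axis i 1)) 0)"
      unfolding jacobian_ideal_def by blast
    have bound: "\<forall>\<^sub>F x in nhds 0. \<bar>g x\<bar> \<le> B * (2 * norm x) ^ (m - 1)"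
    proof -
      have "\<forall>\<^sub>F x in nhds (0::real ^ 'r). norm x < r / 4"
        using f(1) by (auto simp: eventually_nhds_metric dist_norm intro!: exI[of _ "r / 4"])
      with diff show ?thesis
      proof eventually_elim
        case (elim x)
        obtain G where G: "(\<Gamma> has_derivative G) (at x)" using elim(1) by blast
        have gG: "g x = G (axis i 1)" unfolding gi by (rule deriv_along_axis[OF G])
        show ?case
        proof (cases "x = 0")
          case True
          then have "G = (\<lambda>_. 0)" using G \<Gamma>(3) has_derivative_unique by blast
          then show ?thesis using gG B(1) by simp
        next
          case False
          have "\<forall>\<^sub>F y in nhds x. norm y < 2 * norm x"
            using False by (intro eventually_nhds_in_open[of "{y. norm y < 2 * norm x}", simplified])
              (auto intro: open_Collect_less continuous_intros)
          then have "\<forall>\<^sub>F y in nhds x. norm (\<Gamma> y - \<Gamma> x) \<le> (B * (2 * norm x) ^ (m - 1)) * norm (y - x)"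
          proof eventually_elim
            case (elim y)
            then show ?case
              using B(2)[of y "2 * norm x" x] \<open>norm x < r / 4\<close> lower by (simp add: series_tail_def)
          qed
          from derivative_bound_of_lipschitz[OF G this, of "axis i 1"] show ?thesis
            using gG by simp
        qed
      qed
    qed
    have "isCont \<gamma> 0" using \<gamma> analytic_isCont by (auto simp: analytic_arc_def)
    then have "filterlim \<gamma> (nhds 0) (nhds 0)"
      using \<gamma> by (auto simp: analytic_arc_def isCont_def tendsto_nhds_iff)
    from eventually_compose_filterlim[OF bound this]
    have "\<forall>\<^sub>F t in nhds 0. \<bar>(g \<circ> \<gamma>) t\<bar> \<le> (B * (2 * norm h) ^ (m - 1)) * \<bar>t\<bar> ^ (m - 1)"
      by eventually_elim (simp add: \<gamma>_def power_mult_distrib mult_ac)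
    then show "enat (m - 1) \<le> ord_t (g \<circ> \<gamma>)"
      by (rule ord_t_geI[OF analytic_along_arc[OF \<gamma> Jan[OF g]]])
  qed
  then have 1: "ereal (real (m - 1)) \<le> ereal_of_enat (arc_order \<gamma> (jacobian_ideal \<Gamma>))"
    by (metis ereal_of_enat_le_iff ereal_of_enat_simps(1))
  have "1 / 2 \<le> real (m - 1) / real k"
  proof -
    have "real k \<le> 2 * real (m - 1)" using km m2 by linarith
    then show ?thesis using k(1) by (simp add: field_simps)
  qed
  then have "ereal (1 / 2) \<le> ereal (real (m - 1)) / ereal (real k)" using k(1) by simp
  also have "\<dots> \<le> arc_ratio \<Gamma> (jacobian_ideal \<Gamma>) \<gamma>"
    using 1 k by (cases "arc_order \<gamma> (jacobian_ideal \<Gamma>)") (auto intro: divide_right_mono)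
  also have "\<dots> \<le> ?SUP" by (rule SUP_upper) (use \<gamma> nz\<gamma> in simp)
  finally show ?thesis .
qed

section \<open>The exponent as a maximum over the divisor\<close>

theorem theorem3p4:
  fixes pair :: "'y::banach \<Rightarrow> 'x::banach \<Rightarrow> real"
    and U K Z :: "'x set"
    and E :: "'x \<Rightarrow> real"
    and M L :: "'x \<Rightarrow> 'y"
    and YK :: "'y set"
    and R :: "'y \<Rightarrow> 'y"
    and \<psi> :: "'x \<Rightarrow> 'x"
    and \<kappa> :: "real ^ 'r \<Rightarrow> 'x"
    and \<Gamma> :: "real ^ 'r \<Rightarrow> real"
    and A :: "('m::{t2_space,second_countable_topology} set \<times> ('m \<Rightarrow> real ^ 'r)) set"
    and W :: "(real ^ 'r) set"
    and \<pi> :: "'m \<Rightarrow> real ^ 'r"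
    and D :: "'m set set"
    and ord_\<Gamma> ord_J :: "'m set \<Rightarrow> nat"
  assumes pairing: "bounded_bilinear pair"
    and U: "open U" "0 \<in> U"
    and E: "\<forall>x\<in>U. real_analytic_at E x" "E 0 = 0" "(E has_derivative (\<lambda>v. 0)) (at 0)"
    and M: "\<forall>x\<in>U. real_analytic_at M x"
    and gradient: "\<forall>x\<in>U. (E has_derivative (\<lambda>v. pair (M x) v)) (at x)"
    and L: "(M has_derivative L) (at 0)" "fredholm L"
    and K: "K = {x. L x = 0}"
    and Z: "closed_complement K Z"
    and YK: "YK = annihilator pair Z"
    and R: "splitting_projection R (range L) YK"
    and \<rho>: "bij_betw (\<lambda>y. restrict (pair y) K) YK (dual_space K)"
    and \<kappa>: "linear \<kappa>" "inj \<kappa>" "range \<kappa> = K"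
    and \<psi>: "real_analytic_at (\<lambda>x. \<psi> (\<kappa> x)) 0" "\<psi> 0 = 0"
      "\<forall>\<^sub>F x in nhds 0. \<psi> (\<kappa> x) \<in> Z \<and> R (M (\<kappa> x + \<psi> (\<kappa> x))) = 0"
    and \<Gamma>: "\<Gamma> = (\<lambda>x. E (\<kappa> x + \<psi> (\<kappa> x)))"
    and \<Gamma>_nonzero: "\<not> (\<forall>\<^sub>F x in nhds 0. \<Gamma> x = 0)"
    and principalization: "common_principalization \<Gamma> A W \<pi> D ord_\<Gamma> ord_J"
  shows "LS_exponent E M = lojasiewicz_exponent \<Gamma> (jacobian_ideal \<Gamma>) \<and>
    LS_exponent E M =
      (SUP \<gamma>\<in>{\<gamma>. analytic_arc \<gamma> \<and> \<not> (\<forall>\<^sub>F t in nhds 0. \<Gamma> (\<gamma> t) = 0)}.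
        ereal_of_enat (arc_order \<gamma> (jacobian_ideal \<Gamma>)) / ereal_of_enat (arc_order \<gamma> {\<Gamma>})) \<and>
    finite {F\<in>D. 0 \<in> \<pi> ` F} \<and>
    LS_exponent E M =
      ereal (Max ((\<lambda>F. real (ord_J F) / real (ord_\<Gamma> F)) ` {F\<in>D. 0 \<in> \<pi> ` F \<and> 0 < ord_\<Gamma> F})) \<and>
    (\<exists>\<theta>\<in>\<rat>. LS_exponent E M = ereal \<theta>) \<and>
    (\<exists>F\<in>D. 0 \<in> \<pi> ` F \<and> 0 < ord_\<Gamma> F \<and>
      LS_exponent E M = ereal (real (ord_J F) / real (ord_\<Gamma> F)))"
proof -
  have closed: "closed (range L)" using L(2) by (simp add: fredholm_def)
  interpret LS: lyapunov_schmidt pair U K Z E M L YK R \<psi> \<kappa> \<Gamma>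
    by (rule lyapunov_schmidt.intro[OF pairing U E(1,2) M gradient L(1) closed K Z YK R \<rho> \<kappa> \<psi> \<Gamma>])
  interpret pr: principalized \<Gamma> A W \<pi> D ord_\<Gamma> ord_J
  proof
    show "common_principalization \<Gamma> A W \<pi> D ord_\<Gamma> ord_J" by (rule principalization)
    show "\<Gamma> 0 = 0" by (rule LS.\<Gamma>_0)
    show "\<exists>C>0. \<forall>\<^sub>F x in nhds 0. \<exists>G. (\<Gamma> has_derivative G) (at x) \<and>
          (\<forall>v. \<bar>G v\<bar> \<le> C * grad_size \<Gamma> x * norm v)"
      by (rule LS.\<Gamma>_derivative_bound) blast
  qed
  let ?SUP = "SUP \<gamma>\<in>nonzero_arcs \<Gamma>. arc_ratio \<Gamma> (jacobian_ideal \<Gamma>) \<gamma>"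
  define S where "S = {F\<in>D. 0 \<in> \<pi> ` F \<and> 0 < ord_\<Gamma> F}"
  define Q where "Q = (\<lambda>F. real (ord_J F) / real (ord_\<Gamma> F)) ` S"
  define \<theta> where "\<theta> = Max Q"
  have fin: "finite {F\<in>D. 0 \<in> \<pi> ` F}" by (rule pr.finite_components)
  then have finQ: "finite Q" unfolding Q_def S_def by (intro finite_imageI) (rule finite_subset, auto)
  obtain p F where "\<pi> p = 0" "F \<in> D" "p \<in> F" "0 < ord_\<Gamma> F" by (rule pr.component_exists)
  then have "F \<in> S" unfolding S_def by (auto intro: rev_image_eqI)
  then have "Q \<noteq> {}" unfolding Q_def by blast
  then have "\<theta> \<in> Q" unfolding \<theta>_def using finQ by (intro Max_in)
  then obtain F where F: "F \<in> S" "\<theta> = real (ord_J F) / real (ord_\<Gamma> F)" unfolding Q_def by blast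
  have exps: "(0 < ord_J F' \<longrightarrow> 0 < ord_\<Gamma> F') \<and> (0 < ord_\<Gamma> F' \<longrightarrow> ord_J F' < ord_\<Gamma> F')"
    if F': "F' \<in> D" "0 \<in> \<pi> ` F'" for F'
  proof -
    obtain p where "\<pi> p = 0" "p \<in> F'" using F'(2) by auto
    then show ?thesis using pr.exponents[OF _ F'(1)] by blast
  qed
  have \<theta>1: "\<theta> < 1" using exps[of F] F by (auto simp: S_def)
  have \<theta>0: "0 \<le> \<theta>" using F(2) by simp
  have le: "real (ord_J F') \<le> \<theta> * real (ord_\<Gamma> F')" if "F' \<in> D" "0 \<in> \<pi> ` F'" for F'
  proof (cases "0 < ord_\<Gamma> F'")
    case True
    then have "real (ord_J F') / real (ord_\<Gamma> F') \<in> Q" using that unfolding Q_def S_def by blast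
    then have "real (ord_J F') / real (ord_\<Gamma> F') \<le> \<theta>" unfolding \<theta>_def using finQ by (intro Max_ge)
    then show ?thesis using True by (simp add: field_simps)
  next
    case False
    then show ?thesis using exps[OF that] by simp
  qed
  obtain C where C: "0 < C" "\<forall>\<^sub>F x in nhds 0. C * \<bar>\<Gamma> x\<bar> powr \<theta> \<le> grad_size \<Gamma> x"
    by (rule pr.gradient_inequality[OF \<theta>0 le]) (assumption, assumption, rule that)
  have SUP_le: "?SUP \<le> ereal \<theta>'"
    if "0 \<le> \<theta>'" "0 < C'" "\<forall>\<^sub>F x in nhds 0. C' * \<bar>\<Gamma> x\<bar> powr \<theta>' \<le> grad_size \<Gamma> x" for \<theta>' C'
  proof (rule SUP_least)
    fix \<gamma> assume "\<gamma> \<in> nonzero_arcs \<Gamma>"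
    then have "analytic_arc \<gamma>" "\<not> (\<forall>\<^sub>F t in nhds 0. \<Gamma> (\<gamma> t) = 0)" by auto
    from arc_ratio_le[OF this LS.\<Gamma>_analytic LS.\<Gamma>_0 LS.finite_jacobian LS.jacobian_analytic that]
    show "arc_ratio \<Gamma> (jacobian_ideal \<Gamma>) \<gamma> \<le> ereal \<theta>'" .
  qed
  have SUP: "?SUP = ereal \<theta>"
  proof (rule antisym)
    show "?SUP \<le> ereal \<theta>" by (rule SUP_le[OF \<theta>0 C])
    show "ereal \<theta> \<le> ?SUP"
      using pr.divisorial_ratio_le_SUP[OF LS.\<Gamma>_analytic LS.jacobian_analytic, of F] F by (simp add: S_def)
  qed
  have d0: "(\<Gamma> has_derivative (\<lambda>_. 0)) (at 0)"
  proof -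
    have "(E has_derivative (\<lambda>v. pair (M 0) v)) (at 0)" using gradient U(2) by blast
    then have "(\<lambda>v. pair (M 0) v) = (\<lambda>v. 0)" using E(3) by (rule has_derivative_unique)
    moreover have "(\<Gamma> has_derivative (\<lambda>v. pair (M (LS.P 0)) (\<kappa> v))) (at 0)"
      using LS.\<Gamma>_has_derivative by (rule eventually_nhds_x_imp_x)
    ultimately show ?thesis by (simp add: LS.P_0 fun_eq_iff)
  qed
  have "\<forall>\<^sub>F x in nhds 0. \<exists>G. (\<Gamma> has_derivative G) (at x)"
    using LS.\<Gamma>_has_derivative by eventually_elim blast
  from half_le_SUP[OF LS.\<Gamma>_analytic LS.\<Gamma>_0 d0 \<Gamma>_nonzero this LS.jacobian_analytic]
  have half: "1 / 2 \<le> \<theta>" unfolding SUP by simp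
  let ?T = "{\<theta>. 1 / 2 \<le> \<theta> \<and> \<theta> < 1 \<and>
        (\<exists>C>0. \<forall>\<^sub>F x in nhds 0. norm (M x) \<ge> C * \<bar>E x\<bar> powr \<theta>)}"
  have LS: "LS_exponent E M = ereal \<theta>"
    unfolding LS_exponent_def
  proof (rule antisym)
    have "\<exists>C>0. \<forall>\<^sub>F x in nhds 0. norm (M x) \<ge> C * \<bar>E x\<bar> powr \<theta>"
      by (rule LS.lifted_inequality[OF half less_imp_le[OF \<theta>1] C]) blast
    then have "\<theta> \<in> ?T"
      using half \<theta>1 by simp
    then show "Inf (ereal ` ?T) \<le> ereal \<theta>"
      by (intro Inf_lower imageI)
    show "ereal \<theta> \<le> Inf (ereal ` ?T)"
    proof (rule Inf_greatest)
      fix z assume "z \<in> ereal ` ?T"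
      then obtain \<theta>' C' where \<theta>': "z = ereal \<theta>'" "1 / 2 \<le> \<theta>'" "0 < C'"
        "\<forall>\<^sub>F x in nhds 0. norm (M x) \<ge> C' * \<bar>E x\<bar> powr \<theta>'" by blast
      have \<theta>'0: "0 \<le> \<theta>'" using \<theta>'(2) by simp
      obtain C'' where "0 < C''" "\<forall>\<^sub>F a in nhds 0. C'' * \<bar>\<Gamma> a\<bar> powr \<theta>' \<le> grad_size \<Gamma> a"
        by (rule LS.reduced_inequality[OF \<theta>'(3,4)]) (rule that)
      from SUP_le[OF \<theta>'0 this] show "ereal \<theta> \<le> z" unfolding SUP \<theta>'(1) .
    qed
  qed
  have "lojasiewicz_exponent \<Gamma> (jacobian_ideal \<Gamma>) = ereal \<theta>"
    by (rule lojasiewicz_exponent_eq_SUP[OF LS.\<Gamma>_analytic LS.\<Gamma>_0 LS.finite_jacobian LS.jacobian_analytic SUP])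
       (use half in auto)
  moreover have "\<theta> \<in> \<rat>" unfolding F(2) by simp
  ultimately show ?thesis
    unfolding LS SUP using fin F \<theta>_def by (auto simp: S_def Q_def)
qed

end
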